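(* Let $a\in L^\infty_{\mathrm{loc}}([0,\infty))$ with $a(x)\ge 0$ for almost all $x>0$, let $b:(0,\infty)^2\to[0,\infty)$ be measurable with $b(x,y)=0$ for almost all $x,y$ with $x>y$, and let $\omega:[0,\infty)\to[0,\infty)$ be measurable. Assume that there exists $\kappa\in(0,1]$ such that $$\int_0^y b(x,y)\omega(x)\,\mathrm{d}x\le\kappa\,\omega(y)\qquad\text{for all } y>0.$$ Let $A^{(\omega)}$ and $B^{(\omega)}$ be the operators in $X_\omega$ defined in the context. Then $G^{(\omega)}=\overline{A^{(\omega)}+B^{(\omega)}}$ (the closure of $A^{(\omega)}+B^{(\omega)}$) is the generator of a substochastic $C_0$-semigroup $(S^{(\omega)}(t))_{t\ge0}$ on $X_\omega$. Moreover, if $c:[0,\infty)\to\mathbb{R}$ is non-decreasing and satisfies $a(x)\le c(x)$ for almost every $x\in[0,\infty)$, and $\widetilde\omega=(1+c)\omega$, then $(S^{(\omega)}(t))_{t\ge0}$ leaves $X_{\widetilde\omega}$ invariant, i.e. $S^{(\omega)}(t)X_{\widetilde\omega}\subseteq X_{\widetilde\omega}$ for all $t\ge0$.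
   Context: For a non-negative measurable function $\omega$ on $[0,\infty)$, $X_\omega = L^1((0,\infty),\omega(x)\,\mathrm{d}x)$ is the real Banach space with norm $\|f\|_\omega=\int_0^\infty|f(x)|\omega(x)\,\mathrm{d}x$, ordered by the pointwise almost-everywhere order. $X_{\widetilde\omega}$ is defined in the same way with $\widetilde\omega$ in place of $\omega$. The operators in $X_\omega$ are $A^{(\omega)}f=-af$ with domain $\mathcal{D}(A^{(\omega)})=\{f\in X_\omega: af\in X_\omega\}$, and $(B^{(\omega)}f)(x)=\int_x^\infty a(y)b(x,y)f(y)\,\mathrm{d}y$ for $x>0$, with domain $\mathcal{D}(B^{(\omega)})=\{f\in X_\omega: B^{(\omega)}f\in X_\omega\}$. The sum $A^{(\omega)}+B^{(\omega)}$ has domain $\mathcal{D}(A^{(\omega)})\cap\mathcal{D}(B^{(\omega)})$. A $C_0$-semigroup $(S(t))_{t\ge0}$ on $X_\omega$ is positive if $S(t)f\ge0$ for all $f\ge0$ and $t\ge0$; a positive semigroup is substochastic if $\|S(t)\|\le1$ for all $t\ge0$. *)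

theory Defs
  imports "HOL-Analysis.Analysis"
begin

section \<open>The real Banach space \<open>L\<^sup>1(M)\<close>\<close>

text \<open>
  Elements of \<open>L\<^sup>1(M)\<close> are represented by integrable functions, and two of them are equal as
  elements of the space iff they agree almost everywhere. Operators with a domain are
  represented by their graphs, which are sets of pairs of such functions; every graph below is
  closed under replacing the second component by an almost everywhere equal one.
\<close>

definition L1 :: "'a measure \<Rightarrow> ('a \<Rightarrow> real) set" where
  "L1 M = {f. integrable M f}"

definition L1_norm :: "'a measure \<Rightarrow> ('a \<Rightarrow> real) \<Rightarrow> real" where
  "L1_norm M f = (\<integral>x. \<bar>f x\<bar> \<partial>M)"

definition L1_eq :: "'a measure \<Rightarrow> ('a \<Rightarrow> real) \<Rightarrow> ('a \<Rightarrow> real) \<Rightarrow> bool" where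
  "L1_eq M f g \<longleftrightarrow> (AE x in M. f x = g x)"

definition L1_nonneg :: "'a measure \<Rightarrow> ('a \<Rightarrow> real) \<Rightarrow> bool" where
  "L1_nonneg M f \<longleftrightarrow> (AE x in M. 0 \<le> f x)"

definition bounded_operator :: "'a measure \<Rightarrow> (('a \<Rightarrow> real) \<Rightarrow> ('a \<Rightarrow> real)) \<Rightarrow> bool" where
  "bounded_operator M T \<longleftrightarrow>
     (\<forall>f\<in>L1 M. T f \<in> L1 M) \<and>
     (\<forall>f\<in>L1 M. \<forall>g\<in>L1 M. L1_eq M f g \<longrightarrow> L1_eq M (T f) (T g)) \<and>
     (\<forall>f\<in>L1 M. \<forall>g\<in>L1 M. L1_eq M (T (\<lambda>x. f x + g x)) (\<lambda>x. T f x + T g x)) \<and>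
     (\<forall>r. \<forall>f\<in>L1 M. L1_eq M (T (\<lambda>x. r * f x)) (\<lambda>x. r * T f x)) \<and>
     (\<exists>C. \<forall>f\<in>L1 M. L1_norm M (T f) \<le> C * L1_norm M f)"


section \<open>Sum and closure of operators\<close>

text \<open>The domain of the sum is the intersection of the domains.\<close>

definition operator_sum ::
  "'a measure \<Rightarrow> (('a \<Rightarrow> real) \<times> ('a \<Rightarrow> real)) set \<Rightarrow> (('a \<Rightarrow> real) \<times> ('a \<Rightarrow> real)) set \<Rightarrow>
     (('a \<Rightarrow> real) \<times> ('a \<Rightarrow> real)) set" where
  "operator_sum M T U =
     {(f, h). h \<in> L1 M \<and>
        (\<exists>g1 g2. (f, g1) \<in> T \<and> (f, g2) \<in> U \<and> L1_eq M h (\<lambda>x. g1 x + g2 x))}"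

text \<open>
  The closure of the graph in \<open>L\<^sup>1(M) \<times> L\<^sup>1(M)\<close>. When this set is the graph of a (single-valued)
  operator, for example of a generator, the operator \<open>T\<close> is closable and the set is the graph of
  its closure.
\<close>

definition operator_closure ::
  "'a measure \<Rightarrow> (('a \<Rightarrow> real) \<times> ('a \<Rightarrow> real)) set \<Rightarrow> (('a \<Rightarrow> real) \<times> ('a \<Rightarrow> real)) set" where
  "operator_closure M T =
     {(f, g). f \<in> L1 M \<and> g \<in> L1 M \<and>
        (\<exists>F G. (\<forall>n::nat. (F n, G n) \<in> T) \<and>
           (\<lambda>n. L1_norm M (\<lambda>x. F n x - f x)) \<longlonglongrightarrow> 0 \<and>
           (\<lambda>n. L1_norm M (\<lambda>x. G n x - g x)) \<longlonglongrightarrow> 0)}"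


section \<open>Strongly continuous semigroups\<close>

text \<open>Only the values \<open>S t\<close> for \<open>t \<ge> 0\<close> are relevant.\<close>

definition C0_semigroup :: "'a measure \<Rightarrow> (real \<Rightarrow> ('a \<Rightarrow> real) \<Rightarrow> ('a \<Rightarrow> real)) \<Rightarrow> bool" where
  "C0_semigroup M S \<longleftrightarrow>
     (\<forall>t\<ge>0. bounded_operator M (S t)) \<and>
     (\<forall>f\<in>L1 M. L1_eq M (S 0 f) f) \<and>
     (\<forall>s\<ge>0. \<forall>t\<ge>0. \<forall>f\<in>L1 M. L1_eq M (S (s + t) f) (S s (S t f))) \<and>
     (\<forall>f\<in>L1 M. ((\<lambda>t. L1_norm M (\<lambda>x. S t f x - f x)) \<longlongrightarrow> 0) (at_right 0))"

definition positive_semigroup :: "'a measure \<Rightarrow> (real \<Rightarrow> ('a \<Rightarrow> real) \<Rightarrow> ('a \<Rightarrow> real)) \<Rightarrow> bool" where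
  "positive_semigroup M S \<longleftrightarrow>
     C0_semigroup M S \<and> (\<forall>t\<ge>0. \<forall>f\<in>L1 M. L1_nonneg M f \<longrightarrow> L1_nonneg M (S t f))"

definition substochastic_semigroup ::
  "'a measure \<Rightarrow> (real \<Rightarrow> ('a \<Rightarrow> real) \<Rightarrow> ('a \<Rightarrow> real)) \<Rightarrow> bool" where
  "substochastic_semigroup M S \<longleftrightarrow>
     positive_semigroup M S \<and> (\<forall>t\<ge>0. \<forall>f\<in>L1 M. L1_norm M (S t f) \<le> L1_norm M f)"

definition semigroup_generator ::
  "'a measure \<Rightarrow> (real \<Rightarrow> ('a \<Rightarrow> real) \<Rightarrow> ('a \<Rightarrow> real)) \<Rightarrow> (('a \<Rightarrow> real) \<times> ('a \<Rightarrow> real)) set" where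
  "semigroup_generator M S =
     {(f, g). f \<in> L1 M \<and> g \<in> L1 M \<and>
        ((\<lambda>t. L1_norm M (\<lambda>x. (S t f x - f x) / t - g x)) \<longlongrightarrow> 0) (at_right 0)}"


section \<open>The weighted spaces and the fragmentation operators\<close>

text \<open>
  The measure \<open>w(x) dx\<close> on \<open>(0,\<infinity>)\<close>, so that \<open>L1 (weighted w)\<close> is \<open>X\<^sub>w\<close>. As \<open>w\<close> may vanish on a
  set of positive Lebesgue measure, ``almost everywhere'' in this space refers to \<open>w(x) dx\<close>,
  which is what makes \<open>L1_norm\<close> a norm modulo \<open>L1_eq\<close>.
\<close>

definition weighted :: "(real \<Rightarrow> real) \<Rightarrow> real measure" where
  "weighted w = density (lebesgue_on {0<..}) (\<lambda>x. ennreal (w x))"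

definition locally_Linf :: "real set \<Rightarrow> (real \<Rightarrow> real) \<Rightarrow> bool" where
  "locally_Linf S f \<longleftrightarrow>
     f \<in> borel_measurable (lebesgue_on S) \<and>
     (\<forall>K. compact K \<and> K \<subseteq> S \<longrightarrow> (\<exists>C. AE x in lebesgue_on K. \<bar>f x\<bar> \<le> C))"

definition frag_A :: "(real \<Rightarrow> real) \<Rightarrow> (real \<Rightarrow> real) \<Rightarrow> ((real \<Rightarrow> real) \<times> (real \<Rightarrow> real)) set" where
  "frag_A w a =
     {(f, g). f \<in> L1 (weighted w) \<and> g \<in> L1 (weighted w) \<and>
        (\<lambda>x. a x * f x) \<in> L1 (weighted w) \<and> L1_eq (weighted w) g (\<lambda>x. - (a x * f x))}"

definition frag_integral ::
  "(real \<Rightarrow> real) \<Rightarrow> (real \<Rightarrow> real \<Rightarrow> real) \<Rightarrow> (real \<Rightarrow> real) \<Rightarrow> real \<Rightarrow> real" where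
  "frag_integral a b f x = (LINT y:{x<..}|lebesgue. a y * b x y * f y)"

text \<open>
  The Bochner integral is \<open>0\<close> for non-integrable functions. Membership in the domain of \<open>B\<close>
  therefore has to say explicitly that the integral exists for almost every \<open>x\<close>.
\<close>

definition frag_B ::
  "(real \<Rightarrow> real) \<Rightarrow> (real \<Rightarrow> real) \<Rightarrow> (real \<Rightarrow> real \<Rightarrow> real) \<Rightarrow> ((real \<Rightarrow> real) \<times> (real \<Rightarrow> real)) set" where
  "frag_B w a b =
     {(f, g). f \<in> L1 (weighted w) \<and> g \<in> L1 (weighted w) \<and>
        (AE x in weighted w. set_integrable lebesgue {x<..} (\<lambda>y. a y * b x y * f y)) \<and>
        frag_integral a b f \<in> L1 (weighted w) \<and> L1_eq (weighted w) g (frag_integral a b f)}"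

end

theory Submission
  imports Defs
begin

text \<open>
  Fragmentation moves mass from \<open>y\<close> to \<open>x < y\<close> only, so \<open>A + B\<close> leaves the space of functions
  living on \<open>(0, n)\<close> invariant. There \<open>a\<close> is bounded by some \<open>C\<close>, and \<open>A + B = C (R - 1)\<close> for a
  positive contraction \<open>R\<close>; hence \<open>exp (t (A + B))\<close> is a limit of convex combinations of powers of
  \<open>R\<close> and preserves every closed convex set preserved by \<open>R\<close>. These semigroups are consistent for
  different \<open>n\<close> and extend by density to a contraction semigroup. Its generator is the closure of
  \<open>A + B\<close>: the resolvent equation \<open>u - (A + B) u = h\<close> is solvable for all \<open>h\<close> living on some
  \<open>(0, n)\<close>, and generators of contraction semigroups are dissipative. Positivity, contractivity
  and the invariance of the space with weight \<open>(1 + c) \<omega>\<close> are all preservation statements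
  about closed convex sets.
\<close>

section \<open>The Banach space of Lebesgue integrable functions\<close>

\<comment> \<open>A Banach space given as a type cannot depend on the weight \<omega>. Hence f is
  replaced by f \<omega>, which embeds the weighted space isometrically into the one space of
  integrable functions on the line. There A keeps its form, and the kernel of B becomes a(y) b(x,y)
  \<omega>(x) / \<omega>(y). The assumption on b bounds its column integrals by \<kappa> a(y) \<le>
  a(y): gain never exceeds loss, and this is what makes R a contraction. Points with \<omega>(y) = 0
  are harmless, since there the assumption forces b(x,y) \<omega>(x) = 0 for almost all x < y, so
  that 0 is the right value of the quotient. The obstacle is that a may be unbounded. A limit of
  cut-off problems always has some generator, but this could be a proper extension of the closure of
  A + B. It is not, because a cut-off resolvent equation is solved by a function that lives on (0,
  n) again, where A + B and the cut-off operator coincide.\<close>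
quotient_type (overloaded) 'a l1 = "'a::euclidean_space \<Rightarrow> real" / partial:
  "\<lambda>f g. integrable lborel f \<and> integrable lborel g \<and> (AE x in lborel. f x = g x)"
proof (rule part_equivpI)
  show "\<exists>f::'a \<Rightarrow> real. integrable lborel f \<and> integrable lborel f \<and> (AE x in lborel. f x = f x)"
    by (intro exI[of _ "\<lambda>_. 0"]) simp
  show "symp (\<lambda>f g::'a \<Rightarrow> real. integrable lborel f \<and> integrable lborel g \<and> (AE x in lborel. f x = g x))"
    by (intro sympI) (simp add: eq_commute)
  show "transp (\<lambda>f g::'a \<Rightarrow> real. integrable lborel f \<and> integrable lborel g \<and> (AE x in lborel. f x = g x))"
  proof (intro transpI conjI)
    fix f g h :: "'a \<Rightarrow> real"
    assume "integrable lborel f \<and> integrable lborel g \<and> (AE x in lborel. f x = g x)"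
      and "integrable lborel g \<and> integrable lborel h \<and> (AE x in lborel. g x = h x)"
    then have "AE x in lborel. f x = g x" "AE x in lborel. g x = h x" by auto
    then show "AE x in lborel. f x = h x" by eventually_elim simp
  qed auto
qed

lemma integrable_rep_l1 [simp, intro]: "integrable lborel (rep_l1 u)"
  using Quotient3_rep_reflp[OF Quotient3_l1, of u] by simp

lemma borel_measurable_rep_l1 [measurable]: "rep_l1 u \<in> borel_measurable borel"
  using borel_measurable_integrable[OF integrable_rep_l1] by simp

lemma abs_rep_l1 [simp]: "abs_l1 (rep_l1 u) = u"
  by (rule Quotient3_abs_rep[OF Quotient3_l1])

lemma rep_abs_l1:
  assumes "integrable lborel f"
  shows "AE x in lborel. rep_l1 (abs_l1 f) x = f x"
  using Quotient3_rep_abs[OF Quotient3_l1, of f] assms by simp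

lemma abs_l1_eq_iff:
  assumes "integrable lborel f" "integrable lborel g"
  shows "abs_l1 f = abs_l1 g \<longleftrightarrow> (AE x in lborel. f x = g x)"
  using Quotient3_rel[OF Quotient3_l1, of f g] assms by simp

lemma l1_eq_iff: "u = v \<longleftrightarrow> (AE x in lborel. rep_l1 u x = rep_l1 v x)"
  using abs_l1_eq_iff[of "rep_l1 u" "rep_l1 v"] by simp

instantiation l1 :: (euclidean_space) real_normed_vector
begin

lift_definition zero_l1 :: "'a l1" is "\<lambda>_. 0"
  by simp

lift_definition plus_l1 :: "'a l1 \<Rightarrow> 'a l1 \<Rightarrow> 'a l1" is "\<lambda>f g x. f x + g x"
  by auto

lift_definition minus_l1 :: "'a l1 \<Rightarrow> 'a l1 \<Rightarrow> 'a l1" is "\<lambda>f g x. f x - g x"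
  by auto

lift_definition uminus_l1 :: "'a l1 \<Rightarrow> 'a l1" is "\<lambda>f x. - f x"
  by auto

lift_definition scaleR_l1 :: "real \<Rightarrow> 'a l1 \<Rightarrow> 'a l1" is "\<lambda>r f x. r * f x"
  by auto

lift_definition norm_l1 :: "'a l1 \<Rightarrow> real" is "\<lambda>f. \<integral>x. \<bar>f x\<bar> \<partial>lborel"
  by (rule integral_cong_AE) auto

definition dist_l1 :: "'a l1 \<Rightarrow> 'a l1 \<Rightarrow> real" where "dist_l1 u v = norm (u - v)"

definition sgn_l1 :: "'a l1 \<Rightarrow> 'a l1" where "sgn_l1 u = inverse (norm u) *\<^sub>R u"

definition uniformity_l1 :: "('a l1 \<times> 'a l1) filter" where
  "uniformity_l1 = (INF e\<in>{0 <..}. principal {(x, y). dist x y < e})"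

definition open_l1 :: "'a l1 set \<Rightarrow> bool" where
  "open_l1 S \<longleftrightarrow> (\<forall>x\<in>S. \<forall>\<^sub>F (x', y) in uniformity. x' = x \<longrightarrow> y \<in> S)"

instance
proof
  fix u v w :: "'a l1" and r s :: real
  show "u + v + w = u + (v + w)" by transfer (auto simp: add.assoc)
  show "u + v = v + u" by transfer (auto simp: add.commute)
  show "0 + u = u" by transfer auto
  show "- u + u = 0" by transfer auto
  show "u - v = u + - v" by transfer auto
  show "r *\<^sub>R (u + v) = r *\<^sub>R u + r *\<^sub>R v" by transfer (auto simp: algebra_simps)
  show "(r + s) *\<^sub>R u = r *\<^sub>R u + s *\<^sub>R u" by transfer (auto simp: algebra_simps)
  show "r *\<^sub>R s *\<^sub>R u = (r * s) *\<^sub>R u" by transfer (auto simp: algebra_simps)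
  show "1 *\<^sub>R u = u" by transfer auto
  show "norm (r *\<^sub>R u) = \<bar>r\<bar> * norm u" by transfer (simp add: abs_mult)
  show "norm u = 0 \<longleftrightarrow> u = 0"
    by transfer (auto simp: integral_nonneg_eq_0_iff_AE)
  show "norm (u + v) \<le> norm u + norm v"
  proof transfer
    fix f g :: "'a \<Rightarrow> real"
    assume "integrable lborel f \<and> integrable lborel f \<and> (AE x in lborel. f x = f x)"
      and "integrable lborel g \<and> integrable lborel g \<and> (AE x in lborel. g x = g x)"
    then have [simp]: "integrable lborel f" "integrable lborel g" by auto
    have "(\<integral>x. \<bar>f x + g x\<bar> \<partial>lborel) \<le> (\<integral>x. \<bar>f x\<bar> + \<bar>g x\<bar> \<partial>lborel)"
      by (intro integral_mono) auto
    then show "(\<integral>x. \<bar>f x + g x\<bar> \<partial>lborel) \<le> (\<integral>x. \<bar>f x\<bar> \<partial>lborel) + (\<integral>x. \<bar>g x\<bar> \<partial>lborel)"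
      by simp
  qed
qed (simp_all only: dist_l1_def sgn_l1_def uniformity_l1_def open_l1_def)

end

lemma norm_abs_l1: "integrable lborel f \<Longrightarrow> norm (abs_l1 f) = (\<integral>x. \<bar>f x\<bar> \<partial>lborel)"
  by (simp add: norm_l1.abs_eq)

lemma norm_l1_rep: "norm u = (\<integral>x. \<bar>rep_l1 u x\<bar> \<partial>lborel)"
  using norm_abs_l1[of "rep_l1 u"] by simp

lemma abs_l1_add: "\<lbrakk>integrable lborel f; integrable lborel g\<rbrakk> \<Longrightarrow> abs_l1 f + abs_l1 g = abs_l1 (\<lambda>x. f x + g x)"
  by (simp add: plus_l1.abs_eq)

lemma abs_l1_diff: "\<lbrakk>integrable lborel f; integrable lborel g\<rbrakk> \<Longrightarrow> abs_l1 f - abs_l1 g = abs_l1 (\<lambda>x. f x - g x)"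
  by (simp add: minus_l1.abs_eq)

lemma abs_l1_scaleR: "integrable lborel f \<Longrightarrow> r *\<^sub>R abs_l1 f = abs_l1 (\<lambda>x. r * f x)"
  by (simp add: scaleR_l1.abs_eq)

lemma rep_l1_add: "AE x in lborel. rep_l1 (u + v) x = rep_l1 u x + rep_l1 v x"
  using rep_abs_l1[of "\<lambda>x. rep_l1 u x + rep_l1 v x"] abs_l1_add[of "rep_l1 u" "rep_l1 v"] by simp

lemma rep_l1_diff: "AE x in lborel. rep_l1 (u - v) x = rep_l1 u x - rep_l1 v x"
  using rep_abs_l1[of "\<lambda>x. rep_l1 u x - rep_l1 v x"] abs_l1_diff[of "rep_l1 u" "rep_l1 v"] by simp

lemma rep_l1_scaleR: "AE x in lborel. rep_l1 (r *\<^sub>R u) x = r * rep_l1 u x"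
  using rep_abs_l1[of "\<lambda>x. r * rep_l1 u x"] abs_l1_scaleR[of "rep_l1 u" r] by simp

lemma nn_integral_rep_l1: "(\<integral>\<^sup>+x. ennreal \<bar>rep_l1 u x\<bar> \<partial>lborel) = ennreal (norm u)"
  unfolding norm_l1_rep by (rule nn_integral_eq_integral) auto

text \<open>The Riesz-Fischer argument: the increments have summable norms, so their absolute values
  have an integrable sum, finite almost everywhere. The telescoping series then converges pointwise
  and, dominated by twice that sum, in norm.\<close>

lemma l1_fast_convergent:
  fixes X :: "nat \<Rightarrow> 'a::euclidean_space l1"
  assumes sm: "summable (\<lambda>n. norm (X (Suc n) - X n))"
  shows "convergent X"
proof -
  define f where "f k = rep_l1 (X (Suc k) - X k)" for k
  have [measurable]: "f k \<in> borel_measurable borel" for k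
    unfolding f_def by measurable
  have int_f [simp]: "integrable lborel (f k)" for k
    by (simp add: f_def)
  have sm_norm: "summable (\<lambda>k. \<integral>x. norm (f k x) \<partial>lborel)"
    using sm by (simp add: f_def norm_l1_rep)
  have "(\<integral>\<^sup>+x. (\<Sum>k. ennreal (norm (f k x))) \<partial>lborel) = (\<Sum>k. \<integral>\<^sup>+x. ennreal (norm (f k x)) \<partial>lborel)"
    by (rule nn_integral_suminf) measurable
  also have "\<dots> = (\<Sum>k. ennreal (norm (X (Suc k) - X k)))"
    by (simp add: f_def nn_integral_rep_l1)
  also have "\<dots> = ennreal (\<Sum>k. norm (X (Suc k) - X k))"
    using sm by (intro suminf_ennreal2) auto
  finally have fin: "(\<integral>\<^sup>+x. (\<Sum>k. ennreal (norm (f k x))) \<partial>lborel) \<noteq> \<infinity>"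
    by simp
  then have "AE x in lborel. (\<Sum>k. ennreal (norm (f k x))) \<noteq> \<infinity>"
    by (intro nn_integral_PInf_AE) auto
  then have sm_AE: "AE x in lborel. summable (\<lambda>k. norm (f k x))"
    by eventually_elim (auto intro!: summable_suminf_not_top)
  have int_bound: "integrable lborel (\<lambda>x. \<Sum>k. norm (f k x))"
    by (rule integrable_suminf) (use sm_AE sm_norm in auto)
  define g where "g x = rep_l1 (X 0) x + (\<Sum>k. f k x)" for x
  have int_g: "integrable lborel g"
    unfolding g_def by (intro Bochner_Integration.integrable_add integrable_suminf) (use sm_AE sm_norm in auto)
  have [measurable]: "g \<in> borel_measurable borel"
    using borel_measurable_integrable[OF int_g] by simp
  have X_rep: "AE x in lborel. rep_l1 (X n) x = rep_l1 (X 0) x + (\<Sum>k<n. f k x)" for n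
  proof (induction n)
    case (Suc n)
    have "AE x in lborel. rep_l1 (X (Suc n) - X n) x = rep_l1 (X (Suc n)) x - rep_l1 (X n) x"
      by (rule rep_l1_diff)
    with Suc show ?case by eventually_elim (simp add: f_def)
  qed simp
  have "(\<lambda>n. \<integral>x. \<bar>(\<Sum>k<n. f k x) - (\<Sum>k. f k x)\<bar> \<partial>lborel) \<longlonglongrightarrow> (\<integral>x. (0::real) \<partial>(lborel::'a measure))"
  proof (rule integral_dominated_convergence[where w = "\<lambda>x. 2 * (\<Sum>k. norm (f k x))"])
    show "integrable lborel (\<lambda>x. 2 * (\<Sum>k. norm (f k x)))" using int_bound by simp
    show "AE x in lborel. (\<lambda>n. \<bar>(\<Sum>k<n. f k x) - (\<Sum>k. f k x)\<bar>) \<longlonglongrightarrow> 0"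
      using sm_AE
    proof eventually_elim
      case (elim x)
      then have "(\<lambda>k. f k x) sums (\<Sum>k. f k x)" by (rule summable_sums[OF summable_norm_cancel])
      then have "(\<lambda>n. (\<Sum>k<n. f k x) - (\<Sum>k. f k x)) \<longlonglongrightarrow> 0" unfolding sums_def by (rule LIM_zero)
      then show ?case by (rule tendsto_rabs_zero)
    qed
    fix n
    show "AE x in lborel. norm \<bar>(\<Sum>k<n. f k x) - (\<Sum>k. f k x)\<bar> \<le> 2 * (\<Sum>k. norm (f k x))"
      using sm_AE
    proof eventually_elim
      case (elim x)
      have "\<bar>\<Sum>k<n. f k x\<bar> \<le> (\<Sum>k<n. norm (f k x))" by (simp add: sum_abs)
      also have "\<dots> \<le> (\<Sum>k. norm (f k x))" using elim by (intro sum_le_suminf) auto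
      finally have "\<bar>\<Sum>k<n. f k x\<bar> \<le> (\<Sum>k. norm (f k x))" .
      moreover have "\<bar>\<Sum>k. f k x\<bar> \<le> (\<Sum>k. norm (f k x))" using summable_norm[OF elim] by simp
      ultimately show ?case by simp
    qed
    show "(\<lambda>x. \<bar>(\<Sum>k<n. f k x) - (\<Sum>k. f k x)\<bar>) \<in> borel_measurable lborel"
      by measurable
  qed simp
  moreover have "norm (X n - abs_l1 g) = (\<integral>x. \<bar>(\<Sum>k<n. f k x) - (\<Sum>k. f k x)\<bar> \<partial>lborel)" for n
  proof -
    have "norm (X n - abs_l1 g) = (\<integral>x. \<bar>rep_l1 (X n) x - g x\<bar> \<partial>lborel)"
      using abs_l1_diff[of "rep_l1 (X n)" g] int_g by (simp add: norm_abs_l1)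
    also have "\<dots> = (\<integral>x. \<bar>(\<Sum>k<n. f k x) - (\<Sum>k. f k x)\<bar> \<partial>lborel)"
    proof (rule integral_cong_AE)
      show "AE x in lborel. \<bar>rep_l1 (X n) x - g x\<bar> = \<bar>(\<Sum>k<n. f k x) - (\<Sum>k. f k x)\<bar>"
        using X_rep[of n] by eventually_elim (simp add: g_def)
    qed measurable
    finally show ?thesis .
  qed
  ultimately have "(\<lambda>n. norm (X n - abs_l1 g)) \<longlonglongrightarrow> 0" by (simp only: Bochner_Integration.integral_zero)
  then have "X \<longlonglongrightarrow> abs_l1 g"
    using LIM_zero_cancel tendsto_norm_zero_iff by blast
  then show ?thesis by (rule convergentI)
qed

instance l1 :: (euclidean_space) banach
proof
  fix X :: "nat \<Rightarrow> 'a l1"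
  assume X: "Cauchy X"
  have "\<exists>N. \<forall>m\<ge>N. \<forall>n\<ge>N. norm (X m - X n) < (1/2)^k" for k :: nat
    using CauchyD[OF X, of "(1/2)^k"] by simp
  then obtain N where N: "norm (X m - X n) < (1/2)^k" if "m \<ge> N k" "n \<ge> N k" for k m n
    by metis
  \<comment> \<open>The sum keeps \<open>r k\<close> above \<open>N k\<close>, and the summand
    \<open>k\<close> makes \<open>r\<close> strictly increasing.\<close>
  define r where "r k = (\<Sum>i\<le>k. N i) + k" for k
  have r: "strict_mono r" unfolding strict_mono_Suc_iff r_def by simp
  have ge: "r k \<ge> N k" for k unfolding r_def by (simp add: member_le_sum trans_le_add1)
  have "summable (\<lambda>k. norm (X (r (Suc k)) - X (r k)))"
  proof (rule summable_comparison_test')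
    show "summable (\<lambda>k. (1/2::real)^k)" by (simp add: summable_geometric)
    show "norm (norm (X (r (Suc k)) - X (r k))) \<le> (1/2)^k" if "0 \<le> k" for k
      using N[of k "r (Suc k)" "r k"] ge[of k] strict_monoD[OF r, of k "Suc k"] by simp
  qed
  from l1_fast_convergent[OF this] obtain l where "(\<lambda>k. X (r k)) \<longlonglongrightarrow> l"
    by (auto simp: convergent_def)
  then have "X \<longlonglongrightarrow> l"
    using Cauchy_converges_subseq[OF X r, of l] by (simp add: o_def)
  then show "convergent X" by (auto simp: convergent_def)
qed

text \<open>Small multiples of one nonzero vector, the indicator of the unit cube, give points close
  to any given one. The class makes the identity an operator of norm 1, as the normed algebra of
  endomorphisms requires.\<close>

instance l1 :: (euclidean_space) perfect_space
proof
  fix u :: "'a l1"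
  define e :: "'a l1" where "e = abs_l1 (indicator (cbox 0 One))"
  have ne: "norm e = 1"
    unfolding e_def by (subst norm_abs_l1) (simp_all add: abs_indicator)
  show "\<not> open {u}"
  proof
    assume "open {u}"
    then obtain d where d: "d > 0" "\<And>v. dist v u < d \<Longrightarrow> v = u"
      unfolding open_dist by auto
    have "dist (u + (d/2) *\<^sub>R e) u < d" using d(1) ne by (simp add: dist_norm)
    then have "(d/2) *\<^sub>R e = 0" using d(2) by force
    then show False using ne d(1) by auto
  qed
qed

section \<open>The Banach algebra of bounded endomorphisms\<close>

text \<open>A copy of \<^typ>\<open>'a \<Rightarrow>\<^sub>L 'a\<close>, since a type with two parameters cannot be made an algebra.\<close>

typedef (overloaded) 'a endo = "UNIV :: ('a::real_normed_vector \<Rightarrow>\<^sub>L 'a) set"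
  morphisms blinfun_of_endo endo_of_blinfun ..

setup_lifting type_definition_endo

instantiation endo :: ("{real_normed_vector, perfect_space}") real_normed_algebra_1
begin

lift_definition zero_endo :: "'a endo" is 0 .
lift_definition one_endo :: "'a endo" is id_blinfun .
lift_definition plus_endo :: "'a endo \<Rightarrow> 'a endo \<Rightarrow> 'a endo" is "(+)" .
lift_definition minus_endo :: "'a endo \<Rightarrow> 'a endo \<Rightarrow> 'a endo" is "(-)" .
lift_definition uminus_endo :: "'a endo \<Rightarrow> 'a endo" is uminus .
lift_definition times_endo :: "'a endo \<Rightarrow> 'a endo \<Rightarrow> 'a endo" is "(o\<^sub>L)" .
lift_definition scaleR_endo :: "real \<Rightarrow> 'a endo \<Rightarrow> 'a endo" is scaleR .
lift_definition norm_endo :: "'a endo \<Rightarrow> real" is norm .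

definition dist_endo :: "'a endo \<Rightarrow> 'a endo \<Rightarrow> real" where "dist_endo A B = norm (A - B)"

definition sgn_endo :: "'a endo \<Rightarrow> 'a endo" where "sgn_endo A = inverse (norm A) *\<^sub>R A"

definition uniformity_endo :: "('a endo \<times> 'a endo) filter" where
  "uniformity_endo = (INF e\<in>{0 <..}. principal {(x, y). dist x y < e})"

definition open_endo :: "'a endo set \<Rightarrow> bool" where
  "open_endo S \<longleftrightarrow> (\<forall>x\<in>S. \<forall>\<^sub>F (x', y) in uniformity. x' = x \<longrightarrow> y \<in> S)"

instance
proof
  fix A B D :: "'a endo" and r s :: real
  show "A + B + D = A + (B + D)" by transfer (rule add.assoc)
  show "A + B = B + A" by transfer (rule add.commute)
  show "0 + A = A" by transfer simp
  show "- A + A = 0" by transfer simp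
  show "A - B = A + - B" by transfer simp
  show "r *\<^sub>R (A + B) = r *\<^sub>R A + r *\<^sub>R B" by transfer (rule scaleR_add_right)
  show "(r + s) *\<^sub>R A = r *\<^sub>R A + s *\<^sub>R A" by transfer (rule scaleR_add_left)
  show "r *\<^sub>R s *\<^sub>R A = (r * s) *\<^sub>R A" by transfer simp
  show "1 *\<^sub>R A = A" by transfer simp
  show "norm (r *\<^sub>R A) = \<bar>r\<bar> * norm A" by transfer simp
  show "norm A = 0 \<longleftrightarrow> A = 0" by transfer simp
  show "norm (A + B) \<le> norm A + norm B" by transfer (rule norm_triangle_ineq)
  show "A * B * D = A * (B * D)" by transfer (simp add: blinfun_eqI)
  show "1 * A = A" by transfer (simp add: blinfun_eqI)
  show "A * 1 = A" by transfer (simp add: blinfun_eqI)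
  show "(A + B) * D = A * D + B * D"
    by transfer (simp add: blinfun_eqI blinfun.bilinear_simps)
  show "A * (B + D) = A * B + A * D"
    by transfer (simp add: blinfun_eqI blinfun.bilinear_simps)
  show "r *\<^sub>R A * B = r *\<^sub>R (A * B)"
    by transfer (simp add: blinfun_eqI blinfun.bilinear_simps)
  show "A * r *\<^sub>R B = r *\<^sub>R (A * B)"
    by transfer (simp add: blinfun_eqI blinfun.bilinear_simps)
  show "norm (A * B) \<le> norm A * norm B" by transfer (rule norm_blinfun_compose)
  show "norm (1 :: 'a endo) = 1" by transfer simp
  show "(0 :: 'a endo) \<noteq> 1" by transfer (metis norm_blinfun_id norm_zero zero_neq_one)
qed (simp_all only: dist_endo_def sgn_endo_def uniformity_endo_def open_endo_def)

end

lemma dist_blinfun_of_endo: "dist (blinfun_of_endo A) (blinfun_of_endo B) = dist A B"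
  by (simp add: dist_norm norm_endo.rep_eq minus_endo.rep_eq)

instance endo :: ("{banach, perfect_space}") banach
proof
  fix X :: "nat \<Rightarrow> 'a endo"
  assume "Cauchy X"
  then have "Cauchy (\<lambda>n. blinfun_of_endo (X n))"
    by (simp add: Cauchy_def dist_blinfun_of_endo)
  then obtain L where L: "(\<lambda>n. blinfun_of_endo (X n)) \<longlonglongrightarrow> L"
    by (auto simp: Cauchy_convergent_iff convergent_def)
  have "dist (X n) (endo_of_blinfun L) = dist (blinfun_of_endo (X n)) L" for n
    using dist_blinfun_of_endo[of "X n" "endo_of_blinfun L"] by (simp add: endo_of_blinfun_inverse)
  then have "X \<longlonglongrightarrow> endo_of_blinfun L"
    using L unfolding tendsto_iff by simp
  then show "convergent X" by (rule convergentI)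
qed

section \<open>Endomorphisms acting on vectors\<close>

lift_definition endo_apply :: "'a::real_normed_vector endo \<Rightarrow> 'a \<Rightarrow> 'a"  (infixr \<open>\<bullet>\<^sub>e\<close> 75)
  is blinfun_apply .

definition endo :: "('a \<Rightarrow> 'a) \<Rightarrow> 'a::real_normed_vector endo" where
  "endo f = endo_of_blinfun (Blinfun f)"

lemma endo_apply_endo: "bounded_linear f \<Longrightarrow> endo f \<bullet>\<^sub>e x = f x"
  by (simp add: endo_apply.rep_eq endo_def endo_of_blinfun_inverse bounded_linear_Blinfun_apply)

context
  fixes A B :: "'a::{real_normed_vector, perfect_space} endo"
begin

lemma endo_eqI: "(\<And>x. A \<bullet>\<^sub>e x = B \<bullet>\<^sub>e x) \<Longrightarrow> A = B"
  by transfer (rule blinfun_eqI)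

lemma endo_apply_mult [simp]: "(A * B) \<bullet>\<^sub>e x = A \<bullet>\<^sub>e B \<bullet>\<^sub>e x"
  by transfer simp

lemma endo_apply_one [simp]: "1 \<bullet>\<^sub>e (x::'a) = x"
  by transfer simp

lemma endo_apply_scaleR [simp]: "(r *\<^sub>R A) \<bullet>\<^sub>e x = r *\<^sub>R (A \<bullet>\<^sub>e x)"
  by transfer (simp add: blinfun.bilinear_simps)

lemma endo_apply_diff [simp]: "(A - B) \<bullet>\<^sub>e x = A \<bullet>\<^sub>e x - B \<bullet>\<^sub>e x"
  by transfer (simp add: blinfun.bilinear_simps)

lemma norm_endo_apply: "norm (A \<bullet>\<^sub>e x) \<le> norm A * norm x"
  by transfer (rule norm_blinfun)

lemma norm_endo_apply_le: "norm A \<le> 1 \<Longrightarrow> norm (A \<bullet>\<^sub>e x) \<le> norm x"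
  using norm_endo_apply[of x] mult_right_mono[of "norm A" 1 "norm x"] by simp

lemma norm_endo_le: "(\<And>x. norm (A \<bullet>\<^sub>e x) \<le> norm x) \<Longrightarrow> norm A \<le> 1"
  by transfer (rule norm_blinfun_bound, auto)

end

lemma bounded_linear_endo_apply: "bounded_linear (\<lambda>x. A \<bullet>\<^sub>e x)"
  by transfer (rule blinfun.bounded_linear_right)

lemmas endo_apply_right_add = linear_add[OF bounded_linear.linear[OF bounded_linear_endo_apply]]
  and endo_apply_right_diff = linear_diff[OF bounded_linear.linear[OF bounded_linear_endo_apply]]
  and endo_apply_right_scaleR = linear_cmul[OF bounded_linear.linear[OF bounded_linear_endo_apply]]

lemma bounded_linear_endo_apply_left:
  "bounded_linear (\<lambda>A. A \<bullet>\<^sub>e (x::'a::{real_normed_vector, perfect_space}))"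
proof (rule bounded_linear_intro[where K = "norm x"])
  fix A B :: "'a endo" and r
  show "(A + B) \<bullet>\<^sub>e x = A \<bullet>\<^sub>e x + B \<bullet>\<^sub>e x" by transfer (simp add: blinfun.bilinear_simps)
qed (simp_all add: norm_endo_apply)

text \<open>The exponential series may be multiplied termwise from both sides. This turns relations
  between powers of bounded generators and cut-offs into relations between their exponentials; some
  of the outer factors are 1 in the applications.\<close>

lemma exp_intertwine:
  fixes A B X Y U V :: "'a::{real_normed_algebra_1, banach}"
  assumes "\<And>k. X * A ^ k * Y = U * B ^ k * V"
  shows "X * exp A * Y = U * exp B * V"
proof -
  have 1: "(\<lambda>k. X * (A ^ k /\<^sub>R fact k) * Y) sums (X * exp A * Y)"
    by (intro sums_mult sums_mult2 exp_converges)
  have 2: "(\<lambda>k. U * (B ^ k /\<^sub>R fact k) * V) sums (U * exp B * V)"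
    by (intro sums_mult sums_mult2 exp_converges)
  have "X * (A ^ k /\<^sub>R fact k) * Y = U * (B ^ k /\<^sub>R fact k) * V" for k
    using assms[of k] by simp
  with 1 2 show ?thesis by (simp add: sums_unique2)
qed

text \<open>
  \<open>exp (s (R - 1)) = exp (-s) exp (s R)\<close> is a limit of convex combinations of powers of \<open>R\<close>.
\<close>

lemma exp_closed_convex_invariant:
  fixes R :: "'a::{banach, perfect_space} endo"
  assumes D: "closed D" "convex D" and R: "\<And>x. x \<in> D \<Longrightarrow> R \<bullet>\<^sub>e x \<in> D"
    and s: "0 \<le> s" and x: "x \<in> D"
  shows "exp (s *\<^sub>R (R - 1)) \<bullet>\<^sub>e x \<in> D"
proof -
  have "exp (s *\<^sub>R (R - 1)) = exp (s *\<^sub>R R + of_real (- s))"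
    by (simp add: algebra_simps of_real_def)
  also have "\<dots> = exp (s *\<^sub>R R) * of_real (exp (- s))"
    by (subst exp_add_commuting) (simp_all only: exp_of_real, simp add: of_real_def)
  finally have exp_eq: "exp (s *\<^sub>R (R - 1)) = exp (- s) *\<^sub>R exp (s *\<^sub>R R)"
    by (simp add: of_real_def)
  \<comment> \<open>Dividing by the partial sum of \<open>exp s\<close> turns the coefficients into
    convex weights. Summing up to \<open>n\<close> inclusive keeps the term for k = 0, so that
    \<open>p n\<close> is at least 1.\<close>
  define p where "p n = (\<Sum>k<Suc n. s ^ k / fact k)" for n
  define q where "q n = (\<Sum>k<Suc n. (s ^ k / fact k) *\<^sub>R (R ^ k \<bullet>\<^sub>e x))" for n
  have Rk: "R ^ k \<bullet>\<^sub>e x \<in> D" for k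
    by (induction k) (auto simp: x R)
  have p_ge: "p n \<ge> 1" for n
  proof -
    have "p n = 1 + (\<Sum>k<n. s ^ Suc k / fact (Suc k))"
      unfolding p_def by (subst sum.lessThan_Suc_shift) simp
    also have "\<dots> \<ge> 1" using s by (simp add: sum_nonneg)
    finally show ?thesis .
  qed
  have "(\<lambda>n. \<Sum>k<n. s ^ k / fact k) \<longlonglongrightarrow> exp s"
    using exp_converges[of s] unfolding sums_def by (simp add: divide_inverse mult.commute)
  then have p: "p \<longlonglongrightarrow> exp s"
    unfolding p_def by (rule LIMSEQ_Suc)
  have "(\<lambda>n. \<Sum>k<n. (s ^ k / fact k) *\<^sub>R (R ^ k \<bullet>\<^sub>e x)) \<longlonglongrightarrow> exp (s *\<^sub>R R) \<bullet>\<^sub>e x"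
    using bounded_linear.sums[OF bounded_linear_endo_apply_left exp_converges[of "s *\<^sub>R R"], of x]
    unfolding sums_def by (simp add: divide_inverse scaleR_power mult.commute)
  then have q: "q \<longlonglongrightarrow> exp (s *\<^sub>R R) \<bullet>\<^sub>e x"
    unfolding q_def by (rule LIMSEQ_Suc)
  have "(1 / p n) *\<^sub>R q n \<in> D" for n
  proof -
    have "(1 / p n) *\<^sub>R q n = (\<Sum>k<Suc n. (s ^ k / fact k / p n) *\<^sub>R (R ^ k \<bullet>\<^sub>e x))"
      unfolding q_def scaleR_sum_right by (simp add: mult.commute)
    also have "\<dots> \<in> D"
    proof (rule convex_sum[OF _ D(2)])
      show "(\<Sum>k<Suc n. s ^ k / fact k / p n) = 1"
        using p_ge[of n] unfolding sum_divide_distrib[symmetric] p_def[symmetric] by auto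
      show "0 \<le> s ^ k / fact k / p n" for k
        using p_ge[of n] s by (intro divide_nonneg_nonneg) auto
    qed (auto simp: Rk)
    finally show ?thesis .
  qed
  moreover have "(\<lambda>n. (1 / p n) *\<^sub>R q n) \<longlonglongrightarrow> (1 / exp s) *\<^sub>R (exp (s *\<^sub>R R) \<bullet>\<^sub>e x)"
    by (intro tendsto_intros p q) simp
  ultimately have "(1 / exp s) *\<^sub>R (exp (s *\<^sub>R R) \<bullet>\<^sub>e x) \<in> D"
    by (rule closed_sequentially[OF D(1)])
  then show ?thesis
    by (simp add: exp_eq exp_minus divide_inverse)
qed


section \<open>Contraction semigroups on Banach spaces\<close>

locale contraction_semigroup =
  fixes T :: "real \<Rightarrow> 'a::real_normed_vector \<Rightarrow> 'a"
  assumes linear_T: "0 \<le> t \<Longrightarrow> linear (T t)"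
    and norm_T: "0 \<le> t \<Longrightarrow> norm (T t f) \<le> norm f"
    and T_0: "T 0 f = f"
    and T_add: "\<lbrakk>0 \<le> s; 0 \<le> t\<rbrakk> \<Longrightarrow> T (s + t) f = T s (T t f)"
    and T_tendsto_0: "((\<lambda>t. T t f) \<longlongrightarrow> f) (at_right 0)"
begin

definition gen :: "('a \<times> 'a) set" where
  "gen = {(f, g). ((\<lambda>t. (T t f - f) /\<^sub>R t) \<longlongrightarrow> g) (at_right 0)}"

lemma bounded_linear_T: "0 \<le> t \<Longrightarrow> bounded_linear (T t)"
  by (rule bounded_linear_intro[where K = 1])
    (simp_all add: linear_T norm_T linear_add linear_cmul)

lemma gen_diff: "\<lbrakk>(f, g) \<in> gen; (f', g') \<in> gen\<rbrakk> \<Longrightarrow> (f - f', g - g') \<in> gen"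
proof -
  assume fg: "(f, g) \<in> gen" "(f', g') \<in> gen"
  then have "((\<lambda>t. (T t f - f) /\<^sub>R t - (T t f' - f') /\<^sub>R t) \<longlongrightarrow> g - g') (at_right 0)"
    unfolding gen_def by (auto intro!: tendsto_diff)
  moreover have "\<forall>\<^sub>F t in at_right 0. (T t f - f) /\<^sub>R t - (T t f' - f') /\<^sub>R t =
      (T t (f - f') - (f - f')) /\<^sub>R t"
    using eventually_at_right_less
    by (rule eventually_mono) (simp add: linear_diff[OF linear_T] algebra_simps)
  ultimately show ?thesis
    unfolding gen_def by (auto elim: Lim_transform_eventually)
qed

text \<open>
  Telescoping \<open>T t f - f - t g\<close> over steps of length \<open>t / N\<close> and letting \<open>N\<close> tend to infinity
  replaces the usual integral representation of \<open>T t f - f\<close>.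
\<close>

lemma gen_estimate:
  assumes fg: "(f, g) \<in> gen" and t: "0 < t"
    and e: "\<And>s. \<lbrakk>0 \<le> s; s \<le> t\<rbrakk> \<Longrightarrow> norm (T s g - g) \<le> e"
  shows "norm (T t f - f - t *\<^sub>R g) \<le> t * e"
proof -
  define d where "d h = norm ((T h f - f) /\<^sub>R h - g)" for h
  have step: "norm (T (real j * h) f - f - (real j * h) *\<^sub>R g) \<le> real j * (h * d h + h * e)"
    if "0 < h" "real j * h \<le> t" for j h
    using that(2)
  proof (induction j)
    case (Suc j)
    let ?s = "real j * h"
    have s: "0 \<le> ?s" "?s \<le> t" using Suc.prems \<open>0 < h\<close> by (auto simp: algebra_simps)
    have "T (real (Suc j) * h) f = T ?s (T h f)"
      using T_add[of ?s h f] s \<open>0 < h\<close> by (simp add: algebra_simps)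
    \<comment> \<open>One further step adds three errors: the one-step error, moved by the
      contraction \<open>T ?s\<close>; the deviation of \<open>T ?s g\<close> from \<open>g\<close>,
      at most \<open>e\<close> because \<open>?s\<close> does not exceed \<open>t\<close>; and the
      error accumulated so far.\<close>
    then have "T (real (Suc j) * h) f - f - (real (Suc j) * h) *\<^sub>R g
        = T ?s (T h f - f - h *\<^sub>R g) + h *\<^sub>R (T ?s g - g) + (T ?s f - f - ?s *\<^sub>R g)"
      using linear_T[OF s(1)] by (simp add: linear_add linear_diff linear_cmul algebra_simps)
    also have "norm \<dots> \<le> norm (T ?s (T h f - f - h *\<^sub>R g)) + norm (h *\<^sub>R (T ?s g - g))
        + norm (T ?s f - f - ?s *\<^sub>R g)"
      by (rule order_trans[OF norm_triangle_ineq]) (intro add_right_mono norm_triangle_ineq)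
    also have "norm (T ?s (T h f - f - h *\<^sub>R g)) \<le> norm (T h f - f - h *\<^sub>R g)"
      by (rule norm_T[OF s(1)])
    also have "T h f - f - h *\<^sub>R g = h *\<^sub>R ((T h f - f) /\<^sub>R h - g)"
      using \<open>0 < h\<close> by (simp add: algebra_simps)
    also have "norm \<dots> = h * d h" using \<open>0 < h\<close> by (simp add: d_def)
    also have "norm (h *\<^sub>R (T ?s g - g)) \<le> h * e"
      using e[OF s] \<open>0 < h\<close> by simp
    also have "norm (T ?s f - f - ?s *\<^sub>R g) \<le> real j * (h * d h + h * e)"
      by (rule Suc.IH[OF s(2)])
    finally show ?case by (simp add: algebra_simps)
  qed (simp add: T_0)
  have "(\<lambda>N. t / real (Suc N)) \<longlonglongrightarrow> 0"
    by (rule LIMSEQ_Suc[OF lim_const_over_n])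
  then have h0: "filterlim (\<lambda>N. t / real (Suc N)) (at_right 0) sequentially"
    unfolding filterlim_at using t by (auto simp del: of_nat_Suc)
  have "(d \<longlongrightarrow> 0) (at_right 0)"
    unfolding d_def using fg by (auto simp: gen_def intro!: tendsto_norm_zero LIM_zero)
  from filterlim_compose[OF this h0]
  have "(\<lambda>N. t * d (t / real (Suc N)) + t * e) \<longlonglongrightarrow> t * 0 + t * e"
    by (intro tendsto_intros)
  moreover have "norm (T t f - f - t *\<^sub>R g) \<le> t * d (t / real (Suc N)) + t * e" for N
  proof -
    have "real (Suc N) * (t / real (Suc N)) = t" by simp
    moreover have "real (Suc N) * (t / real (Suc N) * x + t / real (Suc N) * e) = t * x + t * e" for x
      by (simp add: distrib_left del: of_nat_Suc)
    ultimately show ?thesis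
      using step[of "t / real (Suc N)" "Suc N"] t by (simp del: of_nat_Suc)
  qed
  ultimately show ?thesis
    using LIMSEQ_le_const by fastforce
qed

text \<open>The difference quotients of the \<open>F n\<close> need not converge at a common rate,
  but the telescoped bound passes to the limit: it involves only \<open>T s\<close> at the second
  component, and replacing \<open>G n\<close> by \<open>g\<close> there costs at most twice
  \<open>norm (G n - g)\<close>. Strong continuity at \<open>g\<close> then gives the derivative of
  the orbit of \<open>f\<close>.\<close>

lemma gen_closed:
  assumes FG: "\<And>n::nat. (F n, G n) \<in> gen" and F: "F \<longlonglongrightarrow> f" and G: "G \<longlonglongrightarrow> g"
  shows "(f, g) \<in> gen"
proof -
  have est: "norm (T t f - f - t *\<^sub>R g) \<le> t * e"
    if t: "0 < t" and e: "\<And>s. \<lbrakk>0 \<le> s; s \<le> t\<rbrakk> \<Longrightarrow> norm (T s g - g) \<le> e" for t e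
  proof (rule LIMSEQ_le)
    have "(\<lambda>n. T t (F n)) \<longlonglongrightarrow> T t f"
      using bounded_linear.tendsto[OF bounded_linear_T F] t by simp
    then show "(\<lambda>n. norm (T t (F n) - F n - t *\<^sub>R G n)) \<longlonglongrightarrow> norm (T t f - f - t *\<^sub>R g)"
      by (intro tendsto_intros F G)
    have "(\<lambda>n. t * (e + 2 * norm (G n - g))) \<longlonglongrightarrow> t * (e + 2 * norm (g - g))"
      by (intro tendsto_intros G)
    then show "(\<lambda>n. t * (e + 2 * norm (G n - g))) \<longlonglongrightarrow> t * e" by simp
    have "norm (T s (G n) - G n) \<le> e + 2 * norm (G n - g)" if s: "0 \<le> s" "s \<le> t" for s n
    proof -
      have "T s (G n) - G n = (T s g - g) + (T s (G n - g) - (G n - g))"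
        using linear_T[OF s(1)] by (simp add: linear_diff)
      also have "norm \<dots> \<le> norm (T s g - g) + (norm (T s (G n - g)) + norm (G n - g))"
        by (intro norm_triangle_mono norm_triangle_ineq4) auto
      also have "\<dots> \<le> e + 2 * norm (G n - g)"
        using e[OF s] norm_T[OF s(1), of "G n - g"] by simp
      finally show ?thesis .
    qed
    then show "\<exists>N. \<forall>n\<ge>N. norm (T t (F n) - F n - t *\<^sub>R G n) \<le> t * (e + 2 * norm (G n - g))"
      using gen_estimate[OF FG t] by blast
  qed
  have "((\<lambda>t. (T t f - f) /\<^sub>R t) \<longlongrightarrow> g) (at_right 0)"
  proof (rule tendstoI)
    fix e :: real
    assume e: "0 < e"
    have "\<forall>\<^sub>F s in at_right 0. dist (T s g) g < e / 2"
      using T_tendsto_0 e by (intro tendstoD) auto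
    then obtain \<delta> where \<delta>: "0 < \<delta>" "\<And>s. \<lbrakk>0 < s; s < \<delta>\<rbrakk> \<Longrightarrow> dist (T s g) g < e / 2"
      unfolding eventually_at_right_field by auto
    have "dist ((T t f - f) /\<^sub>R t) g < e" if t: "0 < t" "t < \<delta>" for t
    proof -
      have "norm (T s g - g) \<le> e / 2" if "0 \<le> s" "s \<le> t" for s
        using \<delta>(2)[of s] that t(2) e by (cases "s = 0") (auto simp: T_0 dist_norm)
      then have "norm (T t f - f - t *\<^sub>R g) \<le> t * (e / 2)" using t(1) by (intro est)
      also have "T t f - f - t *\<^sub>R g = t *\<^sub>R ((T t f - f) /\<^sub>R t - g)"
        using t(1) by (simp add: algebra_simps)
      finally have "norm ((T t f - f) /\<^sub>R t - g) \<le> e / 2" using t(1) by simp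
      then show ?thesis using e by (simp add: dist_norm)
    qed
    then show "\<forall>\<^sub>F t in at_right 0. dist ((T t f - f) /\<^sub>R t) g < e"
      unfolding eventually_at_right_field using \<delta>(1) by auto
  qed
  then show ?thesis by (simp add: gen_def)
qed

text \<open>Contractivity makes the norm of \<open>(1 + h) *\<^sub>R u - T h u\<close> at least
  \<open>h * norm u\<close>; divided by \<open>h\<close>, this vector tends to
  \<open>u - v\<close>.\<close>

lemma gen_dissipative:
  assumes "(u, v) \<in> gen"
  shows "norm u \<le> norm (u - v)"
proof (rule tendsto_lowerbound)
  show "((\<lambda>h. norm (u - (T h u - u) /\<^sub>R h)) \<longlongrightarrow> norm (u - v)) (at_right 0)"
    using assms by (auto simp: gen_def intro!: tendsto_intros)
  show "\<forall>\<^sub>F h in at_right 0. norm u \<le> norm (u - (T h u - u) /\<^sub>R h)"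
    using eventually_at_right_less
  proof (rule eventually_mono)
    fix h :: real
    assume h: "0 < h"
    have "(1 + h) * norm u - norm u \<le> norm ((1 + h) *\<^sub>R u) - norm (T h u)"
      using norm_T[of h u] h by simp
    also have "\<dots> \<le> norm ((1 + h) *\<^sub>R u - T h u)" by (rule norm_triangle_ineq2)
    also have "(1 + h) *\<^sub>R u - T h u = h *\<^sub>R (u - (T h u - u) /\<^sub>R h)"
      using h by (simp add: algebra_simps)
    also have "norm \<dots> = h * norm (u - (T h u - u) /\<^sub>R h)"
      using h by simp
    finally have "h * norm u \<le> h * norm (u - (T h u - u) /\<^sub>R h)"
      by (simp add: distrib_right)
    then show "norm u \<le> norm (u - (T h u - u) /\<^sub>R h)" using h by simp
  qed
qed simp

end

section \<open>Semigroups exhausted by bounded generators\<close>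

text \<open>The \<open>P n\<close> are projections with growing ranges; \<open>P_P\<close> with
  equal indices is idempotence. \<open>K_P\<close> makes the bounded generators agree on the smaller
  range, \<open>P_K\<close> keeps the evolution inside the range, and \<open>P_tendsto\<close> makes
  the union of the ranges dense.\<close>

locale exhausted_generator =
  fixes P R :: "nat \<Rightarrow> 'a::{banach, perfect_space} endo" and C :: "nat \<Rightarrow> real"
    and K :: "nat \<Rightarrow> 'a endo"
  assumes K_def: "K n = C n *\<^sub>R (R n - 1)"
    and C_nonneg: "0 \<le> C n"
    and norm_P: "norm (P n) \<le> 1"
    and norm_R: "norm (R n) \<le> 1"
    and P_P: "m \<le> n \<Longrightarrow> P n * P m = P m"
    and K_P: "m \<le> n \<Longrightarrow> K n * P m = K m * P m"
    and P_K: "P n * K n = K n"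
    and P_tendsto: "(\<lambda>n. P n \<bullet>\<^sub>e f) \<longlonglongrightarrow> f"
begin

definition U :: "nat \<Rightarrow> real \<Rightarrow> 'a endo" where
  "U n t = exp (t *\<^sub>R K n)"

definition T :: "real \<Rightarrow> 'a \<Rightarrow> 'a" where
  "T t f = lim (\<lambda>n. U n t \<bullet>\<^sub>e P n \<bullet>\<^sub>e f)"

section \<open>Exponentials of the bounded generators and their limit\<close>

lemma U_invariant:
  assumes "closed D" "convex D" "\<And>x. x \<in> D \<Longrightarrow> R n \<bullet>\<^sub>e x \<in> D" "0 \<le> t" "x \<in> D"
  shows "U n t \<bullet>\<^sub>e x \<in> D"
proof -
  have "t *\<^sub>R K n = (t * C n) *\<^sub>R (R n - 1)" by (simp add: K_def)
  then show ?thesis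
    unfolding U_def using exp_closed_convex_invariant[OF assms(1-3) _ assms(5), of "t * C n"]
      assms(4) C_nonneg by simp
qed

text \<open>The ball of radius \<open>norm x\<close> is closed, convex and preserved by the
  contraction \<open>R n\<close>. Estimating the series term by term would only give a bound that
  grows exponentially with the norm of \<open>K n\<close>.\<close>

lemma norm_U_apply: "0 \<le> t \<Longrightarrow> norm (U n t \<bullet>\<^sub>e x) \<le> norm x"
  using U_invariant[of "cball 0 (norm x)" n t x] norm_endo_apply_le[OF norm_R[of n]]
  by (auto intro: order_trans)

text \<open>For positive exponents the leftmost factor \<open>K n\<close> already maps into the
  range of \<open>P n\<close>; for exponent 0 it is idempotence.\<close>

lemma P_pow_P: "P n * (t *\<^sub>R K n) ^ k * P n = (t *\<^sub>R K n) ^ k * P n"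
  by (cases k) (simp_all add: P_P P_K mult.assoc[symmetric])

text \<open>Replacing \<open>K n\<close> by \<open>K m\<close> requires a factor \<open>P m\<close>
  directly to its right. It can be inserted because powers of \<open>K m\<close> map the range of
  \<open>P m\<close> into itself.\<close>

lemma pow_P:
  assumes "m \<le> n"
  shows "(t *\<^sub>R K n) ^ k * P m = (t *\<^sub>R K m) ^ k * P m"
proof (induction k)
  case (Suc k)
  have "(t *\<^sub>R K n) ^ Suc k * P m = t *\<^sub>R K n * (P m * (t *\<^sub>R K m) ^ k * P m)"
    unfolding P_pow_P Suc[symmetric] by (simp only: power_Suc mult.assoc)
  also have "\<dots> = t *\<^sub>R (K n * P m) * ((t *\<^sub>R K m) ^ k * P m)"
    by (simp add: mult.assoc)
  also have "\<dots> = t *\<^sub>R K m * (P m * (t *\<^sub>R K m) ^ k * P m)"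
    by (simp add: K_P[OF assms] mult.assoc)
  also have "\<dots> = (t *\<^sub>R K m) ^ Suc k * P m"
    unfolding P_pow_P by (simp only: power_Suc mult.assoc)
  finally show ?case .
qed simp

lemma U_P: "m \<le> n \<Longrightarrow> U n t * P m = U m t * P m"
  using exp_intertwine[where X = 1 and U = 1] pow_P unfolding U_def by (metis mult_1)

lemma P_U_P: "P n * U n t * P n = U n t * P n"
  using exp_intertwine[where U = 1] P_pow_P unfolding U_def by (metis mult_1)

text \<open>For m \<le> n consistency lets \<open>U n t\<close> replace \<open>U m t\<close> on the
  range of \<open>P m\<close>. Two members of the sequence thus differ by the contraction
  \<open>U n t\<close> applied to a difference of cut-offs of \<open>f\<close>, and the cut-offs
  form a Cauchy sequence.\<close>

lemma T_tendsto:
  assumes t: "0 \<le> t"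
  shows "(\<lambda>n. U n t \<bullet>\<^sub>e P n \<bullet>\<^sub>e f) \<longlonglongrightarrow> T t f"
proof -
  have le: "dist (U m t \<bullet>\<^sub>e P m \<bullet>\<^sub>e f) (U n t \<bullet>\<^sub>e P n \<bullet>\<^sub>e f) \<le> dist (P m \<bullet>\<^sub>e f) (P n \<bullet>\<^sub>e f)"
    if "m \<le> n" for m n
  proof -
    have "U m t \<bullet>\<^sub>e P m \<bullet>\<^sub>e f = U n t \<bullet>\<^sub>e P m \<bullet>\<^sub>e f"
      using U_P[OF that, of t] by (metis endo_apply_mult)
    then have "U m t \<bullet>\<^sub>e P m \<bullet>\<^sub>e f - U n t \<bullet>\<^sub>e P n \<bullet>\<^sub>e f = U n t \<bullet>\<^sub>e (P m \<bullet>\<^sub>e f - P n \<bullet>\<^sub>e f)"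
      using endo_apply_right_diff by metis
    then show ?thesis using norm_U_apply[OF t] by (simp add: dist_norm)
  qed
  then have le': "dist (U m t \<bullet>\<^sub>e P m \<bullet>\<^sub>e f) (U n t \<bullet>\<^sub>e P n \<bullet>\<^sub>e f) \<le> dist (P m \<bullet>\<^sub>e f) (P n \<bullet>\<^sub>e f)"
    for m n
    by (metis dist_commute nle_le)
  have "Cauchy (\<lambda>n. P n \<bullet>\<^sub>e f)" using P_tendsto by (auto intro: LIMSEQ_imp_Cauchy)
  then have "Cauchy (\<lambda>n. U n t \<bullet>\<^sub>e P n \<bullet>\<^sub>e f)"
    unfolding Cauchy_def using le' by (meson le_less_trans)
  then show ?thesis
    unfolding T_def by (simp add: Cauchy_convergent_iff convergent_LIMSEQ_iff)
qed

lemma T_P: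
  assumes "0 \<le> t"
  shows "T t (P m \<bullet>\<^sub>e f) = U m t \<bullet>\<^sub>e P m \<bullet>\<^sub>e f"
proof (rule LIMSEQ_unique[OF T_tendsto[OF assms]])
  have "U n t \<bullet>\<^sub>e P n \<bullet>\<^sub>e P m \<bullet>\<^sub>e f = U m t \<bullet>\<^sub>e P m \<bullet>\<^sub>e f" if "n \<ge> m" for n
    using U_P[OF that, of t] P_P[OF that] by (metis endo_apply_mult)
  then show "(\<lambda>n. U n t \<bullet>\<^sub>e P n \<bullet>\<^sub>e P m \<bullet>\<^sub>e f) \<longlonglongrightarrow> U m t \<bullet>\<^sub>e P m \<bullet>\<^sub>e f"
    by (intro tendsto_eventually eventually_sequentiallyI)
qed

lemma T_invariant:
  assumes "closed D" "convex D" "\<And>n x. x \<in> D \<Longrightarrow> P n \<bullet>\<^sub>e x \<in> D" "\<And>n x. x \<in> D \<Longrightarrow> R n \<bullet>\<^sub>e x \<in> D"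
    and "0 \<le> t" "f \<in> D"
  shows "T t f \<in> D"
  by (rule closed_sequentially[OF assms(1) _ T_tendsto]) (use assms in \<open>auto intro!: U_invariant\<close>)

lemma linear_T:
  assumes t: "0 \<le> t"
  shows "linear (T t)"
proof (rule linearI)
  fix f g :: 'a and r :: real
  show "T t (f + g) = T t f + T t g"
    using tendsto_add[OF T_tendsto[OF t, of f] T_tendsto[OF t, of g]] T_tendsto[OF t, of "f + g"]
    by (simp add: endo_apply_right_add LIMSEQ_unique)
  show "T t (r *\<^sub>R f) = r *\<^sub>R T t f"
    using tendsto_scaleR[OF tendsto_const T_tendsto[OF t, of f], of r] T_tendsto[OF t, of "r *\<^sub>R f"]
    by (simp add: endo_apply_right_scaleR LIMSEQ_unique)
qed

lemma norm_T:
  assumes "0 \<le> t"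
  shows "norm (T t f) \<le> norm f"
proof -
  have "T t f \<in> cball 0 (norm f)"
  proof (rule T_invariant[OF _ _ _ _ assms])
    fix n and x :: 'a
    assume "x \<in> cball 0 (norm f)"
    then show "P n \<bullet>\<^sub>e x \<in> cball 0 (norm f)" "R n \<bullet>\<^sub>e x \<in> cball 0 (norm f)"
      using norm_endo_apply_le[OF norm_P, of n x] norm_endo_apply_le[OF norm_R, of n x] by auto
  qed auto
  then show ?thesis by simp
qed

lemma T_continuous:
  assumes "0 \<le> t" "F \<longlonglongrightarrow> f"
  shows "(\<lambda>n. T t (F n)) \<longlonglongrightarrow> T t f"
proof -
  have "bounded_linear (T t)"
    using linear_T[OF assms(1)] norm_T[OF assms(1)]
    by (intro bounded_linear_intro[where K = 1]) (simp_all add: linear_add linear_cmul)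
  from bounded_linear.tendsto[OF this assms(2)] show ?thesis .
qed

lemma U_derivative:
  "((\<lambda>t. (U n t \<bullet>\<^sub>e x - x) /\<^sub>R t) \<longlongrightarrow> K n \<bullet>\<^sub>e x) (at_right 0)"
proof -
  have "((\<lambda>t. exp (t *\<^sub>R K n)) has_derivative (\<lambda>h. h *\<^sub>R K n)) (at_right 0)"
    using exp_scaleR_has_vector_derivative_right[of "K n" 0 "{0<..}"]
    by (simp add: has_vector_derivative_def)
  from bounded_linear.has_derivative[OF bounded_linear_endo_apply_left this, of x]
  have "((\<lambda>t. U n t \<bullet>\<^sub>e x) has_derivative (\<lambda>h. h *\<^sub>R (K n \<bullet>\<^sub>e x))) (at_right 0)"
    by (simp add: U_def)
  then have "((\<lambda>t. norm (U n t \<bullet>\<^sub>e x - x - t *\<^sub>R (K n \<bullet>\<^sub>e x)) / norm t) \<longlongrightarrow> 0) (at_right 0)"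
    by (simp add: has_derivative_iff_norm U_def)
  moreover have "\<forall>\<^sub>F t in at_right 0. norm (U n t \<bullet>\<^sub>e x - x - t *\<^sub>R (K n \<bullet>\<^sub>e x)) / norm t =
      norm ((U n t \<bullet>\<^sub>e x - x) /\<^sub>R t - K n \<bullet>\<^sub>e x)"
    using eventually_at_right_less
  proof (rule eventually_mono)
    fix t :: real
    assume t: "0 < t"
    have "U n t \<bullet>\<^sub>e x - x - t *\<^sub>R (K n \<bullet>\<^sub>e x) = t *\<^sub>R ((U n t \<bullet>\<^sub>e x - x) /\<^sub>R t - K n \<bullet>\<^sub>e x)"
      using t by (simp add: algebra_simps)
    then show "norm (U n t \<bullet>\<^sub>e x - x - t *\<^sub>R (K n \<bullet>\<^sub>e x)) / norm t =
        norm ((U n t \<bullet>\<^sub>e x - x) /\<^sub>R t - K n \<bullet>\<^sub>e x)"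
      using t by simp
  qed
  ultimately have "((\<lambda>t. norm ((U n t \<bullet>\<^sub>e x - x) /\<^sub>R t - K n \<bullet>\<^sub>e x)) \<longlongrightarrow> 0) (at_right 0)"
    by (rule Lim_transform_eventually)
  then show ?thesis
    using LIM_zero_cancel tendsto_norm_zero_iff by blast
qed

sublocale contraction_semigroup T
proof (rule contraction_semigroup.intro)
  fix s t :: real and f :: 'a
  show "0 \<le> t \<Longrightarrow> linear (T t)" by (rule linear_T)
  show "0 \<le> t \<Longrightarrow> norm (T t f) \<le> norm f" by (rule norm_T)
  have "(\<lambda>n. U n 0 \<bullet>\<^sub>e P n \<bullet>\<^sub>e f) \<longlonglongrightarrow> f"
    using P_tendsto by (simp add: U_def)
  then show "T 0 f = f"
    using T_tendsto[of 0 f] LIMSEQ_unique by blast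
  show "T (s + t) f = T s (T t f)" if st: "0 \<le> s" "0 \<le> t"
  proof (rule LIMSEQ_unique)
    \<comment> \<open>On the range of \<open>P n\<close> the limit is the exponential itself, which
      stays in this range, so that its functional equation applies. Density and continuity extend
      the law to \<open>f\<close>.\<close>
    have "T (s + t) (P n \<bullet>\<^sub>e f) = T s (T t (P n \<bullet>\<^sub>e f))" for n
    proof -
      have "U n (s + t) = U n s * U n t"
        by (simp add: U_def scaleR_add_left exp_add_commuting)
      then have "T (s + t) (P n \<bullet>\<^sub>e f) = U n s \<bullet>\<^sub>e U n t \<bullet>\<^sub>e P n \<bullet>\<^sub>e f"
        using st by (simp add: T_P)
      also have "U n t \<bullet>\<^sub>e P n \<bullet>\<^sub>e f = P n \<bullet>\<^sub>e U n t \<bullet>\<^sub>e P n \<bullet>\<^sub>e f"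
        using P_U_P[of n t] by (metis endo_apply_mult)
      also have "U n s \<bullet>\<^sub>e \<dots> = T s \<dots>" using st by (simp add: T_P)
      also have "P n \<bullet>\<^sub>e U n t \<bullet>\<^sub>e P n \<bullet>\<^sub>e f = U n t \<bullet>\<^sub>e P n \<bullet>\<^sub>e f"
        using P_U_P[of n t] by (metis endo_apply_mult)
      finally show ?thesis using st by (simp add: T_P)
    qed
    then show "(\<lambda>n. T (s + t) (P n \<bullet>\<^sub>e f)) \<longlonglongrightarrow> T s (T t f)"
      using st by (simp add: T_continuous P_tendsto)
    show "(\<lambda>n. T (s + t) (P n \<bullet>\<^sub>e f)) \<longlonglongrightarrow> T (s + t) f"
      using st by (simp add: T_continuous P_tendsto)
  qed
  show "((\<lambda>t. T t f) \<longlongrightarrow> f) (at_right 0)"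
  proof (rule tendstoI)
    fix e :: real
    assume e: "0 < e"
    \<comment> \<open>On the range of \<open>P n\<close> the orbit is even differentiable at 0.
      Contractivity carries continuity over to \<open>f\<close> at the cost of two further thirds of
      \<open>e\<close>.\<close>
    from P_tendsto[of f] e obtain n where n: "dist (P n \<bullet>\<^sub>e f) f < e / 3"
      using metric_LIMSEQ_D[of "\<lambda>n. P n \<bullet>\<^sub>e f" f "e / 3"] by auto
    let ?u = "P n \<bullet>\<^sub>e f"
    have "((\<lambda>t. t *\<^sub>R ((U n t \<bullet>\<^sub>e ?u - ?u) /\<^sub>R t) + ?u) \<longlongrightarrow> 0 *\<^sub>R (K n \<bullet>\<^sub>e ?u) + ?u) (at_right 0)"
      by (intro tendsto_add tendsto_scaleR U_derivative tendsto_const tendsto_ident_at)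
    then have "((\<lambda>t. t *\<^sub>R ((U n t \<bullet>\<^sub>e ?u - ?u) /\<^sub>R t) + ?u) \<longlongrightarrow> ?u) (at_right 0)" by simp
    moreover have "\<forall>\<^sub>F t in at_right 0. t *\<^sub>R ((U n t \<bullet>\<^sub>e ?u - ?u) /\<^sub>R t) + ?u = T t ?u"
      using eventually_at_right_less by (rule eventually_mono) (simp add: T_P)
    ultimately have "((\<lambda>t. T t ?u) \<longlongrightarrow> ?u) (at_right 0)"
      by (rule Lim_transform_eventually)
    then have "\<forall>\<^sub>F t in at_right 0. dist (T t ?u) ?u < e / 3"
      using e by (intro tendstoD) auto
    then show "\<forall>\<^sub>F t in at_right 0. dist (T t f) f < e"
      using eventually_at_right_less
    proof eventually_elim
      case (elim t)
      have "dist (T t f) (T t ?u) \<le> dist f ?u"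
        using norm_T[of t "f - ?u"] linear_T[of t] elim(2) by (simp add: dist_norm linear_diff)
      moreover have "dist (T t f) f \<le> dist (T t f) (T t ?u) + dist (T t ?u) ?u + dist ?u f"
        using dist_triangle[of "T t f" f "T t ?u"] dist_triangle[of "T t ?u" f ?u] by linarith
      ultimately show ?case using elim(1) n by (simp add: dist_commute)
    qed
  qed
qed

lemma P_gen: "(P n \<bullet>\<^sub>e f, K n \<bullet>\<^sub>e P n \<bullet>\<^sub>e f) \<in> gen"
proof -
  have "\<forall>\<^sub>F t in at_right 0. (U n t \<bullet>\<^sub>e P n \<bullet>\<^sub>e f - P n \<bullet>\<^sub>e f) /\<^sub>R t = (T t (P n \<bullet>\<^sub>e f) - P n \<bullet>\<^sub>e f) /\<^sub>R t"
    using eventually_at_right_less by (rule eventually_mono) (simp add: T_P)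
  from Lim_transform_eventually[OF U_derivative this] show ?thesis
    by (simp add: gen_def)
qed

text \<open>The equation reads (1 + C) u = P h + C R u, a fixed point equation with contraction
  constant C / (1 + C) < 1. Its solution equals P h + K u and hence lies in the range of
  \<open>P n\<close>.\<close>

lemma P_resolvent:
  obtains u where "P n \<bullet>\<^sub>e u = u" "u - K n \<bullet>\<^sub>e u = P n \<bullet>\<^sub>e h"
proof -
  define \<theta> where "\<theta> = C n / (1 + C n)"
  define \<Phi> where "\<Phi> x = (1 / (1 + C n)) *\<^sub>R (P n \<bullet>\<^sub>e h) + \<theta> *\<^sub>R (R n \<bullet>\<^sub>e x)" for x
  have \<theta>: "0 \<le> \<theta>" "\<theta> < 1" using C_nonneg[of n] by (auto simp: \<theta>_def)
  have "dist (\<Phi> x) (\<Phi> y) \<le> \<theta> * dist x y" for x y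
  proof -
    have "\<Phi> x - \<Phi> y = \<theta> *\<^sub>R (R n \<bullet>\<^sub>e (x - y))"
      by (simp add: \<Phi>_def algebra_simps endo_apply_right_diff)
    then show ?thesis
      using norm_endo_apply_le[OF norm_R, of n "x - y"] \<theta>(1)
      by (simp add: dist_norm mult_left_mono)
  qed
  then obtain u where u: "\<Phi> u = u" using banach_fix_type[OF \<theta>] by blast
  have "(1 + C n) *\<^sub>R u = (1 + C n) *\<^sub>R \<Phi> u" using u by simp
  also have "\<dots> = P n \<bullet>\<^sub>e h + C n *\<^sub>R (R n \<bullet>\<^sub>e u)"
    using C_nonneg[of n] by (simp add: \<Phi>_def \<theta>_def scaleR_add_right)
  finally have eq: "u - K n \<bullet>\<^sub>e u = P n \<bullet>\<^sub>e h"
    by (simp add: K_def algebra_simps)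
  have "P n \<bullet>\<^sub>e u = P n \<bullet>\<^sub>e (P n \<bullet>\<^sub>e h + K n \<bullet>\<^sub>e u)" by (simp flip: eq)
  also have "\<dots> = (P n * P n) \<bullet>\<^sub>e h + (P n * K n) \<bullet>\<^sub>e u"
    by (simp add: endo_apply_right_add)
  also have "\<dots> = P n \<bullet>\<^sub>e h + K n \<bullet>\<^sub>e u" by (simp only: P_P P_K order_refl)
  also have "\<dots> = u" by (simp flip: eq)
  finally show thesis using that eq by blast
qed

text \<open>
  An element \<open>(f, g)\<close> of the generator is approximated by the solutions \<open>u\<close> of
  \<open>u - K n u = P n (f - g)\<close>; dissipativity bounds \<open>\<parallel>u - f\<parallel>\<close> by \<open>\<parallel>P n (f - g) - (f - g)\<parallel>\<close>.
\<close>

lemma gen_approx: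
  assumes fg: "(f, g) \<in> gen"
  obtains u where "\<And>n. P n \<bullet>\<^sub>e u n = u n" "u \<longlonglongrightarrow> f" "(\<lambda>n. K n \<bullet>\<^sub>e u n) \<longlonglongrightarrow> g"
proof -
  have "\<forall>n. \<exists>u. P n \<bullet>\<^sub>e u = u \<and> u - K n \<bullet>\<^sub>e u = P n \<bullet>\<^sub>e (f - g)"
    using P_resolvent by metis
  then obtain u where u: "\<And>n. P n \<bullet>\<^sub>e u n = u n" "\<And>n. u n - K n \<bullet>\<^sub>e u n = P n \<bullet>\<^sub>e (f - g)"
    by metis
  have "norm (u n - f) \<le> norm (P n \<bullet>\<^sub>e (f - g) - (f - g))" for n
  proof -
    have "(u n - f, K n \<bullet>\<^sub>e u n - g) \<in> gen"
      using gen_diff[OF P_gen[of n "u n"] fg] by (simp add: u(1))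
    from gen_dissipative[OF this] have "norm (u n - f) \<le> norm (u n - f - (K n \<bullet>\<^sub>e u n - g))" .
    also have "u n - f - (K n \<bullet>\<^sub>e u n - g) = P n \<bullet>\<^sub>e (f - g) - (f - g)"
      by (simp flip: u(2))
    finally show ?thesis .
  qed
  moreover have lim: "(\<lambda>n. P n \<bullet>\<^sub>e (f - g) - (f - g)) \<longlonglongrightarrow> 0"
    by (intro LIM_zero P_tendsto)
  ultimately have "(\<lambda>n. u n - f) \<longlonglongrightarrow> 0"
    by (intro Lim_null_comparison[OF always_eventually tendsto_norm_zero[OF lim]]) auto
  then have uf: "u \<longlonglongrightarrow> f" by (rule LIM_zero_cancel)
  have "(\<lambda>n. u n - P n \<bullet>\<^sub>e (f - g)) \<longlonglongrightarrow> f - (f - g)"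
    by (intro tendsto_diff uf P_tendsto)
  moreover have "u n - P n \<bullet>\<^sub>e (f - g) = K n \<bullet>\<^sub>e u n" for n
    by (simp flip: u(2))
  ultimately have "(\<lambda>n. K n \<bullet>\<^sub>e u n) \<longlonglongrightarrow> g" by simp
  with u(1) uf show thesis by (rule that)
qed

end

section \<open>Closed convex sets of integrable functions\<close>

lemma l1_tendsto_AE_subseq:
  fixes u :: "nat \<Rightarrow> 'a::euclidean_space l1"
  assumes "u \<longlonglongrightarrow> l"
  obtains r where "strict_mono r" "AE x in lborel. (\<lambda>n. rep_l1 (u (r n)) x) \<longlonglongrightarrow> rep_l1 l x"
proof -
  have "(\<lambda>n. \<integral>x. norm (rep_l1 (u n - l) x) \<partial>lborel) \<longlonglongrightarrow> 0"
    using tendsto_norm_zero[OF LIM_zero[OF assms]] by (simp add: norm_l1_rep)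
  from tendsto_L1_AE_subseq[OF _ this] obtain r where r: "strict_mono r"
    and lim: "AE x in lborel. (\<lambda>n. rep_l1 (u (r n) - l) x) \<longlonglongrightarrow> 0"
    by auto
  have "AE x in lborel. \<forall>n. rep_l1 (u (r n) - l) x = rep_l1 (u (r n)) x - rep_l1 l x"
    unfolding AE_all_countable using rep_l1_diff by blast
  with lim have "AE x in lborel. (\<lambda>n. rep_l1 (u (r n)) x) \<longlonglongrightarrow> rep_l1 l x"
    by eventually_elim (simp add: LIM_zero_iff)
  with r that show thesis by blast
qed

text \<open>A convergent sequence has a subsequence converging almost everywhere, and countably many
  null sets can be discarded together.\<close>

lemma closed_l1_pointwise:
  assumes "\<And>x. closed (S x)"
  shows "closed {u. AE x in lborel. rep_l1 u x \<in> S x}"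
  unfolding closed_sequential_limits
proof (intro allI impI)
  fix u :: "nat \<Rightarrow> 'a l1" and l
  assume u: "(\<forall>n. u n \<in> {u. AE x in lborel. rep_l1 u x \<in> S x}) \<and> u \<longlonglongrightarrow> l"
  then obtain r where "AE x in lborel. (\<lambda>n. rep_l1 (u (r n)) x) \<longlonglongrightarrow> rep_l1 l x"
    using l1_tendsto_AE_subseq by blast
  moreover have "AE x in lborel. \<forall>n. rep_l1 (u (r n)) x \<in> S x"
    unfolding AE_all_countable using u by blast
  ultimately have "AE x in lborel. rep_l1 l x \<in> S x"
  proof eventually_elim
    case (elim x)
    show ?case by (rule closed_sequentially[OF assms _ elim(1)]) (use elim(2) in auto)
  qed
  then show "l \<in> {u. AE x in lborel. rep_l1 u x \<in> S x}" by simp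
qed

lemma rep_l1_lincomb:
  "AE x in lborel. rep_l1 (r *\<^sub>R u + s *\<^sub>R v) x = r * rep_l1 u x + s * rep_l1 v x"
  using rep_l1_add[of "r *\<^sub>R u" "s *\<^sub>R v"] rep_l1_scaleR[of r u] rep_l1_scaleR[of s v]
  by eventually_elim simp

lemma convex_l1_pointwise:
  assumes "\<And>x. convex (S x)"
  shows "convex {u. AE x in lborel. rep_l1 u x \<in> S x}"
proof (rule convexI)
  fix u v :: "'a l1" and r s :: real
  assume "u \<in> {u. AE x in lborel. rep_l1 u x \<in> S x}" "v \<in> {u. AE x in lborel. rep_l1 u x \<in> S x}"
    and rs: "0 \<le> r" "0 \<le> s" "r + s = 1"
  then have "AE x in lborel. rep_l1 u x \<in> S x" "AE x in lborel. rep_l1 v x \<in> S x" by auto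
  with rep_l1_lincomb[of r u s v] have "AE x in lborel. rep_l1 (r *\<^sub>R u + s *\<^sub>R v) x \<in> S x"
  proof eventually_elim
    case (elim x)
    then show ?case
      using convexD[OF assms[of x], of "rep_l1 u x" "rep_l1 v x" r s] rs by simp
  qed
  then show "r *\<^sub>R u + s *\<^sub>R v \<in> {u. AE x in lborel. rep_l1 u x \<in> S x}" by simp
qed

text \<open>With extended real values a moment bound is a condition on every element of
  \<open>l1\<close>, and finiteness expresses membership in the space with the additional
  weight.\<close>

definition l1_moment :: "('a::euclidean_space \<Rightarrow> real) \<Rightarrow> 'a l1 \<Rightarrow> ennreal" where
  "l1_moment v u = (\<integral>\<^sup>+x. ennreal (v x * \<bar>rep_l1 u x\<bar>) \<partial>lborel)"

context
  fixes v :: "'a::euclidean_space \<Rightarrow> real"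
  assumes v_meas [measurable]: "v \<in> borel_measurable borel"
    and v_nonneg: "\<And>x. 0 \<le> v x"
begin

text \<open>A moment is in general only lower semicontinuous; Fatou's lemma along an almost
  everywhere convergent subsequence suffices for sublevel sets.\<close>

lemma closed_l1_moment: "closed {u. l1_moment v u \<le> c}"
  unfolding closed_sequential_limits
proof (intro allI impI)
  fix u :: "nat \<Rightarrow> 'a l1" and l
  assume u: "(\<forall>n. u n \<in> {u. l1_moment v u \<le> c}) \<and> u \<longlonglongrightarrow> l"
  then obtain r where lim: "AE x in lborel. (\<lambda>n. rep_l1 (u (r n)) x) \<longlonglongrightarrow> rep_l1 l x"
    using l1_tendsto_AE_subseq by blast
  have "l1_moment v l = (\<integral>\<^sup>+x. liminf (\<lambda>n. ennreal (v x * \<bar>rep_l1 (u (r n)) x\<bar>)) \<partial>lborel)"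
    unfolding l1_moment_def
  proof (rule nn_integral_cong_AE)
    show "AE x in lborel. ennreal (v x * \<bar>rep_l1 l x\<bar>) =
        liminf (\<lambda>n. ennreal (v x * \<bar>rep_l1 (u (r n)) x\<bar>))"
      using lim
    proof eventually_elim
      case (elim x)
      then have "(\<lambda>n. ennreal (v x * \<bar>rep_l1 (u (r n)) x\<bar>)) \<longlonglongrightarrow> ennreal (v x * \<bar>rep_l1 l x\<bar>)"
        by (intro tendsto_intros)
      then show ?case by (simp add: lim_imp_Liminf)
    qed
  qed
  also have "\<dots> \<le> liminf (\<lambda>n. l1_moment v (u (r n)))"
    unfolding l1_moment_def by (intro nn_integral_liminf) measurable
  also have "\<dots> \<le> c"
    using u by (intro Liminf_le) auto
  finally show "l \<in> {u. l1_moment v u \<le> c}" by simp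
qed

lemma convex_l1_moment: "convex {u. l1_moment v u \<le> c}"
proof (rule convexI)
  fix u w :: "'a l1" and r s :: real
  assume "u \<in> {u. l1_moment v u \<le> c}" "w \<in> {u. l1_moment v u \<le> c}"
    and rs: "0 \<le> r" "0 \<le> s" "r + s = 1"
  then have uw: "l1_moment v u \<le> c" "l1_moment v w \<le> c" by auto
  have "l1_moment v (r *\<^sub>R u + s *\<^sub>R w) \<le>
      (\<integral>\<^sup>+x. r * ennreal (v x * \<bar>rep_l1 u x\<bar>) + s * ennreal (v x * \<bar>rep_l1 w x\<bar>) \<partial>lborel)"
    unfolding l1_moment_def
  proof (rule nn_integral_mono_AE)
    show "AE x in lborel. ennreal (v x * \<bar>rep_l1 (r *\<^sub>R u + s *\<^sub>R w) x\<bar>) \<le>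
        ennreal r * ennreal (v x * \<bar>rep_l1 u x\<bar>) + ennreal s * ennreal (v x * \<bar>rep_l1 w x\<bar>)"
      using rep_l1_lincomb[of r u s w]
    proof eventually_elim
      case (elim x)
      have "v x * \<bar>r * rep_l1 u x + s * rep_l1 w x\<bar> \<le> v x * (r * \<bar>rep_l1 u x\<bar> + s * \<bar>rep_l1 w x\<bar>)"
        using rs v_nonneg by (intro mult_left_mono order_trans[OF abs_triangle_ineq]) (auto simp: abs_mult)
      then show ?case
        using rs v_nonneg
        by (simp add: elim ennreal_mult'[symmetric] ennreal_plus[symmetric] algebra_simps del: ennreal_plus)
    qed
  qed
  also have "\<dots> = r * l1_moment v u + s * l1_moment v w"
    unfolding l1_moment_def by (subst nn_integral_add) (simp_all add: nn_integral_cmult)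
  also have "\<dots> \<le> r * c + s * c"
    by (intro add_mono mult_left_mono uw) auto
  also have "\<dots> = c"
    using rs by (simp add: distrib_right[symmetric] ennreal_plus[symmetric] del: ennreal_plus)
  finally show "r *\<^sub>R u + s *\<^sub>R w \<in> {u. l1_moment v u \<le> c}" by simp
qed

end

section \<open>Positive integral operators with a diagonal part\<close>

text \<open>Columns control the norm in a space of integrable functions: of the mass at
  \<open>y\<close> the share \<open>h y\<close> stays and a total share of at most
  \<open>1 - h y\<close> is spread by \<open>q\<close>. Both the cut-offs and the contractions
  \<open>R n\<close> have this form.\<close>

locale kernel_operator =
  fixes h :: "'a::euclidean_space \<Rightarrow> real" and q :: "'a \<Rightarrow> 'a \<Rightarrow> real"
  assumes h_meas [measurable]: "h \<in> borel_measurable borel"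
    and q_meas [measurable]: "(\<lambda>(x, y). q x y) \<in> borel_measurable (borel \<Otimes>\<^sub>M borel)"
    and h_nonneg: "0 \<le> h x" and q_nonneg: "0 \<le> q x y"
    and column: "AE y in lborel. ennreal (h y) + (\<integral>\<^sup>+x. ennreal (q x y) \<partial>lborel) \<le> 1"
begin

definition kernel_fun :: "('a \<Rightarrow> real) \<Rightarrow> 'a \<Rightarrow> real" where
  "kernel_fun f x = h x * f x + (\<integral>y. q x y * f y \<partial>lborel)"

definition kernel_endo :: "'a l1 endo" where
  "kernel_endo = endo (\<lambda>u. abs_l1 (kernel_fun (rep_l1 u)))"

lemma kernel_fun_measurable [measurable (raw)]:
  assumes [measurable]: "f \<in> borel_measurable borel"
  shows "kernel_fun f \<in> borel_measurable borel"
  unfolding kernel_fun_def by measurable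

lemma kernel_fun_cong_AE:
  assumes [measurable]: "f \<in> borel_measurable borel" "g \<in> borel_measurable borel"
    and fg: "AE x in lborel. f x = g x"
  shows "AE x in lborel. kernel_fun f x = kernel_fun g x"
proof -
  have "(\<integral>y. q x y * f y \<partial>lborel) = (\<integral>y. q x y * g y \<partial>lborel)" for x
    by (rule integral_cong_AE) (use fg in \<open>auto elim: eventually_mono\<close>)
  with fg show ?thesis unfolding kernel_fun_def by (auto elim: eventually_mono)
qed

text \<open>Tonelli's theorem collects the column at \<open>y\<close> as the coefficient of |f(y)|.
  The weight 1 yields contractivity, other weights yield moment estimates; having absolute values
  inside the integral also yields integrability of \<open>q x y * f y\<close> in
  \<open>y\<close>.\<close>

lemma nn_integral_abs_kernel:
  assumes [measurable]: "f \<in> borel_measurable borel" "v \<in> borel_measurable borel"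
    and v: "\<And>x. 0 \<le> v x"
    and col: "AE y in lborel. ennreal (h y * v y) + (\<integral>\<^sup>+x. ennreal (v x * q x y) \<partial>lborel) \<le> ennreal (v y)"
  shows "(\<integral>\<^sup>+x. ennreal (v x) * (ennreal (h x * \<bar>f x\<bar>) + (\<integral>\<^sup>+y. ennreal (q x y * \<bar>f y\<bar>) \<partial>lborel)) \<partial>lborel)
    \<le> (\<integral>\<^sup>+x. ennreal (v x * \<bar>f x\<bar>) \<partial>lborel)"
proof -
  have "(\<integral>\<^sup>+x. ennreal (v x) * (ennreal (h x * \<bar>f x\<bar>) + (\<integral>\<^sup>+y. ennreal (q x y * \<bar>f y\<bar>) \<partial>lborel)) \<partial>lborel)
      = (\<integral>\<^sup>+x. ennreal (h x * v x) * ennreal \<bar>f x\<bar> + (\<integral>\<^sup>+y. ennreal (v x * q x y) * ennreal \<bar>f y\<bar> \<partial>lborel) \<partial>lborel)"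
    using v h_nonneg q_nonneg
    by (intro nn_integral_cong) (simp add: distrib_left nn_integral_cmult[symmetric] ennreal_mult'[symmetric] mult_ac)
  also have "\<dots> = (\<integral>\<^sup>+x. ennreal (h x * v x) * ennreal \<bar>f x\<bar> \<partial>lborel) +
      (\<integral>\<^sup>+x. (\<integral>\<^sup>+y. ennreal (v x * q x y) * ennreal \<bar>f y\<bar> \<partial>lborel) \<partial>lborel)"
    by (rule nn_integral_add) measurable
  also have "(\<integral>\<^sup>+x. (\<integral>\<^sup>+y. ennreal (v x * q x y) * ennreal \<bar>f y\<bar> \<partial>lborel) \<partial>lborel) =
      (\<integral>\<^sup>+y. (\<integral>\<^sup>+x. ennreal (v x * q x y) * ennreal \<bar>f y\<bar> \<partial>lborel) \<partial>lborel)"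
    by (rule lborel_pair.Fubini'[symmetric]) measurable
  also have "(\<integral>\<^sup>+x. ennreal (h x * v x) * ennreal \<bar>f x\<bar> \<partial>lborel) + \<dots> =
      (\<integral>\<^sup>+y. ennreal (h y * v y) * ennreal \<bar>f y\<bar> + (\<integral>\<^sup>+x. ennreal (v x * q x y) * ennreal \<bar>f y\<bar> \<partial>lborel) \<partial>lborel)"
    by (rule nn_integral_add[symmetric]) measurable
  also have "\<dots> = (\<integral>\<^sup>+y. (ennreal (h y * v y) + (\<integral>\<^sup>+x. ennreal (v x * q x y) \<partial>lborel)) * ennreal \<bar>f y\<bar> \<partial>lborel)"
    by (intro nn_integral_cong) (simp add: distrib_right nn_integral_multc)
  also have "\<dots> \<le> (\<integral>\<^sup>+y. ennreal (v y) * ennreal \<bar>f y\<bar> \<partial>lborel)"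
    using col by (intro nn_integral_mono_AE) (auto elim!: eventually_mono intro!: mult_right_mono)
  also have "\<dots> = (\<integral>\<^sup>+x. ennreal (v x * \<bar>f x\<bar>) \<partial>lborel)"
    using v by (simp add: ennreal_mult')
  finally show ?thesis .
qed

text \<open>This holds at every \<open>x\<close>, because the Bochner integral is 0 where it does
  not exist.\<close>

lemma abs_kernel_fun_le:
  assumes [measurable]: "f \<in> borel_measurable borel"
  shows "ennreal \<bar>kernel_fun f x\<bar> \<le> ennreal (h x * \<bar>f x\<bar>) + (\<integral>\<^sup>+y. ennreal (q x y * \<bar>f y\<bar>) \<partial>lborel)"
proof -
  have "ennreal \<bar>kernel_fun f x\<bar> \<le> ennreal (\<bar>h x * f x\<bar> + \<bar>\<integral>y. q x y * f y \<partial>lborel\<bar>)"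
    unfolding kernel_fun_def by (intro ennreal_leI abs_triangle_ineq)
  also have "\<dots> = ennreal (h x * \<bar>f x\<bar>) + ennreal \<bar>\<integral>y. q x y * f y \<partial>lborel\<bar>"
    using h_nonneg by (simp add: abs_mult)
  also have "ennreal \<bar>\<integral>y. q x y * f y \<partial>lborel\<bar> \<le> (\<integral>\<^sup>+y. ennreal (norm (q x y * f y)) \<partial>lborel)"
  proof (cases "integrable lborel (\<lambda>y. q x y * f y)")
    case True
    from integral_norm_bound_ennreal[OF this] show ?thesis by simp
  qed (simp add: not_integrable_integral_eq)
  finally show ?thesis
    using q_nonneg by (simp add: abs_mult)
qed

lemma kernel_fun_moment:
  assumes [measurable]: "f \<in> borel_measurable borel" "v \<in> borel_measurable borel"
    and v: "\<And>x. 0 \<le> v x"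
    and col: "AE y in lborel. ennreal (h y * v y) + (\<integral>\<^sup>+x. ennreal (v x * q x y) \<partial>lborel) \<le> ennreal (v y)"
  shows "(\<integral>\<^sup>+x. ennreal (v x * \<bar>kernel_fun f x\<bar>) \<partial>lborel) \<le> (\<integral>\<^sup>+x. ennreal (v x * \<bar>f x\<bar>) \<partial>lborel)"
proof -
  have "(\<integral>\<^sup>+x. ennreal (v x * \<bar>kernel_fun f x\<bar>) \<partial>lborel) \<le>
      (\<integral>\<^sup>+x. ennreal (v x) * (ennreal (h x * \<bar>f x\<bar>) + (\<integral>\<^sup>+y. ennreal (q x y * \<bar>f y\<bar>) \<partial>lborel)) \<partial>lborel)"
    using v by (intro nn_integral_mono) (simp add: ennreal_mult' mult_left_mono abs_kernel_fun_le)
  also have "\<dots> \<le> (\<integral>\<^sup>+x. ennreal (v x * \<bar>f x\<bar>) \<partial>lborel)"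
    by (rule nn_integral_abs_kernel) (use assms in auto)
  finally show ?thesis .
qed

lemma kernel_fun_norm:
  assumes f: "f \<in> borel_measurable borel"
  shows "(\<integral>\<^sup>+x. ennreal \<bar>kernel_fun f x\<bar> \<partial>lborel) \<le> (\<integral>\<^sup>+x. ennreal \<bar>f x\<bar> \<partial>lborel)"
  using kernel_fun_moment[OF f, of "\<lambda>_. 1"] column by simp

lemma integrable_kernel_fun:
  assumes f: "integrable lborel f"
  shows "integrable lborel (kernel_fun f)"
proof -
  have [measurable]: "f \<in> borel_measurable borel"
    using borel_measurable_integrable[OF f] by simp
  have "(\<integral>\<^sup>+x. ennreal \<bar>kernel_fun f x\<bar> \<partial>lborel) \<le> (\<integral>\<^sup>+x. ennreal \<bar>f x\<bar> \<partial>lborel)"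
    by (rule kernel_fun_norm) measurable
  also have "\<dots> < \<infinity>" using f by (simp add: integrable_iff_bounded)
  finally show ?thesis by (simp add: integrable_iff_bounded)
qed

lemma integrable_kernel_AE:
  assumes f: "integrable lborel f"
  shows "AE x in lborel. integrable lborel (\<lambda>y. q x y * f y)"
proof -
  have [measurable]: "f \<in> borel_measurable borel"
    using borel_measurable_integrable[OF f] by simp
  have "(\<integral>\<^sup>+x. (\<integral>\<^sup>+y. ennreal (q x y * \<bar>f y\<bar>) \<partial>lborel) \<partial>lborel) \<le>
      (\<integral>\<^sup>+x. ennreal 1 * (ennreal (h x * \<bar>f x\<bar>) + (\<integral>\<^sup>+y. ennreal (q x y * \<bar>f y\<bar>) \<partial>lborel)) \<partial>lborel)"
    by (intro nn_integral_mono) simp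
  also have "\<dots> \<le> (\<integral>\<^sup>+x. ennreal (1 * \<bar>f x\<bar>) \<partial>lborel)"
    by (rule nn_integral_abs_kernel) (use column in auto)
  also have "\<dots> < \<infinity>" using f by (simp add: integrable_iff_bounded)
  finally have "AE x in lborel. (\<integral>\<^sup>+y. ennreal (q x y * \<bar>f y\<bar>) \<partial>lborel) \<noteq> \<infinity>"
    by (intro nn_integral_PInf_AE) auto
  then show ?thesis
    by eventually_elim (simp add: integrable_iff_bounded abs_mult q_nonneg less_top)
qed

text \<open>Unlike scaling, additivity can fail where an inner integral does not exist, hence the
  exceptional null set.\<close>

lemma kernel_fun_add:
  assumes f: "integrable lborel f" and g: "integrable lborel g"
  shows "AE x in lborel. kernel_fun (\<lambda>x. f x + g x) x = kernel_fun f x + kernel_fun g x"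
  using integrable_kernel_AE[OF f] integrable_kernel_AE[OF g]
  by eventually_elim (simp add: kernel_fun_def distrib_left)

lemma kernel_fun_scale: "kernel_fun (\<lambda>x. r * f x) x = r * kernel_fun f x"
proof -
  have "(\<integral>y. q x y * (r * f y) \<partial>lborel) = r * (\<integral>y. q x y * f y \<partial>lborel)"
    by (subst integral_mult_right_zero[symmetric]) (simp add: mult_ac)
  then show ?thesis by (simp add: kernel_fun_def algebra_simps)
qed

lemma bounded_linear_kernel: "bounded_linear (\<lambda>u. abs_l1 (kernel_fun (rep_l1 u)))"
proof (rule bounded_linear_intro[where K = 1])
  fix u v :: "'a l1" and r :: real
  note [simp] = integrable_kernel_fun
  have "AE x in lborel. kernel_fun (rep_l1 (u + v)) x = kernel_fun (\<lambda>x. rep_l1 u x + rep_l1 v x) x"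
    by (rule kernel_fun_cong_AE) (simp_all add: rep_l1_add)
  moreover have "AE x in lborel. kernel_fun (\<lambda>x. rep_l1 u x + rep_l1 v x) x =
      kernel_fun (rep_l1 u) x + kernel_fun (rep_l1 v) x"
    by (rule kernel_fun_add) auto
  ultimately have "AE x in lborel. kernel_fun (rep_l1 (u + v)) x = kernel_fun (rep_l1 u) x + kernel_fun (rep_l1 v) x"
    by eventually_elim simp
  then show "abs_l1 (kernel_fun (rep_l1 (u + v))) = abs_l1 (kernel_fun (rep_l1 u)) + abs_l1 (kernel_fun (rep_l1 v))"
    by (simp add: abs_l1_add abs_l1_eq_iff)
  have "AE x in lborel. kernel_fun (rep_l1 (r *\<^sub>R u)) x = kernel_fun (\<lambda>x. r * rep_l1 u x) x"
    by (rule kernel_fun_cong_AE) (simp_all add: rep_l1_scaleR)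
  then show "abs_l1 (kernel_fun (rep_l1 (r *\<^sub>R u))) = r *\<^sub>R abs_l1 (kernel_fun (rep_l1 u))"
    by (simp add: abs_l1_scaleR abs_l1_eq_iff kernel_fun_scale)
  have "ennreal (norm (abs_l1 (kernel_fun (rep_l1 u)))) = (\<integral>\<^sup>+x. ennreal \<bar>kernel_fun (rep_l1 u) x\<bar> \<partial>lborel)"
    by (simp add: norm_abs_l1 nn_integral_eq_integral)
  also have "\<dots> \<le> (\<integral>\<^sup>+x. ennreal \<bar>rep_l1 u x\<bar> \<partial>lborel)"
    by (rule kernel_fun_norm) measurable
  finally show "norm (abs_l1 (kernel_fun (rep_l1 u))) \<le> norm u * 1"
    by (simp add: nn_integral_rep_l1)
qed

lemma kernel_endo_apply: "kernel_endo \<bullet>\<^sub>e u = abs_l1 (kernel_fun (rep_l1 u))"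
  unfolding kernel_endo_def by (rule endo_apply_endo[OF bounded_linear_kernel])

lemma rep_kernel_endo: "AE x in lborel. rep_l1 (kernel_endo \<bullet>\<^sub>e u) x = kernel_fun (rep_l1 u) x"
  unfolding kernel_endo_apply by (rule rep_abs_l1) (simp add: integrable_kernel_fun)

lemma norm_kernel_endo: "norm kernel_endo \<le> 1"
proof (rule norm_endo_le)
  fix u :: "'a l1"
  have "ennreal (norm (kernel_endo \<bullet>\<^sub>e u)) = (\<integral>\<^sup>+x. ennreal \<bar>kernel_fun (rep_l1 u) x\<bar> \<partial>lborel)"
    by (simp add: kernel_endo_apply norm_abs_l1 nn_integral_eq_integral integrable_kernel_fun)
  also have "\<dots> \<le> (\<integral>\<^sup>+x. ennreal \<bar>rep_l1 u x\<bar> \<partial>lborel)"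
    by (rule kernel_fun_norm) measurable
  finally show "norm (kernel_endo \<bullet>\<^sub>e u) \<le> norm u"
    by (simp add: nn_integral_rep_l1)
qed

lemma kernel_endo_moment:
  assumes [measurable]: "v \<in> borel_measurable borel" and "\<And>x. 0 \<le> v x"
    and "AE y in lborel. ennreal (h y * v y) + (\<integral>\<^sup>+x. ennreal (v x * q x y) \<partial>lborel) \<le> ennreal (v y)"
  shows "l1_moment v (kernel_endo \<bullet>\<^sub>e u) \<le> l1_moment v u"
proof -
  have "l1_moment v (kernel_endo \<bullet>\<^sub>e u) = (\<integral>\<^sup>+x. ennreal (v x * \<bar>kernel_fun (rep_l1 u) x\<bar>) \<partial>lborel)"
    unfolding l1_moment_def
    by (rule nn_integral_cong_AE) (use rep_kernel_endo[of u] in \<open>auto elim: eventually_mono\<close>)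
  also have "\<dots> \<le> l1_moment v u"
    unfolding l1_moment_def by (rule kernel_fun_moment) (use assms in auto)
  finally show ?thesis .
qed

lemma kernel_endo_nonneg:
  assumes "AE x in lborel. 0 \<le> rep_l1 u x"
  shows "AE x in lborel. 0 \<le> rep_l1 (kernel_endo \<bullet>\<^sub>e u) x"
proof -
  have pos: "0 \<le> (\<integral>y. q x y * rep_l1 u y \<partial>lborel)" for x
    using assms q_nonneg by (intro integral_nonneg_AE) (auto elim: eventually_mono)
  from rep_kernel_endo[of u] assms show ?thesis
    by eventually_elim (simp add: kernel_fun_def h_nonneg pos)
qed

end

section \<open>The unweighted fragmentation semigroup\<close>

text \<open>The problem after the weight has been absorbed: \<open>\<alpha>\<close> is the rate and
  \<open>k\<close> the conjugated kernel, and \<open>k_column\<close> says that gain does not exceed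
  loss. The half-line reappears later, through the zero set of the weight.\<close>

locale fragmentation =
  fixes k :: "real \<Rightarrow> real \<Rightarrow> real" and \<alpha> :: "real \<Rightarrow> real" and C :: "nat \<Rightarrow> real"
  assumes k_meas [measurable]: "(\<lambda>(x, y). k x y) \<in> borel_measurable (borel \<Otimes>\<^sub>M borel)"
    and \<alpha>_meas [measurable]: "\<alpha> \<in> borel_measurable borel"
    and k_nonneg: "0 \<le> k x y" and \<alpha>_nonneg: "0 \<le> \<alpha> x"
    and k_zero: "y \<le> x \<Longrightarrow> k x y = 0"
    and C_pos: "0 < C n" and \<alpha>_le: "y < real n \<Longrightarrow> \<alpha> y \<le> C n"
    and k_column: "AE y in lborel. (\<integral>\<^sup>+x. ennreal (k x y) \<partial>lborel) \<le> ennreal (\<alpha> y)"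
begin

abbreviation I :: "nat \<Rightarrow> real \<Rightarrow> real" where
  "I n \<equiv> indicator {..<real n}"

text \<open>
  \<open>R n\<close> is \<open>1 + (G \<circ> P n) / C n\<close>, a positive contraction because \<open>\<alpha> \<le> C n\<close> on \<open>(-\<infinity>, n)\<close>.
\<close>

definition P :: "nat \<Rightarrow> real l1 endo" where
  "P n = kernel_operator.kernel_endo (I n) (\<lambda>_ _. 0)"

definition R :: "nat \<Rightarrow> real l1 endo" where
  "R n = kernel_operator.kernel_endo (\<lambda>x. 1 - I n x * \<alpha> x / C n) (\<lambda>x y. k x y * I n y / C n)"

text \<open>The formal sum A + B on representatives. It is total because the integral is 0 where it
  does not exist; for integrable \<open>\<alpha> x * f x\<close> that happens on a null set
  only.\<close>

definition G :: "(real \<Rightarrow> real) \<Rightarrow> real \<Rightarrow> real" where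
  "G f x = - (\<alpha> x * f x) + (\<integral>y. k x y * f y \<partial>lborel)"

definition K :: "nat \<Rightarrow> real l1 endo" where
  "K n = C n *\<^sub>R (R n - 1)"

text \<open>Fragments of \<open>y\<close> are smaller than \<open>y\<close>, so a nondecreasing
  \<open>v\<close> is at most \<open>v y\<close> on them, and the gain is at most \<alpha>(y) v(y) /
  C n, exactly what the diagonal part loses. For \<open>y\<close> beyond \<open>n\<close> the column
  is that of the identity.\<close>

lemma R_column:
  assumes [measurable]: "v \<in> borel_measurable borel"
    and v: "\<And>x. 0 \<le> v x" "\<And>x y. x < y \<Longrightarrow> v x \<le> v y"
  shows "AE y in lborel. ennreal ((1 - I n y * \<alpha> y / C n) * v y) +
    (\<integral>\<^sup>+x. ennreal (v x * (k x y * I n y / C n)) \<partial>lborel) \<le> ennreal (v y)"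
  using k_column
proof eventually_elim
  case (elim y)
  show ?case
  proof (cases "y < real n")
    case True
    have "(\<integral>\<^sup>+x. ennreal (v x * (k x y * I n y / C n)) \<partial>lborel) \<le>
        (\<integral>\<^sup>+x. ennreal (v y / C n) * ennreal (k x y) \<partial>lborel)"
    proof (rule nn_integral_mono)
      fix x
      have "v x * k x y \<le> v y * k x y"
        using v(2)[of x y] k_zero[of y x] k_nonneg[of x y] by (cases "x < y") (auto intro: mult_right_mono)
      then have "v x * k x y / C n \<le> v y * k x y / C n"
        using C_pos[of n] by (simp add: divide_right_mono)
      then have "ennreal (v x * k x y / C n) \<le> ennreal (v y * k x y / C n)"
        by (rule ennreal_leI)
      also have "\<dots> = ennreal (v y / C n) * ennreal (k x y)"
        using v(1)[of y] k_nonneg[of x y] C_pos[of n] by (simp add: ennreal_mult'[symmetric] ennreal_mult[symmetric] field_simps)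
      finally show "ennreal (v x * (k x y * I n y / C n)) \<le> ennreal (v y / C n) * ennreal (k x y)"
        using True by simp
    qed
    also have "\<dots> = ennreal (v y / C n) * (\<integral>\<^sup>+x. ennreal (k x y) \<partial>lborel)"
      by (rule nn_integral_cmult) measurable
    also have "\<dots> \<le> ennreal (v y / C n) * ennreal (\<alpha> y)"
      by (intro mult_left_mono elim) auto
    also have "\<dots> = ennreal (\<alpha> y / C n * v y)"
      using v(1)[of y] C_pos[of n] \<alpha>_nonneg[of y] by (simp add: ennreal_mult[symmetric] field_simps)
    finally have "ennreal ((1 - I n y * \<alpha> y / C n) * v y) + (\<integral>\<^sup>+x. ennreal (v x * (k x y * I n y / C n)) \<partial>lborel)
        \<le> ennreal ((1 - \<alpha> y / C n) * v y) + ennreal (\<alpha> y / C n * v y)"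
      using True by (intro add_mono) auto
    also have "\<dots> = ennreal (v y)"
      using v(1)[of y] C_pos[of n] \<alpha>_nonneg[of y] \<alpha>_le[OF True]
      by (subst ennreal_plus[symmetric]) (auto simp: field_simps intro: mult_right_mono)
    finally show ?thesis .
  qed simp
qed

lemma P_kernel: "kernel_operator (I n) (\<lambda>_ _. 0)"
  by unfold_locales (auto simp: indicator_def)

lemma R_kernel: "kernel_operator (\<lambda>x. 1 - I n x * \<alpha> x / C n) (\<lambda>x y. k x y * I n y / C n)"
proof
  show "0 \<le> 1 - I n x * \<alpha> x / C n" for x
    using \<alpha>_le[of x n] C_pos[of n] by (cases "x < real n") auto
  show "0 \<le> k x y * I n y / C n" for x y
    using k_nonneg[of x y] C_pos[of n] by simp
  show "AE y in lborel. ennreal (1 - I n y * \<alpha> y / C n) + (\<integral>\<^sup>+x. ennreal (k x y * I n y / C n) \<partial>lborel) \<le> 1"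
    using R_column[of "\<lambda>_. 1" n] by simp
qed measurable

lemma rep_P: "AE x in lborel. rep_l1 (P n \<bullet>\<^sub>e u) x = I n x * rep_l1 u x"
  unfolding P_def using kernel_operator.rep_kernel_endo[OF P_kernel, of n u]
  by (simp add: kernel_operator.kernel_fun_def[OF P_kernel])

lemma G_measurable [measurable (raw)]:
  assumes [measurable]: "f \<in> borel_measurable borel"
  shows "G f \<in> borel_measurable borel"
  unfolding G_def by measurable

lemma G_cong_AE:
  assumes [measurable]: "f \<in> borel_measurable borel" "g \<in> borel_measurable borel"
    and fg: "AE x in lborel. f x = g x"
  shows "AE x in lborel. G f x = G g x"
proof -
  have "(\<integral>y. k x y * f y \<partial>lborel) = (\<integral>y. k x y * g y \<partial>lborel)" for x
    by (rule integral_cong_AE) (use fg in \<open>auto elim: eventually_mono\<close>)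
  with fg show ?thesis unfolding G_def by (auto elim: eventually_mono)
qed

lemma rep_K: "AE x in lborel. rep_l1 (K n \<bullet>\<^sub>e u) x = G (\<lambda>y. I n y * rep_l1 u y) x"
proof -
  have *: "C n * (\<integral>y. k x y * I n y / C n * rep_l1 u y \<partial>lborel) = (\<integral>y. k x y * (I n y * rep_l1 u y) \<partial>lborel)" for x
    using C_pos[of n] by (subst integral_mult_right_zero[symmetric]) (simp add: mult_ac)
  have "AE x in lborel. rep_l1 (R n \<bullet>\<^sub>e u) x =
      (1 - I n x * \<alpha> x / C n) * rep_l1 u x + (\<integral>y. k x y * I n y / C n * rep_l1 u y \<partial>lborel)"
    unfolding R_def using kernel_operator.rep_kernel_endo[OF R_kernel, of n u]
    by (simp add: kernel_operator.kernel_fun_def[OF R_kernel])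
  moreover have "AE x in lborel. rep_l1 (K n \<bullet>\<^sub>e u) x = C n * rep_l1 (R n \<bullet>\<^sub>e u - u) x"
    unfolding K_def using rep_l1_scaleR[of "C n" "R n \<bullet>\<^sub>e u - u"] by simp
  moreover note rep_l1_diff[of "R n \<bullet>\<^sub>e u" u]
  ultimately show ?thesis
  proof eventually_elim
    case (elim x)
    have "rep_l1 (K n \<bullet>\<^sub>e u) x = - (\<alpha> x * (I n x * rep_l1 u x)) +
        C n * (\<integral>y. k x y * I n y / C n * rep_l1 u y \<partial>lborel)"
      unfolding elim using C_pos[of n] by (simp add: field_simps)
    then show ?case by (simp only: * G_def)
  qed
qed

lemma rep_K_P: "AE x in lborel. rep_l1 (K n \<bullet>\<^sub>e P m \<bullet>\<^sub>e u) x = G (\<lambda>y. I n y * I m y * rep_l1 u y) x"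
proof -
  have "AE y in lborel. I n y * rep_l1 (P m \<bullet>\<^sub>e u) y = I n y * I m y * rep_l1 u y"
    using rep_P[of m u] by eventually_elim simp
  then have "AE x in lborel. G (\<lambda>y. I n y * rep_l1 (P m \<bullet>\<^sub>e u) y) x = G (\<lambda>y. I n y * I m y * rep_l1 u y) x"
    by (intro G_cong_AE) measurable
  with rep_K[of n "P m \<bullet>\<^sub>e u"] show ?thesis by eventually_elim simp
qed

lemma I_mult: "m \<le> n \<Longrightarrow> I n x * I m x = I m x"
  by (auto simp: indicator_def)

text \<open>At x \<ge> n only y > x contribute, and there the cut-off vanishes.\<close>

lemma G_I_mult: "I n x * G (\<lambda>y. I n y * f y) x = G (\<lambda>y. I n y * f y) x"
proof (cases "x < real n")
  case False
  then have "k x y * (I n y * f y) = 0" for y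
    using k_zero[of y x] by (auto simp: indicator_def)
  then have "(\<integral>y. k x y * (I n y * f y) \<partial>lborel) = 0" by (simp only: Bochner_Integration.integral_zero)
  then show ?thesis using False by (simp add: G_def)
qed simp

sublocale semigroup: exhausted_generator P R C K
proof (rule exhausted_generator.intro)
  fix m n and u :: "real l1"
  show "K n = C n *\<^sub>R (R n - 1)" by (simp add: K_def)
  show "0 \<le> C n" using C_pos[of n] by simp
  show "norm (P n) \<le> 1" unfolding P_def by (rule kernel_operator.norm_kernel_endo[OF P_kernel])
  show "norm (R n) \<le> 1" unfolding R_def by (rule kernel_operator.norm_kernel_endo[OF R_kernel])
  show "P n * P m = P m" if "m \<le> n"
  proof (rule endo_eqI)
    fix u
    from rep_P[of n "P m \<bullet>\<^sub>e u"] rep_P[of m u]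
    have "AE x in lborel. rep_l1 (P n \<bullet>\<^sub>e P m \<bullet>\<^sub>e u) x = rep_l1 (P m \<bullet>\<^sub>e u) x"
      by eventually_elim (use I_mult[OF that] in \<open>simp add: mult.assoc[symmetric]\<close>)
    then show "(P n * P m) \<bullet>\<^sub>e u = P m \<bullet>\<^sub>e u" by (simp add: l1_eq_iff)
  qed
  show "K n * P m = K m * P m" if "m \<le> n"
  proof (rule endo_eqI)
    fix u
    from rep_K_P[of n m u] rep_K_P[of m m u]
    have "AE x in lborel. rep_l1 (K n \<bullet>\<^sub>e P m \<bullet>\<^sub>e u) x = rep_l1 (K m \<bullet>\<^sub>e P m \<bullet>\<^sub>e u) x"
      by eventually_elim (simp add: I_mult that)
    then show "(K n * P m) \<bullet>\<^sub>e u = (K m * P m) \<bullet>\<^sub>e u" by (simp add: l1_eq_iff)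
  qed
  show "P n * K n = K n"
  proof (rule endo_eqI)
    fix u
    from rep_P[of n "K n \<bullet>\<^sub>e u"] rep_K[of n u]
    have "AE x in lborel. rep_l1 (P n \<bullet>\<^sub>e K n \<bullet>\<^sub>e u) x = rep_l1 (K n \<bullet>\<^sub>e u) x"
      by eventually_elim (simp add: G_I_mult)
    then show "(P n * K n) \<bullet>\<^sub>e u = K n \<bullet>\<^sub>e u" by (simp add: l1_eq_iff)
  qed
  show "(\<lambda>n. P n \<bullet>\<^sub>e u) \<longlonglongrightarrow> u"
  proof -
    have "(\<lambda>n. \<integral>x. \<bar>I n x * rep_l1 u x - rep_l1 u x\<bar> \<partial>lborel) \<longlonglongrightarrow> (\<integral>x. (0::real) \<partial>(lborel :: real measure))"
    proof (rule integral_dominated_convergence[where w = "\<lambda>x. \<bar>rep_l1 u x\<bar>"])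
      show "AE x in lborel. (\<lambda>n. \<bar>I n x * rep_l1 u x - rep_l1 u x\<bar>) \<longlonglongrightarrow> 0"
      proof (rule AE_I2, rule tendsto_eventually)
        fix x
        obtain N where N: "x < real N" using reals_Archimedean2 by blast
        show "\<forall>\<^sub>F n in sequentially. \<bar>I n x * rep_l1 u x - rep_l1 u x\<bar> = 0"
          by (rule eventually_sequentiallyI[of N]) (use N in \<open>auto simp: indicator_def\<close>)
      qed
      show "AE x in lborel. norm \<bar>I n x * rep_l1 u x - rep_l1 u x\<bar> \<le> \<bar>rep_l1 u x\<bar>" for n
        by (auto simp: indicator_def)
      show "(\<lambda>x. \<bar>I n x * rep_l1 u x - rep_l1 u x\<bar>) \<in> borel_measurable lborel" for n
        by measurable
    qed simp_all
    moreover have "norm (P n \<bullet>\<^sub>e u - u) = (\<integral>x. \<bar>I n x * rep_l1 u x - rep_l1 u x\<bar> \<partial>lborel)" for n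
      unfolding norm_l1_rep
    proof (rule integral_cong_AE)
      show "AE x in lborel. \<bar>rep_l1 (P n \<bullet>\<^sub>e u - u) x\<bar> = \<bar>I n x * rep_l1 u x - rep_l1 u x\<bar>"
        using rep_l1_diff[of "P n \<bullet>\<^sub>e u" u] rep_P[of n u] by eventually_elim simp
    qed measurable
    ultimately have "(\<lambda>n. norm (P n \<bullet>\<^sub>e u - u)) \<longlonglongrightarrow> 0" by simp
    then show ?thesis using LIM_zero_cancel tendsto_norm_zero_iff by blast
  qed
qed

section \<open>The operator A + B without weight, and the generator as its closure\<close>

definition graph :: "(real l1 \<times> real l1) set" where
  "graph = {(u, w). integrable lborel (\<lambda>x. \<alpha> x * rep_l1 u x) \<and>
     (AE x in lborel. rep_l1 w x = G (rep_l1 u) x)}"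

text \<open>The gain is bounded relative to the loss with constant 1, so the domain of A lies in
  that of B. This is why \<open>graph\<close> asks for integrability of the loss alone.\<close>

lemma nn_integral_kernel_le:
  assumes [measurable]: "f \<in> borel_measurable borel"
  shows "(\<integral>\<^sup>+x. (\<integral>\<^sup>+y. ennreal \<bar>k x y * f y\<bar> \<partial>lborel) \<partial>lborel) \<le> (\<integral>\<^sup>+y. ennreal \<bar>\<alpha> y * f y\<bar> \<partial>lborel)"
proof -
  have "(\<integral>\<^sup>+x. (\<integral>\<^sup>+y. ennreal \<bar>k x y * f y\<bar> \<partial>lborel) \<partial>lborel) =
      (\<integral>\<^sup>+y. (\<integral>\<^sup>+x. ennreal (k x y) * ennreal \<bar>f y\<bar> \<partial>lborel) \<partial>lborel)"
    by (subst lborel_pair.Fubini') (simp_all add: abs_mult k_nonneg ennreal_mult)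
  also have "\<dots> = (\<integral>\<^sup>+y. (\<integral>\<^sup>+x. ennreal (k x y) \<partial>lborel) * ennreal \<bar>f y\<bar> \<partial>lborel)"
    by (intro nn_integral_cong nn_integral_multc) measurable
  also have "\<dots> \<le> (\<integral>\<^sup>+y. ennreal (\<alpha> y) * ennreal \<bar>f y\<bar> \<partial>lborel)"
    using k_column by (intro nn_integral_mono_AE) (auto elim!: eventually_mono intro!: mult_right_mono)
  also have "\<dots> = (\<integral>\<^sup>+y. ennreal \<bar>\<alpha> y * f y\<bar> \<partial>lborel)"
    by (simp add: abs_mult \<alpha>_nonneg ennreal_mult)
  finally show ?thesis .
qed

lemma integrable_kernel_AE:
  assumes [measurable]: "f \<in> borel_measurable borel" and f: "integrable lborel (\<lambda>x. \<alpha> x * f x)"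
  shows "AE x in lborel. integrable lborel (\<lambda>y. k x y * f y)"
proof -
  note nn_integral_kernel_le[OF assms(1)]
  also have "(\<integral>\<^sup>+y. ennreal \<bar>\<alpha> y * f y\<bar> \<partial>lborel) < \<infinity>"
    using f by (simp add: integrable_iff_bounded)
  finally have "AE x in lborel. (\<integral>\<^sup>+y. ennreal \<bar>k x y * f y\<bar> \<partial>lborel) \<noteq> \<infinity>"
    by (intro nn_integral_PInf_AE) auto
  then show ?thesis by eventually_elim (simp add: integrable_iff_bounded less_top)
qed

lemma nn_integral_G_le:
  assumes [measurable]: "f \<in> borel_measurable borel"
  shows "(\<integral>\<^sup>+x. ennreal \<bar>G f x\<bar> \<partial>lborel) \<le> 2 * (\<integral>\<^sup>+y. ennreal \<bar>\<alpha> y * f y\<bar> \<partial>lborel)"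
proof -
  have "ennreal \<bar>G f x\<bar> \<le> ennreal \<bar>\<alpha> x * f x\<bar> + (\<integral>\<^sup>+y. ennreal \<bar>k x y * f y\<bar> \<partial>lborel)" for x
  proof -
    have "ennreal \<bar>G f x\<bar> \<le> ennreal (\<bar>\<alpha> x * f x\<bar> + \<bar>\<integral>y. k x y * f y \<partial>lborel\<bar>)"
      unfolding G_def by (intro ennreal_leI) simp
    also have "\<dots> = ennreal \<bar>\<alpha> x * f x\<bar> + ennreal \<bar>\<integral>y. k x y * f y \<partial>lborel\<bar>" by simp
    also have "ennreal \<bar>\<integral>y. k x y * f y \<partial>lborel\<bar> \<le> (\<integral>\<^sup>+y. ennreal \<bar>k x y * f y\<bar> \<partial>lborel)"
    proof (cases "integrable lborel (\<lambda>y. k x y * f y)")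
      case True
      from integral_norm_bound_ennreal[OF this] show ?thesis by simp
    qed (simp add: not_integrable_integral_eq)
    finally show ?thesis by simp
  qed
  then have "(\<integral>\<^sup>+x. ennreal \<bar>G f x\<bar> \<partial>lborel) \<le>
      (\<integral>\<^sup>+x. ennreal \<bar>\<alpha> x * f x\<bar> + (\<integral>\<^sup>+y. ennreal \<bar>k x y * f y\<bar> \<partial>lborel) \<partial>lborel)"
    by (rule nn_integral_mono)
  also have "\<dots> = (\<integral>\<^sup>+x. ennreal \<bar>\<alpha> x * f x\<bar> \<partial>lborel) + (\<integral>\<^sup>+x. (\<integral>\<^sup>+y. ennreal \<bar>k x y * f y\<bar> \<partial>lborel) \<partial>lborel)"
    by (rule nn_integral_add) measurable
  also have "\<dots> \<le> 2 * (\<integral>\<^sup>+y. ennreal \<bar>\<alpha> y * f y\<bar> \<partial>lborel)"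
    using nn_integral_kernel_le[OF assms] by (simp add: mult_2 add_left_mono)
  finally show ?thesis .
qed

text \<open>Below \<open>n\<close> the rate is bounded by \<open>C n\<close>, which puts
  \<open>u\<close> into the domain, and the cut-off built into \<open>K n\<close> does not change
  \<open>u\<close>.\<close>

lemma P_graph:
  assumes "P n \<bullet>\<^sub>e u = u"
  shows "(u, K n \<bullet>\<^sub>e u) \<in> graph"
proof -
  have u: "AE x in lborel. rep_l1 u x = I n x * rep_l1 u x"
    using rep_P[of n u] assms by simp
  have "integrable lborel (\<lambda>x. \<alpha> x * rep_l1 u x)"
  proof (rule Bochner_Integration.integrable_bound)
    show "integrable lborel (\<lambda>x. C n * rep_l1 u x)" by simp
    show "AE x in lborel. norm (\<alpha> x * rep_l1 u x) \<le> norm (C n * rep_l1 u x)"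
      using u
    proof eventually_elim
      case (elim x)
      then show ?case
        using \<alpha>_le[of x n] \<alpha>_nonneg[of x] C_pos[of n]
        by (cases "x < real n") (auto simp: abs_mult intro: mult_right_mono)
    qed
  qed measurable
  moreover have "AE x in lborel. G (rep_l1 u) x = G (\<lambda>y. I n y * rep_l1 u y) x"
    by (rule G_cong_AE) (use u in measurable)
  then have "AE x in lborel. rep_l1 (K n \<bullet>\<^sub>e u) x = G (rep_l1 u) x"
    using rep_K[of n u] by eventually_elim simp
  ultimately show ?thesis by (simp add: graph_def)
qed

text \<open>The cut-offs of \<open>u\<close> belong to the generator. The error of their images is
  \<open>G\<close> of the tail of \<open>u\<close>, of norm at most twice the integral of \<alpha>
  times the absolute tail, which vanishes in the limit by dominated convergence.\<close>

lemma graph_gen: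
  assumes "(u, w) \<in> graph"
  shows "(u, w) \<in> semigroup.gen"
proof (rule semigroup.gen_closed[OF semigroup.P_gen])
  show "(\<lambda>n. P n \<bullet>\<^sub>e u) \<longlonglongrightarrow> u" by (rule semigroup.P_tendsto)
  define f where "f = rep_l1 u"
  define r where "r n x = f x - I n x * f x" for n x
  have [measurable]: "f \<in> borel_measurable borel" "r n \<in> borel_measurable borel" for n
    unfolding f_def r_def by measurable
  have int_f: "integrable lborel (\<lambda>x. \<alpha> x * f x)" and w: "AE x in lborel. rep_l1 w x = G f x"
    using assms by (auto simp: graph_def f_def)
  have int_I: "integrable lborel (\<lambda>x. \<alpha> x * (I n x * f x))" for n
    by (rule Bochner_Integration.integrable_bound[OF int_f]) (auto simp: indicator_def)
  have le: "norm (w - K n \<bullet>\<^sub>e P n \<bullet>\<^sub>e u) \<le> 2 * (\<integral>x. \<bar>\<alpha> x * r n x\<bar> \<partial>lborel)" for n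
  proof -
    have "AE x in lborel. integrable lborel (\<lambda>y. k x y * f y)"
      "AE x in lborel. integrable lborel (\<lambda>y. k x y * (I n y * f y))"
      by (intro integrable_kernel_AE int_f int_I; measurable)+
    with w rep_K_P[of n n u] rep_l1_diff[of w "K n \<bullet>\<^sub>e P n \<bullet>\<^sub>e u"]
    have "AE x in lborel. rep_l1 (w - K n \<bullet>\<^sub>e P n \<bullet>\<^sub>e u) x = G (r n) x"
    proof eventually_elim
      case (elim x)
      have "(\<integral>y. k x y * f y - k x y * (I n y * f y) \<partial>lborel) =
          (\<integral>y. k x y * f y \<partial>lborel) - (\<integral>y. k x y * (I n y * f y) \<partial>lborel)"
        by (rule Bochner_Integration.integral_diff) (use elim in auto)
      then show ?case
        unfolding elim(3) elim(1) elim(2) by (simp add: G_def r_def f_def algebra_simps I_mult)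
    qed
    then have "ennreal (norm (w - K n \<bullet>\<^sub>e P n \<bullet>\<^sub>e u)) = (\<integral>\<^sup>+x. ennreal \<bar>G (r n) x\<bar> \<partial>lborel)"
      unfolding nn_integral_rep_l1[symmetric] by (intro nn_integral_cong_AE) (auto elim: eventually_mono)
    also have "\<dots> \<le> 2 * (\<integral>\<^sup>+x. ennreal \<bar>\<alpha> x * r n x\<bar> \<partial>lborel)"
      by (rule nn_integral_G_le) measurable
    also have "(\<integral>\<^sup>+x. ennreal \<bar>\<alpha> x * r n x\<bar> \<partial>lborel) = ennreal (\<integral>x. \<bar>\<alpha> x * r n x\<bar> \<partial>lborel)"
      using int_f int_I[of n] by (intro nn_integral_eq_integral) (auto simp: r_def right_diff_distrib)
    also have "2 * \<dots> = ennreal (2 * (\<integral>x. \<bar>\<alpha> x * r n x\<bar> \<partial>lborel))"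
      by (simp add: ennreal_mult)
    finally show ?thesis by simp
  qed
  have "(\<lambda>n. 2 * (\<integral>x. \<bar>\<alpha> x * r n x\<bar> \<partial>lborel)) \<longlonglongrightarrow> 2 * (\<integral>x. (0::real) \<partial>(lborel :: real measure))"
  proof (intro tendsto_mult tendsto_const integral_dominated_convergence[where w = "\<lambda>x. \<bar>\<alpha> x * f x\<bar>"])
    show "AE x in lborel. (\<lambda>n. \<bar>\<alpha> x * r n x\<bar>) \<longlonglongrightarrow> 0"
    proof (rule AE_I2, rule tendsto_eventually)
      fix x
      obtain N where N: "x < real N" using reals_Archimedean2 by blast
      show "\<forall>\<^sub>F n in sequentially. \<bar>\<alpha> x * r n x\<bar> = 0"
        by (rule eventually_sequentiallyI[of N]) (use N in \<open>auto simp: indicator_def r_def\<close>)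
    qed
    show "AE x in lborel. norm \<bar>\<alpha> x * r n x\<bar> \<le> \<bar>\<alpha> x * f x\<bar>" for n
      by (auto simp: indicator_def r_def)
  qed (use int_f in simp_all)
  then have lim: "(\<lambda>n. 2 * (\<integral>x. \<bar>\<alpha> x * r n x\<bar> \<partial>lborel)) \<longlonglongrightarrow> 0" by simp
  have "(\<lambda>n. w - K n \<bullet>\<^sub>e P n \<bullet>\<^sub>e u) \<longlonglongrightarrow> 0"
    by (rule Lim_null_comparison[OF always_eventually lim]) (simp add: le)
  from tendsto_diff[OF tendsto_const this, of w]
  show "(\<lambda>n. K n \<bullet>\<^sub>e P n \<bullet>\<^sub>e u) \<longlonglongrightarrow> w" by simp
qed

text \<open>The solutions of the cut-off resolvent equations live below some \<open>n\<close> and so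
  lie in the domain of A + B: such functions form a core of the generator.\<close>

lemma gen_graph_approx:
  assumes "(u, w) \<in> semigroup.gen"
  obtains U W where "\<And>n::nat. (U n, W n) \<in> graph" "U \<longlonglongrightarrow> u" "W \<longlonglongrightarrow> w"
proof -
  from semigroup.gen_approx[OF assms] obtain U where U: "\<And>n. P n \<bullet>\<^sub>e U n = U n" "U \<longlonglongrightarrow> u"
    "(\<lambda>n. K n \<bullet>\<^sub>e U n) \<longlonglongrightarrow> w" by blast
  show thesis by (rule that[OF P_graph U(2,3)]) (rule U(1))
qed

section \<open>Closed convex sets preserved by the semigroup\<close>

lemma T_nonneg:
  assumes "0 \<le> t" "AE x in lborel. 0 \<le> rep_l1 u x"
  shows "AE x in lborel. 0 \<le> rep_l1 (semigroup.T t u) x"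
proof -
  let ?D = "{u. AE x in lborel. rep_l1 u x \<in> {0..}}"
  have "semigroup.T t u \<in> ?D"
  proof (rule semigroup.T_invariant)
    show "closed ?D" by (rule closed_l1_pointwise) auto
    show "convex ?D" by (rule convex_l1_pointwise) auto
    show "P n \<bullet>\<^sub>e u \<in> ?D" if "u \<in> ?D" for n u
      unfolding P_def using that kernel_operator.kernel_endo_nonneg[OF P_kernel] by auto
    show "R n \<bullet>\<^sub>e u \<in> ?D" if "u \<in> ?D" for n u
      unfolding R_def using that kernel_operator.kernel_endo_nonneg[OF R_kernel] by auto
  qed (use assms in auto)
  then show ?thesis by auto
qed

text \<open>Nothing is gained outside \<open>Z\<close>, and the diagonal parts of \<open>P n\<close>
  and \<open>R n\<close> create nothing there. Taking for \<open>Z\<close> the set where the weight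
  is nonzero keeps the semigroup inside the image of the weighted space.\<close>

lemma T_support:
  assumes Z: "\<And>x y. x \<notin> Z \<Longrightarrow> k x y = 0"
    and t: "0 \<le> t" and u: "AE x in lborel. x \<notin> Z \<longrightarrow> rep_l1 u x = 0"
  shows "AE x in lborel. x \<notin> Z \<longrightarrow> rep_l1 (semigroup.T t u) x = 0"
proof -
  let ?S = "\<lambda>x. if x \<in> Z then UNIV else {0::real}"
  let ?D = "{u. AE x in lborel. rep_l1 u x \<in> ?S x}"
  have "semigroup.T t u \<in> ?D"
  proof (rule semigroup.T_invariant)
    show "closed ?D" by (rule closed_l1_pointwise) auto
    show "convex ?D" by (rule convex_l1_pointwise) auto
    fix n and u :: "real l1"
    assume "u \<in> ?D"
    then have u: "AE x in lborel. rep_l1 u x \<in> ?S x" by simp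
    with rep_P[of n u] have "AE x in lborel. rep_l1 (P n \<bullet>\<^sub>e u) x \<in> ?S x"
      by eventually_elim auto
    then show "P n \<bullet>\<^sub>e u \<in> ?D" by simp
    have "AE x in lborel. rep_l1 (R n \<bullet>\<^sub>e u) x =
        (1 - I n x * \<alpha> x / C n) * rep_l1 u x + (\<integral>y. k x y * I n y / C n * rep_l1 u y \<partial>lborel)"
      unfolding R_def using kernel_operator.rep_kernel_endo[OF R_kernel, of n u]
      by (simp add: kernel_operator.kernel_fun_def[OF R_kernel])
    with u have "AE x in lborel. rep_l1 (R n \<bullet>\<^sub>e u) x \<in> ?S x"
      by eventually_elim (use Z in auto)
    then show "R n \<bullet>\<^sub>e u \<in> ?D" by simp
  next
    from u show "u \<in> ?D" by (auto elim: eventually_mono)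
  qed (rule t)
  then have "AE x in lborel. rep_l1 (semigroup.T t u) x \<in> ?S x" by simp
  then show ?thesis by eventually_elim (auto split: if_splits)
qed

text \<open>Mass only moves to smaller \<open>x\<close>, so moments with nondecreasing weights do not grow.\<close>

lemma T_moment:
  assumes v: "v \<in> borel_measurable borel" "\<And>x. 0 \<le> v x" "\<And>x y. x < y \<Longrightarrow> v x \<le> v y"
    and t: "0 \<le> t"
  shows "l1_moment v (semigroup.T t u) \<le> l1_moment v u"
proof -
  let ?D = "{w. l1_moment v w \<le> l1_moment v u}"
  have "semigroup.T t u \<in> ?D"
  proof (rule semigroup.T_invariant)
    show "closed ?D" by (rule closed_l1_moment) (use v in auto)
    show "convex ?D" by (rule convex_l1_moment) (use v in auto)
    fix n w
    assume w: "w \<in> ?D"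
    have "l1_moment v (P n \<bullet>\<^sub>e w) \<le> l1_moment v w"
      unfolding P_def by (rule kernel_operator.kernel_endo_moment[OF P_kernel])
        (use v in \<open>auto simp: indicator_def\<close>)
    with w show "P n \<bullet>\<^sub>e w \<in> ?D" by auto
    have "l1_moment v (R n \<bullet>\<^sub>e w) \<le> l1_moment v w"
      unfolding R_def by (rule kernel_operator.kernel_endo_moment[OF R_kernel _ _ R_column]) (use v in auto)
    with w show "R n \<bullet>\<^sub>e w \<in> ?D" by auto
  qed (use t in auto)
  then show ?thesis by auto
qed

end

section \<open>Weighted spaces as subspaces of the unweighted one\<close>

lemma AE_lebesgue_on_iff:
  "S \<in> sets lebesgue \<Longrightarrow> (AE x in lebesgue_on S. Q x) \<longleftrightarrow> (AE x in lborel. x \<in> S \<longrightarrow> Q x)"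
  by (simp add: AE_restrict_space_iff AE_completion_iff)

lemma lebesgue_on_borel_version:
  fixes f :: "'a::euclidean_space \<Rightarrow> real"
  assumes S: "S \<in> sets lebesgue" and f: "f \<in> borel_measurable (lebesgue_on S)"
  obtains g where "g \<in> borel_measurable borel" "AE x in lborel. x \<in> S \<longrightarrow> g x = f x"
proof -
  have "(\<lambda>x. indicator S x *\<^sub>R f x) \<in> borel_measurable lebesgue"
    using f S by (subst (asm) borel_measurable_restrict_space_iff) auto
  from completion_ex_borel_measurable_real[OF this] obtain g
    where "g \<in> borel_measurable lborel" "AE x in lborel. indicator S x *\<^sub>R f x = g x" by blast
  then show thesis by (intro that[of g]) (auto elim!: eventually_mono simp: indicator_def)
qed

lemma borel_measurable_lebesgue_onI:
  fixes f :: "'a::euclidean_space \<Rightarrow> real"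
  assumes S: "S \<in> sets lebesgue" and [measurable]: "g \<in> borel_measurable borel"
    and ae: "AE x in lborel. x \<in> S \<longrightarrow> g x = f x"
  shows "f \<in> borel_measurable (lebesgue_on S)"
proof -
  have ae': "AE x in lebesgue. indicator S x *\<^sub>R g x = indicator S x *\<^sub>R f x"
    unfolding AE_completion_iff using ae by (auto elim!: eventually_mono simp: indicator_def)
  have "(\<lambda>x. indicator S x *\<^sub>R g x) \<in> borel_measurable lebesgue"
    using S by (intro borel_measurable_scaleR borel_measurable_indicator measurable_completion) auto
  from borel_measurable_AE[OF this ae']
  have "(\<lambda>x. indicator S x *\<^sub>R f x) \<in> borel_measurable lebesgue" .
  then show ?thesis using S by (subst borel_measurable_restrict_space_iff) auto
qed

lemma lebesgue_AE_borel:
  fixes f g :: "'a::euclidean_space \<Rightarrow> real"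
  assumes [measurable]: "g \<in> borel_measurable borel" and ae: "AE x in lborel. f x = g x"
  shows "integrable lebesgue f \<longleftrightarrow> integrable lborel g"
    and "(\<integral>x. f x \<partial>lebesgue) = (\<integral>x. g x \<partial>lborel)"
proof -
  have g: "g \<in> borel_measurable lebesgue" by (rule measurable_completion) simp
  have ae': "AE x in lebesgue. f x = g x" using ae by (simp add: AE_completion_iff)
  then have f: "f \<in> borel_measurable lebesgue"
    by (intro borel_measurable_AE[OF g]) (auto elim: eventually_mono)
  show "integrable lebesgue f \<longleftrightarrow> integrable lborel g"
    using integrable_cong_AE[OF f g ae'] by (simp add: integrable_completion)
  show "(\<integral>x. f x \<partial>lebesgue) = (\<integral>x. g x \<partial>lborel)"
    using integral_cong_AE[OF f g ae'] by (simp add: integral_completion)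
qed

lemma L1_weighted_iff:
  assumes "w \<in> borel_measurable (lebesgue_on {0<..})"
  shows "f \<in> L1 (weighted w) \<longleftrightarrow> f \<in> borel_measurable (lebesgue_on {0<..}) \<and>
    (\<integral>\<^sup>+x. ennreal (w x) * ennreal \<bar>f x\<bar> * indicator {0<..} x \<partial>lborel) < \<infinity>"
proof (cases "f \<in> borel_measurable (lebesgue_on {0<..})")
  case True
  have "(\<integral>\<^sup>+x. ennreal \<bar>f x\<bar> \<partial>weighted w) = (\<integral>\<^sup>+x. ennreal (w x) * ennreal \<bar>f x\<bar> \<partial>lebesgue_on {0<..})"
    unfolding weighted_def using True assms by (intro nn_integral_density) auto
  also have "\<dots> = (\<integral>\<^sup>+x. ennreal (w x) * ennreal \<bar>f x\<bar> * indicator {0<..} x \<partial>lborel)"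
    by (simp add: nn_integral_restrict_space nn_integral_completion)
  finally show ?thesis
    using True by (simp add: L1_def integrable_iff_bounded weighted_def)
qed (auto simp: L1_def integrable_iff_bounded weighted_def)

lemma AE_weighted_iff:
  assumes "w \<in> borel_measurable (lebesgue_on {0<..})"
  shows "(AE x in weighted w. Q x) \<longleftrightarrow> (AE x in lborel. 0 < x \<longrightarrow> 0 < w x \<longrightarrow> Q x)"
proof -
  have "(AE x in weighted w. Q x) \<longleftrightarrow> (AE x in lebesgue_on {0<..}. 0 < ennreal (w x) \<longrightarrow> Q x)"
    unfolding weighted_def using assms by (intro AE_density) auto
  also have "\<dots> \<longleftrightarrow> (AE x in lborel. x \<in> {0<..} \<longrightarrow> 0 < ennreal (w x) \<longrightarrow> Q x)"
    by (rule AE_lebesgue_on_iff) auto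
  finally show ?thesis by simp
qed

text \<open>
  \<open>J\<close> sends \<open>f\<close> to the class of \<open>f \<omega>\<close>. It maps \<open>X\<^sub>\<omega>\<close> isometrically onto the functions that
  vanish where \<open>\<omega>\<close> does, with inverse \<open>J'\<close>. Here \<open>w\<close> is a Borel version of \<open>\<omega>\<close>.
\<close>

locale weighted_embedding =
  fixes \<omega> w :: "real \<Rightarrow> real"
  assumes \<omega>_measurable: "\<omega> \<in> borel_measurable (lebesgue_on {0<..})"
    and w_meas [measurable]: "w \<in> borel_measurable borel"
    and w_nonneg: "0 \<le> w x"
    and w_zero: "x \<le> 0 \<Longrightarrow> w x = 0"
    and w_eq: "AE x in lborel. 0 < x \<longrightarrow> w x = \<omega> x"
begin

abbreviation "M \<equiv> weighted \<omega>"

lemma AE_M_iff: "(AE x in M. Q x) \<longleftrightarrow> (AE x in lborel. w x \<noteq> 0 \<longrightarrow> Q x)"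
  unfolding AE_weighted_iff[OF \<omega>_measurable]
proof
  show "AE x in lborel. 0 < x \<longrightarrow> 0 < \<omega> x \<longrightarrow> Q x" if "AE x in lborel. w x \<noteq> 0 \<longrightarrow> Q x"
    using that w_eq by eventually_elim auto
  show "AE x in lborel. w x \<noteq> 0 \<longrightarrow> Q x" if "AE x in lborel. 0 < x \<longrightarrow> 0 < \<omega> x \<longrightarrow> Q x"
    using that w_eq
  proof eventually_elim
    case (elim x)
    then show ?case using w_zero[of x] w_nonneg[of x] by (cases "0 < x") auto
  qed
qed

lemma L1_iff:
  "f \<in> L1 M \<longleftrightarrow> f \<in> borel_measurable (lebesgue_on {0<..}) \<and>
    (\<integral>\<^sup>+x. ennreal \<bar>f x * w x\<bar> \<partial>lborel) < \<infinity>"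
proof -
  have "(\<integral>\<^sup>+x. ennreal (\<omega> x) * ennreal \<bar>f x\<bar> * indicator {0<..} x \<partial>lborel) = (\<integral>\<^sup>+x. ennreal \<bar>f x * w x\<bar> \<partial>lborel)"
  proof (rule nn_integral_cong_AE)
    show "AE x in lborel. ennreal (\<omega> x) * ennreal \<bar>f x\<bar> * indicator {0<..} x = ennreal \<bar>f x * w x\<bar>"
      using w_eq
    proof eventually_elim
      case (elim x)
      then show ?case
        using w_zero[of x] w_nonneg[of x]
        by (cases "0 < x") (auto simp: abs_mult ennreal_mult'' mult.commute)
    qed
  qed
  then show ?thesis by (simp add: L1_weighted_iff[OF \<omega>_measurable])
qed

lemma L1_measurable: "f \<in> L1 M \<Longrightarrow> f \<in> borel_measurable (lebesgue_on {0<..})"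
  by (simp add: L1_iff)

lemma L1_borel_version:
  assumes "f \<in> L1 M"
  obtains g where "g \<in> borel_measurable borel" "AE x in lborel. 0 < x \<longrightarrow> g x = f x"
  using lebesgue_on_borel_version[OF _ L1_measurable[OF assms]] by auto

lemma L1_borel_iff:
  assumes [measurable]: "g \<in> borel_measurable borel" and ae: "AE x in lborel. 0 < x \<longrightarrow> g x = f x"
  shows "f \<in> L1 M \<longleftrightarrow> integrable lborel (\<lambda>x. g x * w x)"
proof -
  have "f \<in> borel_measurable (lebesgue_on {0<..})"
    by (rule borel_measurable_lebesgue_onI[of _ g]) (use ae in auto)
  moreover have "(\<integral>\<^sup>+x. ennreal \<bar>f x * w x\<bar> \<partial>lborel) = (\<integral>\<^sup>+x. ennreal \<bar>g x * w x\<bar> \<partial>lborel)"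
  proof (rule nn_integral_cong_AE)
    show "AE x in lborel. ennreal \<bar>f x * w x\<bar> = ennreal \<bar>g x * w x\<bar>"
      using ae
    proof eventually_elim
      case (elim x)
      then show ?case using w_zero[of x] by (cases "0 < x") auto
    qed
  qed
  ultimately show ?thesis by (simp add: L1_iff integrable_iff_bounded)
qed

text \<open>The product \<open>f x * w x\<close> need not be Borel measurable, so an almost
  everywhere equal Borel function is chosen.\<close>

definition J :: "(real \<Rightarrow> real) \<Rightarrow> real l1" where
  "J f = abs_l1 (SOME g. integrable lborel g \<and> (AE x in lborel. g x = f x * w x))"

text \<open>Division by 0 gives 0 where \<open>w\<close> vanishes. Hence \<open>J'\<close> is
  defined on all of \<open>l1\<close>, and \<open>J\<close> after \<open>J'\<close> erases
  \<open>u\<close> on the zero set of the weight.\<close>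

definition J' :: "real l1 \<Rightarrow> real \<Rightarrow> real" where
  "J' u x = rep_l1 u x / w x"

lemma rep_J:
  assumes f: "f \<in> L1 M"
  shows "AE x in lborel. rep_l1 (J f) x = f x * w x"
proof -
  obtain g where g: "g \<in> borel_measurable borel" "AE x in lborel. 0 < x \<longrightarrow> g x = f x"
    using L1_borel_version[OF f] .
  have "AE x in lborel. g x * w x = f x * w x"
    using g(2)
  proof eventually_elim
    case (elim x)
    then show ?case using w_zero[of x] by (cases "0 < x") auto
  qed
  with L1_borel_iff[OF g] f
  have "\<exists>g. integrable lborel g \<and> (AE x in lborel. g x = f x * w x)" by blast
  note some = someI_ex[OF this]
  from rep_abs_l1[OF some[THEN conjunct1]] some[THEN conjunct2] show ?thesis
    unfolding J_def by eventually_elim simp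
qed

lemma J_eqI:
  assumes "f \<in> L1 M" "AE x in lborel. rep_l1 u x = f x * w x"
  shows "J f = u"
  unfolding l1_eq_iff using rep_J[OF assms(1)] assms(2) by eventually_elim simp

lemma L1_eq_iff_J:
  assumes "f \<in> L1 M" "g \<in> L1 M"
  shows "L1_eq M f g \<longleftrightarrow> J f = J g"
proof
  assume "L1_eq M f g"
  then have "AE x in lborel. w x \<noteq> 0 \<longrightarrow> f x = g x"
    by (simp add: L1_eq_def AE_M_iff)
  with rep_J[OF assms(1)] rep_J[OF assms(2)] show "J f = J g"
    unfolding l1_eq_iff by eventually_elim auto
next
  assume eq: "J f = J g"
  from rep_J[OF assms(1)] rep_J[OF assms(2)] show "L1_eq M f g"
    unfolding L1_eq_def AE_M_iff by eventually_elim (auto simp: eq)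
qed

lemma L1_norm_J:
  assumes "f \<in> L1 M"
  shows "L1_norm M f = norm (J f)"
proof -
  have "ennreal (L1_norm M f) = (\<integral>\<^sup>+x. ennreal \<bar>f x\<bar> \<partial>M)"
    unfolding L1_norm_def using assms by (intro nn_integral_eq_integral[symmetric]) (auto simp: L1_def)
  also have "\<dots> = (\<integral>\<^sup>+x. ennreal (\<omega> x) * ennreal \<bar>f x\<bar> * indicator {0<..} x \<partial>lborel)"
    unfolding weighted_def using L1_measurable[OF assms] \<omega>_measurable
    by (subst nn_integral_density) (auto simp: nn_integral_restrict_space nn_integral_completion)
  also have "\<dots> = (\<integral>\<^sup>+x. ennreal \<bar>rep_l1 (J f) x\<bar> \<partial>lborel)"
  proof (rule nn_integral_cong_AE)
    show "AE x in lborel. ennreal (\<omega> x) * ennreal \<bar>f x\<bar> * indicator {0<..} x = ennreal \<bar>rep_l1 (J f) x\<bar>"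
      using w_eq rep_J[OF assms]
    proof eventually_elim
      case (elim x)
      then show ?case
        using w_zero[of x] w_nonneg[of x]
        by (cases "0 < x") (auto simp: abs_mult ennreal_mult'' mult.commute)
    qed
  qed
  also have "\<dots> = ennreal (norm (J f))" by (rule nn_integral_rep_l1)
  finally show ?thesis by (simp add: L1_norm_def)
qed

lemma L1_add: "f \<in> L1 M \<Longrightarrow> g \<in> L1 M \<Longrightarrow> (\<lambda>x. f x + g x) \<in> L1 M"
  and L1_diff: "f \<in> L1 M \<Longrightarrow> g \<in> L1 M \<Longrightarrow> (\<lambda>x. f x - g x) \<in> L1 M"
  and L1_scale: "f \<in> L1 M \<Longrightarrow> (\<lambda>x. r * f x) \<in> L1 M"
  by (simp_all add: L1_def)

lemma J_add: "f \<in> L1 M \<Longrightarrow> g \<in> L1 M \<Longrightarrow> J (\<lambda>x. f x + g x) = J f + J g"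
proof (intro J_eqI L1_add)
  assume "f \<in> L1 M" "g \<in> L1 M"
  from rep_J[OF this(1)] rep_J[OF this(2)] rep_l1_add[of "J f" "J g"]
  show "AE x in lborel. rep_l1 (J f + J g) x = (f x + g x) * w x"
    by eventually_elim (simp add: algebra_simps)
qed

lemma J_diff: "f \<in> L1 M \<Longrightarrow> g \<in> L1 M \<Longrightarrow> J (\<lambda>x. f x - g x) = J f - J g"
proof (intro J_eqI L1_diff)
  assume "f \<in> L1 M" "g \<in> L1 M"
  from rep_J[OF this(1)] rep_J[OF this(2)] rep_l1_diff[of "J f" "J g"]
  show "AE x in lborel. rep_l1 (J f - J g) x = (f x - g x) * w x"
    by eventually_elim (simp add: algebra_simps)
qed

lemma J_scale: "f \<in> L1 M \<Longrightarrow> J (\<lambda>x. r * f x) = r *\<^sub>R J f"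
proof (intro J_eqI L1_scale)
  assume "f \<in> L1 M"
  from rep_J[OF this] rep_l1_scaleR[of r "J f"]
  show "AE x in lborel. rep_l1 (r *\<^sub>R J f) x = r * f x * w x"
    by eventually_elim simp
qed

lemma J'_L1: "J' u \<in> L1 M"
proof -
  have [measurable]: "J' u \<in> borel_measurable borel"
    unfolding J'_def by measurable
  have "integrable lborel (\<lambda>x. J' u x * w x)"
    by (rule Bochner_Integration.integrable_bound[of _ "rep_l1 u"]) (auto simp: J'_def)
  then show ?thesis by (subst L1_borel_iff[of "J' u"]) auto
qed

lemma rep_J_J': "AE x in lborel. rep_l1 (J (J' u)) x = (if w x = 0 then 0 else rep_l1 u x)"
  using rep_J[OF J'_L1[of u]] by eventually_elim (simp add: J'_def)

lemma J_support: "f \<in> L1 M \<Longrightarrow> AE x in lborel. w x = 0 \<longrightarrow> rep_l1 (J f) x = 0"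
  using rep_J[of f] by (auto elim: eventually_mono)

lemma J_J': "AE x in lborel. w x = 0 \<longrightarrow> rep_l1 u x = 0 \<Longrightarrow> J (J' u) = u"
proof -
  assume "AE x in lborel. w x = 0 \<longrightarrow> rep_l1 u x = 0"
  with rep_J_J'[of u] show ?thesis unfolding l1_eq_iff by eventually_elim auto
qed

lemma L1_nonneg_J: "f \<in> L1 M \<Longrightarrow> L1_nonneg M f \<longleftrightarrow> (AE x in lborel. 0 \<le> rep_l1 (J f) x)"
proof
  assume f: "f \<in> L1 M"
  show "AE x in lborel. 0 \<le> rep_l1 (J f) x" if "L1_nonneg M f"
    using that rep_J[OF f] unfolding L1_nonneg_def AE_M_iff
    by eventually_elim (use w_nonneg in force)
  show "L1_nonneg M f" if "AE x in lborel. 0 \<le> rep_l1 (J f) x"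
    using that rep_J[OF f] unfolding L1_nonneg_def AE_M_iff
  proof eventually_elim
    case (elim x)
    then show ?case using w_nonneg[of x] by (auto simp: zero_le_mult_iff)
  qed
qed

lemma L1_weighted_moment:
  assumes v [measurable]: "v \<in> borel_measurable borel" and v_nonneg: "\<And>x. 0 \<le> v x" and f: "f \<in> L1 M"
    and cv: "\<And>x. 0 < x \<Longrightarrow> c x = v x"
  shows "f \<in> L1 (weighted (\<lambda>x. c x * \<omega> x)) \<longleftrightarrow> l1_moment v (J f) < \<infinity>"
proof -
  have "c \<in> borel_measurable (lebesgue_on {0<..})"
    by (rule borel_measurable_lebesgue_onI[of _ v]) (auto simp: cv)
  then have "(\<lambda>x. c x * \<omega> x) \<in> borel_measurable (lebesgue_on {0<..})"
    using \<omega>_measurable by simp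
  note * = L1_weighted_iff[OF this, of f]
  have "(\<integral>\<^sup>+x. ennreal (c x * \<omega> x) * ennreal \<bar>f x\<bar> * indicator {0<..} x \<partial>lborel) = l1_moment v (J f)"
    unfolding l1_moment_def
  proof (rule nn_integral_cong_AE)
    show "AE x in lborel. ennreal (c x * \<omega> x) * ennreal \<bar>f x\<bar> * indicator {0<..} x = ennreal (v x * \<bar>rep_l1 (J f) x\<bar>)"
      using w_eq rep_J[OF f]
    proof eventually_elim
      case (elim x)
      then show ?case
        using w_zero[of x] w_nonneg[of x] v_nonneg[of x] cv[of x]
        by (cases "0 < x") (auto simp: abs_mult ennreal_mult'[symmetric] mult_ac)
    qed
  qed
  with * show ?thesis using L1_measurable[OF f] by simp
qed

end

section \<open>The weighted fragmentation semigroup\<close>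

text \<open>\<open>k\<close> is the kernel of B conjugated with multiplication by \<open>w\<close>.
  Where \<open>w y = 0\<close> the division makes it 0, and \<open>\<beta>_null\<close> makes this
  the correct value. \<open>\<beta>_eq\<close> is iterated because a null set in the plane has null
  sections for almost every \<open>x\<close> only.\<close>

locale weighted_fragmentation =
  weighted_embedding \<omega> w + fragmentation k \<alpha> C
  for \<omega> w :: "real \<Rightarrow> real" and k :: "real \<Rightarrow> real \<Rightarrow> real" and \<alpha> :: "real \<Rightarrow> real" and C :: "nat \<Rightarrow> real" +
  fixes a :: "real \<Rightarrow> real" and b \<beta> :: "real \<Rightarrow> real \<Rightarrow> real"
  assumes \<alpha>_eq: "AE x in lborel. 0 < x \<longrightarrow> \<alpha> x = a x"
    and \<beta>_meas [measurable]: "(\<lambda>(x, y). \<beta> x y) \<in> borel_measurable (borel \<Otimes>\<^sub>M borel)"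
    and \<beta>_eq: "AE x in lborel. AE y in lborel. 0 < x \<longrightarrow> 0 < y \<longrightarrow> \<beta> x y = b x y"
    and \<beta>_null: "AE x in lborel. AE y in lborel. w x \<noteq> 0 \<longrightarrow> x < y \<longrightarrow> w y = 0 \<longrightarrow> \<beta> x y = 0"
    and k_eq: "k x y = (if 0 < x \<and> x < y then \<alpha> y * \<beta> x y * w x / w y else 0)"
begin

lemma w_pos_imp: "w x \<noteq> 0 \<Longrightarrow> 0 < x"
  using w_zero[of x] by (cases "0 < x") auto

lemma frag_integral_borel:
  assumes F [measurable]: "F' \<in> borel_measurable borel" and F': "AE x in lborel. 0 < x \<longrightarrow> F' x = F x"
  shows "AE x in lborel. 0 < x \<longrightarrow>
    (set_integrable lebesgue {x<..} (\<lambda>y. a y * b x y * F y) \<longleftrightarrow>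
      integrable lborel (\<lambda>y. if x < y then \<alpha> y * \<beta> x y * F' y else 0)) \<and>
    frag_integral a b F x = (\<integral>y. (if x < y then \<alpha> y * \<beta> x y * F' y else 0) \<partial>lborel)"
  using \<beta>_eq
proof eventually_elim
  case (elim x)
  show ?case
  proof
    assume x: "0 < x"
    from elim F' \<alpha>_eq have ae: "AE y in lborel. indicator {x<..} y *\<^sub>R (a y * b x y * F y) =
        (if x < y then \<alpha> y * \<beta> x y * F' y else 0)"
      by eventually_elim (use x in auto)
    have "(\<lambda>y. if x < y then \<alpha> y * \<beta> x y * F' y else 0) \<in> borel_measurable borel" by measurable
    from lebesgue_AE_borel[OF this ae]
    show "(set_integrable lebesgue {x<..} (\<lambda>y. a y * b x y * F y) \<longleftrightarrow>
        integrable lborel (\<lambda>y. if x < y then \<alpha> y * \<beta> x y * F' y else 0)) \<and>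
      frag_integral a b F x = (\<integral>y. (if x < y then \<alpha> y * \<beta> x y * F' y else 0) \<partial>lborel)"
      by (simp add: set_integrable_def frag_integral_def set_lebesgue_integral_def)
  qed
qed

lemma frag_integral_measurable:
  assumes "F \<in> L1 M"
  shows "frag_integral a b F \<in> borel_measurable (lebesgue_on {0<..})"
proof -
  obtain F' where [measurable]: "F' \<in> borel_measurable borel" and F': "AE x in lborel. 0 < x \<longrightarrow> F' x = F x"
    using L1_borel_version[OF assms] .
  let ?B = "\<lambda>x. \<integral>y. (if x < y then \<alpha> y * \<beta> x y * F' y else 0) \<partial>lborel"
  show ?thesis
  proof (rule borel_measurable_lebesgue_onI[of _ ?B])
    show "?B \<in> borel_measurable borel" by measurable
    show "AE x in lborel. x \<in> {0<..} \<longrightarrow> ?B x = frag_integral a b F x"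
      using frag_integral_borel[OF _ F'] by (auto elim: eventually_mono)
  qed simp
qed

text \<open>The factor \<open>w y\<close> inside \<open>J F\<close> cancels the denominator of
  \<open>k\<close>. Where \<open>w y = 0\<close> both integrands vanish, the left one by division by
  0 and the other one by \<open>\<beta>_null\<close>.\<close>

lemma frag_integral_J:
  assumes F: "F \<in> L1 M"
  shows "AE x in lborel. w x \<noteq> 0 \<longrightarrow>
    (set_integrable lebesgue {x<..} (\<lambda>y. a y * b x y * F y) \<longleftrightarrow>
      integrable lborel (\<lambda>y. k x y * rep_l1 (J F) y)) \<and>
    frag_integral a b F x * w x = (\<integral>y. k x y * rep_l1 (J F) y \<partial>lborel)"
proof -
  obtain F' where [measurable]: "F' \<in> borel_measurable borel" and F': "AE x in lborel. 0 < x \<longrightarrow> F' x = F x"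
    using L1_borel_version[OF F] .
  from frag_integral_borel[OF _ F'] have "AE x in lborel. 0 < x \<longrightarrow>
    (set_integrable lebesgue {x<..} (\<lambda>y. a y * b x y * F y) \<longleftrightarrow>
      integrable lborel (\<lambda>y. if x < y then \<alpha> y * \<beta> x y * F' y else 0)) \<and>
    frag_integral a b F x = (\<integral>y. (if x < y then \<alpha> y * \<beta> x y * F' y else 0) \<partial>lborel)"
    by measurable
  with \<beta>_null show ?thesis
  proof eventually_elim
    case (elim x)
    show ?case
    proof
      let ?q = "\<lambda>y. if x < y then \<alpha> y * \<beta> x y * F' y else 0"
      assume wx: "w x \<noteq> 0"
      then have x: "0 < x" by (rule w_pos_imp)
      have meas: "(\<lambda>y. k x y * rep_l1 (J F) y) \<in> borel_measurable lborel"
        "(\<lambda>y. w x * ?q y) \<in> borel_measurable lborel"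
        by measurable
      from elim(1) F' rep_J[OF F] have ae: "AE y in lborel. k x y * rep_l1 (J F) y = w x * ?q y"
        by eventually_elim (use wx x in \<open>auto simp: k_eq\<close>)
      from integrable_cong_AE[OF meas ae] integral_cong_AE[OF meas ae]
      show "(set_integrable lebesgue {x<..} (\<lambda>y. a y * b x y * F y) \<longleftrightarrow>
          integrable lborel (\<lambda>y. k x y * rep_l1 (J F) y)) \<and>
        frag_integral a b F x * w x = (\<integral>y. k x y * rep_l1 (J F) y \<partial>lborel)"
        using elim(2) x wx by (simp add: mult.commute)
    qed
  qed
qed

lemma L1_mult_iff:
  assumes F: "F \<in> L1 M"
  shows "(\<lambda>x. a x * F x) \<in> L1 M \<longleftrightarrow> integrable lborel (\<lambda>x. \<alpha> x * rep_l1 (J F) x)"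
proof -
  obtain F' where [measurable]: "F' \<in> borel_measurable borel" and F': "AE x in lborel. 0 < x \<longrightarrow> F' x = F x"
    using L1_borel_version[OF F] .
  from \<alpha>_eq F' have "AE x in lborel. 0 < x \<longrightarrow> \<alpha> x * F' x = a x * F x"
    by eventually_elim simp
  then have "(\<lambda>x. a x * F x) \<in> L1 M \<longleftrightarrow> integrable lborel (\<lambda>x. \<alpha> x * F' x * w x)"
    by (intro L1_borel_iff) measurable
  also have "\<dots> \<longleftrightarrow> integrable lborel (\<lambda>x. \<alpha> x * rep_l1 (J F) x)"
  proof (rule integrable_cong_AE)
    show "AE x in lborel. \<alpha> x * F' x * w x = \<alpha> x * rep_l1 (J F) x"
      using F' rep_J[OF F] by eventually_elim (use w_zero in \<open>auto simp: not_less\<close>)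
  qed measurable
  finally show ?thesis .
qed

lemma k_zero_left: "w x = 0 \<Longrightarrow> k x y = 0" and k_zero_right: "w y = 0 \<Longrightarrow> k x y = 0"
  by (simp_all add: k_eq)

text \<open>From right to left, membership in the domain of B has to be produced from integrability
  of the loss: the inner integrals exist by the relative bound, and the gain is integrable because
  it equals \<open>H\<close> plus the loss.\<close>

lemma operator_sum_iff:
  "(F, H) \<in> operator_sum M (frag_A \<omega> a) (frag_B \<omega> a b) \<longleftrightarrow> F \<in> L1 M \<and> H \<in> L1 M \<and> (J F, J H) \<in> graph"
proof
  assume "(F, H) \<in> operator_sum M (frag_A \<omega> a) (frag_B \<omega> a b)"
  then obtain g1 g2 where F: "F \<in> L1 M" and H: "H \<in> L1 M" and aF: "(\<lambda>x. a x * F x) \<in> L1 M"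
    and eqs: "L1_eq M g1 (\<lambda>x. - (a x * F x))" "L1_eq M g2 (frag_integral a b F)" "L1_eq M H (\<lambda>x. g1 x + g2 x)"
    by (auto simp: operator_sum_def frag_A_def frag_B_def)
  from eqs[unfolded L1_eq_def] have "AE x in M. H x = - (a x * F x) + frag_integral a b F x"
    by eventually_elim simp
  then have "AE x in lborel. rep_l1 (J H) x = G (rep_l1 (J F)) x"
    using rep_J[OF F] rep_J[OF H] frag_integral_J[OF F] \<alpha>_eq unfolding AE_M_iff
  proof eventually_elim
    case (elim x)
    show ?case
    proof (cases "w x = 0")
      case True
      then show ?thesis using elim by (simp add: G_def k_zero_left)
    next
      case False
      then have "rep_l1 (J H) x = (- (a x * F x) + frag_integral a b F x) * w x"
        using elim(1,3) by simp
      then have "rep_l1 (J H) x = - (a x * F x) * w x + frag_integral a b F x * w x"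
        by (simp only: distrib_right)
      then show ?thesis using elim False w_pos_imp[OF False] by (simp add: G_def)
    qed
  qed
  with F H aF show "F \<in> L1 M \<and> H \<in> L1 M \<and> (J F, J H) \<in> graph"
    by (simp add: graph_def L1_mult_iff)
next
  assume "F \<in> L1 M \<and> H \<in> L1 M \<and> (J F, J H) \<in> graph"
  then have F: "F \<in> L1 M" and H: "H \<in> L1 M" and int: "integrable lborel (\<lambda>x. \<alpha> x * rep_l1 (J F) x)"
    and eq: "AE x in lborel. rep_l1 (J H) x = G (rep_l1 (J F)) x"
    by (auto simp: graph_def)
  have aF: "(\<lambda>x. a x * F x) \<in> L1 M" using int F by (simp add: L1_mult_iff)
  have H_eq: "AE x in M. H x = - (a x * F x) + frag_integral a b F x"
    unfolding AE_M_iff using eq rep_J[OF F] rep_J[OF H] frag_integral_J[OF F] \<alpha>_eq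
  proof eventually_elim
    case (elim x)
    show ?case
    proof
      assume wx: "w x \<noteq> 0"
      then have "H x * w x = (- (a x * F x) + frag_integral a b F x) * w x"
        using elim w_pos_imp[OF wx] by (simp add: G_def algebra_simps)
      then show "H x = - (a x * F x) + frag_integral a b F x" using wx by simp
    qed
  qed
  have "integrable M (frag_integral a b F)"
  proof (rule iffD2[OF integrable_cong_AE[where g = "\<lambda>x. H x + a x * F x"]])
    show "frag_integral a b F \<in> borel_measurable M"
      using frag_integral_measurable[OF F] by (simp add: weighted_def)
    show "integrable M (\<lambda>x. H x + a x * F x)" using H aF by (simp add: L1_def)
    then show "(\<lambda>x. H x + a x * F x) \<in> borel_measurable M" by (rule borel_measurable_integrable)
    show "AE x in M. frag_integral a b F x = H x + a x * F x" using H_eq by eventually_elim simp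
  qed
  moreover have "AE x in M. set_integrable lebesgue {x<..} (\<lambda>y. a y * b x y * F y)"
    unfolding AE_M_iff using frag_integral_J[OF F] integrable_kernel_AE[OF borel_measurable_rep_l1 int]
    by eventually_elim simp
  ultimately have "(F, frag_integral a b F) \<in> frag_B \<omega> a b"
    using F by (simp add: frag_B_def L1_def L1_eq_def)
  moreover have "(F, \<lambda>x. - (a x * F x)) \<in> frag_A \<omega> a"
    using F aF by (simp add: frag_A_def L1_def L1_eq_def)
  ultimately show "(F, H) \<in> operator_sum M (frag_A \<omega> a) (frag_B \<omega> a b)"
    using H H_eq unfolding operator_sum_def L1_eq_def mem_Collect_eq prod.case
    by (intro conjI exI[of _ "\<lambda>x. - (a x * F x)"] exI[of _ "frag_integral a b F"])
qed

text \<open>Approximants found in the unweighted space need not vanish where the weight does.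
  Erasing them there stays within the graph, as \<open>k\<close> is 0 whenever either argument is in
  the zero set.\<close>

lemma graph_J_J':
  assumes "(u, v) \<in> graph"
  shows "(J (J' u), J (J' v)) \<in> graph"
proof -
  have int: "integrable lborel (\<lambda>x. \<alpha> x * rep_l1 u x)" and eq: "AE x in lborel. rep_l1 v x = G (rep_l1 u) x"
    using assms by (auto simp: graph_def)
  have "integrable lborel (\<lambda>x. \<alpha> x * rep_l1 (J (J' u)) x)"
  proof (rule Bochner_Integration.integrable_bound[OF int])
    show "AE x in lborel. norm (\<alpha> x * rep_l1 (J (J' u)) x) \<le> norm (\<alpha> x * rep_l1 u x)"
      using rep_J_J'[of u] by eventually_elim auto
  qed measurable
  moreover have "AE x in lborel. rep_l1 (J (J' v)) x = G (rep_l1 (J (J' u))) x"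
  proof -
    have ker: "(\<integral>y. k x y * rep_l1 (J (J' u)) y \<partial>lborel) = (\<integral>y. k x y * rep_l1 u y \<partial>lborel)" for x
    proof (rule integral_cong_AE)
      show "AE y in lborel. k x y * rep_l1 (J (J' u)) y = k x y * rep_l1 u y"
        using rep_J_J'[of u] by eventually_elim (simp add: k_zero_right)
    qed measurable
    from rep_J_J'[of u] rep_J_J'[of v] eq show ?thesis
      by eventually_elim (simp add: G_def ker k_zero_left)
  qed
  ultimately show ?thesis by (simp add: graph_def)
qed

lemma norm_J_J'_diff: "norm (J (J' u) - J (J' v)) \<le> norm (u - v)"
proof -
  have "AE x in lborel. \<bar>rep_l1 (J (J' u) - J (J' v)) x\<bar> \<le> \<bar>rep_l1 (u - v) x\<bar>"
    using rep_J_J'[of u] rep_J_J'[of v] rep_l1_diff[of u v] rep_l1_diff[of "J (J' u)" "J (J' v)"]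
    by eventually_elim simp
  then show ?thesis
    unfolding norm_l1_rep by (intro integral_mono_AE) auto
qed

text \<open>One inclusion is closedness of the generator. For the other, approximants of
  \<open>J f\<close> and \<open>J g\<close> are pulled back by \<open>J'\<close>; erasing on the
  zero set of the weight does not increase distances and leaves both limits unchanged.\<close>

lemma operator_closure_iff:
  "(f, g) \<in> operator_closure M (operator_sum M (frag_A \<omega> a) (frag_B \<omega> a b)) \<longleftrightarrow>
    f \<in> L1 M \<and> g \<in> L1 M \<and> (J f, J g) \<in> semigroup.gen"
proof
  assume "(f, g) \<in> operator_closure M (operator_sum M (frag_A \<omega> a) (frag_B \<omega> a b))"
  then obtain F H where f: "f \<in> L1 M" and g: "g \<in> L1 M"
    and FH: "\<And>n::nat. (F n, H n) \<in> operator_sum M (frag_A \<omega> a) (frag_B \<omega> a b)"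
    and F_lim: "(\<lambda>n. L1_norm M (\<lambda>x. F n x - f x)) \<longlonglongrightarrow> 0"
    and H_lim: "(\<lambda>n. L1_norm M (\<lambda>x. H n x - g x)) \<longlonglongrightarrow> 0"
    unfolding operator_closure_def by auto
  have mem: "F n \<in> L1 M" "H n \<in> L1 M" "(J (F n), J (H n)) \<in> graph" for n
    using FH[of n] by (auto simp: operator_sum_iff)
  have "(\<lambda>n. J (F n) - J f) \<longlonglongrightarrow> 0"
    by (rule tendsto_norm_zero_cancel) (use F_lim in \<open>simp add: L1_norm_J L1_diff J_diff mem f\<close>)
  then have Jf: "(\<lambda>n. J (F n)) \<longlonglongrightarrow> J f" by (rule LIM_zero_cancel)
  have "(\<lambda>n. J (H n) - J g) \<longlonglongrightarrow> 0"
    by (rule tendsto_norm_zero_cancel) (use H_lim in \<open>simp add: L1_norm_J L1_diff J_diff mem g\<close>)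
  then have Jg: "(\<lambda>n. J (H n)) \<longlonglongrightarrow> J g" by (rule LIM_zero_cancel)
  have "(J f, J g) \<in> semigroup.gen"
    by (rule semigroup.gen_closed[OF graph_gen[OF mem(3)] Jf Jg])
  with f g show "f \<in> L1 M \<and> g \<in> L1 M \<and> (J f, J g) \<in> semigroup.gen" by simp
next
  assume "f \<in> L1 M \<and> g \<in> L1 M \<and> (J f, J g) \<in> semigroup.gen"
  then have f: "f \<in> L1 M" and g: "g \<in> L1 M" and gen: "(J f, J g) \<in> semigroup.gen" by auto
  from gen_graph_approx[OF gen] obtain U W where UW: "\<And>n::nat. (U n, W n) \<in> graph"
    and lim: "U \<longlonglongrightarrow> J f" "W \<longlonglongrightarrow> J g" by blast
  have "(\<lambda>n. L1_norm M (\<lambda>x. J' (V n) x - h x)) \<longlonglongrightarrow> 0" if h: "h \<in> L1 M" and V: "V \<longlonglongrightarrow> J h" for V h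
  proof (rule Lim_null_comparison[OF always_eventually])
    have "J (J' (J h)) = J h" by (rule J_J'[OF J_support[OF h]])
    then show "\<forall>n. norm (L1_norm M (\<lambda>x. J' (V n) x - h x)) \<le> norm (V n - J h)"
      using norm_J_J'_diff[of _ "J h"] by (simp add: L1_norm_J L1_diff J_diff J'_L1 h)
    show "(\<lambda>n. norm (V n - J h)) \<longlonglongrightarrow> 0" by (intro tendsto_norm_zero LIM_zero V)
  qed
  moreover have "(J' (U n), J' (W n)) \<in> operator_sum M (frag_A \<omega> a) (frag_B \<omega> a b)" for n
    unfolding operator_sum_iff using graph_J_J'[OF UW] by (simp add: J'_L1)
  ultimately show "(f, g) \<in> operator_closure M (operator_sum M (frag_A \<omega> a) (frag_B \<omega> a b))"
    unfolding operator_closure_def mem_Collect_eq prod.case using f g lim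
    by (intro conjI allI exI[of _ "\<lambda>n. J' (U n)"] exI[of _ "\<lambda>n. J' (W n)"])
qed

section \<open>The semigroup on the weighted space\<close>

definition S :: "real \<Rightarrow> (real \<Rightarrow> real) \<Rightarrow> real \<Rightarrow> real" where
  "S t f = J' (semigroup.T t (J f))"

lemma S_L1: "S t f \<in> L1 M"
  unfolding S_def by (rule J'_L1)

text \<open>\<open>J'\<close> loses nothing here, since the semigroup keeps functions zero on the
  zero set of the weight. All semigroup properties transfer through this identity.\<close>

lemma J_S:
  assumes "f \<in> L1 M" "0 \<le> t"
  shows "J (S t f) = semigroup.T t (J f)"
  unfolding S_def
proof (rule J_J')
  show "AE x in lborel. w x = 0 \<longrightarrow> rep_l1 (semigroup.T t (J f)) x = 0"
    using T_support[of "{x. w x \<noteq> 0}", OF _ assms(2), of "J f"] J_support[OF assms(1)] k_zero_left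
    by auto
qed

lemma substochastic_S: "substochastic_semigroup M S"
proof -
  note [simp] = S_L1 J_S L1_eq_iff_J L1_norm_J L1_add L1_diff L1_scale J_add J_diff J_scale
  have "bounded_operator M (S t)" if t: "0 \<le> t" for t
    unfolding bounded_operator_def
    using t semigroup.norm_T[OF t] linear_add[OF semigroup.linear_T[OF t]]
      linear_cmul[OF semigroup.linear_T[OF t]]
    by (auto intro!: exI[of _ 1])
  moreover have "((\<lambda>t. L1_norm M (\<lambda>x. S t f x - f x)) \<longlongrightarrow> 0) (at_right 0)" if f: "f \<in> L1 M" for f
  proof (rule Lim_transform_eventually)
    show "((\<lambda>t. norm (semigroup.T t (J f) - J f)) \<longlongrightarrow> 0) (at_right 0)"
      by (intro tendsto_norm_zero LIM_zero semigroup.T_tendsto_0)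
    show "\<forall>\<^sub>F t in at_right 0. norm (semigroup.T t (J f) - J f) = L1_norm M (\<lambda>x. S t f x - f x)"
      using eventually_at_right_less by (rule eventually_mono) (simp add: f)
  qed
  ultimately show ?thesis
    unfolding substochastic_semigroup_def positive_semigroup_def C0_semigroup_def
    using semigroup.T_0 semigroup.T_add semigroup.norm_T T_nonneg
    by (auto simp: L1_nonneg_J)
qed

lemma generator_S:
  "semigroup_generator M S = operator_closure M (operator_sum M (frag_A \<omega> a) (frag_B \<omega> a b))"
proof -
  have "((\<lambda>t. L1_norm M (\<lambda>x. (S t f x - f x) / t - g x)) \<longlongrightarrow> 0) (at_right 0) \<longleftrightarrow>
      (J f, J g) \<in> semigroup.gen" if f: "f \<in> L1 M" and g: "g \<in> L1 M" for f g
  proof -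
    have "L1_norm M (\<lambda>x. (S t f x - f x) / t - g x) =
        norm ((semigroup.T t (J f) - J f) /\<^sub>R t - J g)" if t: "0 < t" for t
    proof -
      have "(\<lambda>x. (S t f x - f x) / t - g x) = (\<lambda>x. inverse t * (S t f x - f x) - g x)"
        by (simp add: divide_inverse mult.commute)
      then show ?thesis
        using t f g S_L1[of t f] by (simp add: L1_norm_J L1_diff L1_scale J_diff J_scale J_S)
    qed
    then have "\<forall>\<^sub>F t in at_right 0. L1_norm M (\<lambda>x. (S t f x - f x) / t - g x) =
        norm ((semigroup.T t (J f) - J f) /\<^sub>R t - J g)"
      using eventually_at_right_less by (rule eventually_mono[rotated])
    from tendsto_cong[OF this, of 0] show ?thesis
      by (simp add: semigroup.gen_def tendsto_norm_zero_iff LIM_zero_iff)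
  qed
  then show ?thesis
    by (auto simp: semigroup_generator_def operator_closure_iff)
qed

lemma S_moment_invariant:
  assumes c: "mono_on {0..} c" "\<And>x. 0 < x \<Longrightarrow> 0 \<le> c x"
    and t: "0 \<le> t" and f: "f \<in> L1 (weighted (\<lambda>x. (1 + c x) * \<omega> x))"
  shows "S t f \<in> L1 (weighted (\<lambda>x. (1 + c x) * \<omega> x))"
proof -
  \<comment> \<open>Extended by 0, the weight is nonnegative and nondecreasing on the whole line,
    hence Borel, although \<open>c\<close> is not controlled for x \<le> 0.\<close>
  define v where "v x = (if 0 < x then 1 + c x else 0)" for x
  have v: "0 \<le> v x" for x using c(2)[of x] by (simp add: v_def)
  have v_mono: "v x \<le> v y" if "x < y" for x y
    using monotone_onD[OF c(1), of x y] c(2)[of y] that by (auto simp: v_def)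
  then have "mono v" by (auto simp: mono_def le_less)
  then have [measurable]: "v \<in> borel_measurable borel" by (rule borel_measurable_mono)
  have cv: "1 + c x = v x" if "0 < x" for x using that by (simp add: v_def)
  \<comment> \<open>The new weight is at least \<omega>, so the smaller space lies in the one on
    which the identity for \<open>J (S t f)\<close> holds.\<close>
  have "f \<in> L1 M"
  proof -
    have "(\<lambda>x. 1 + c x) \<in> borel_measurable (lebesgue_on {0<..})"
      by (rule borel_measurable_lebesgue_onI[of _ v]) (auto simp: cv)
    then have meas: "(\<lambda>x. (1 + c x) * \<omega> x) \<in> borel_measurable (lebesgue_on {0<..})"
      using \<omega>_measurable by simp
    have "(\<integral>\<^sup>+x. ennreal \<bar>f x * w x\<bar> \<partial>lborel) \<le>
        (\<integral>\<^sup>+x. ennreal ((1 + c x) * \<omega> x) * ennreal \<bar>f x\<bar> * indicator {0<..} x \<partial>lborel)"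
    proof (rule nn_integral_mono_AE)
      show "AE x in lborel. ennreal \<bar>f x * w x\<bar> \<le> ennreal ((1 + c x) * \<omega> x) * ennreal \<bar>f x\<bar> * indicator {0<..} x"
        using w_eq
      proof eventually_elim
        case (elim x)
        show ?case
        proof (cases "0 < x")
          case True
          then have "\<bar>f x * w x\<bar> \<le> (1 + c x) * \<omega> x * \<bar>f x\<bar>"
            using elim w_nonneg[of x] c(2)[of x] by (simp add: abs_mult mult.commute[of "\<bar>f x\<bar>"] mult_right_mono mult_le_cancel_right1 distrib_right)
          then show ?thesis using True by (simp add: ennreal_mult''[symmetric] ennreal_leI)
        qed (simp add: w_zero)
      qed
    qed
    then show ?thesis
      using f unfolding L1_iff L1_weighted_iff[OF meas] by (auto intro: le_less_trans)
  qed
  note iff = L1_weighted_moment[OF _ v _ cv]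
  have "l1_moment v (J (S t f)) \<le> l1_moment v (J f)"
    unfolding J_S[OF \<open>f \<in> L1 M\<close> t] by (rule T_moment[OF _ v v_mono t]) auto
  also have "\<dots> < \<infinity>" using f iff[OF _ \<open>f \<in> L1 M\<close>] by simp
  finally show ?thesis using iff[OF _ S_L1] by simp
qed

end

lemma AE_lborel_pair:
  assumes "AE p in (lborel :: (real \<times> real) measure). Q p"
  shows "AE x in lborel. AE y in lborel. Q (x, y)" "AE y in lborel. AE x in lborel. Q (x, y)"
proof -
  from assms obtain N :: "(real \<times> real) set" where N: "{p. \<not> Q p} \<subseteq> N" "emeasure lborel N = 0" "N \<in> sets lborel"
    by (auto elim!: AE_E)
  have [measurable]: "N \<in> sets (lborel \<Otimes>\<^sub>M lborel)"
    using N(3) unfolding lborel_prod .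
  have "AE p in lborel \<Otimes>\<^sub>M lborel. p \<notin> N"
    unfolding lborel_prod using N by (intro AE_not_in) auto
  then have AE_N: "AE x in lborel. AE y in lborel. (x, y) \<notin> N"
    by (rule lborel_pair.AE_pair)
  then show "AE x in lborel. AE y in lborel. Q (x, y)"
    using N(1) by (auto elim!: eventually_mono)
  have "AE y in lborel. AE x in lborel. (x, y) \<notin> N"
    using AE_N by (subst (asm) lborel_pair.AE_commute) measurable
  then show "AE y in lborel. AE x in lborel. Q (x, y)"
    using N(1) by (auto elim!: eventually_mono)
qed

text \<open>A negative value at \<open>x\<close> would spread by monotonicity to all of (0, x),
  which has positive measure. This removes the exceptional set left by a \<le> c.\<close>

lemma mono_on_AE_ge_nonneg:
  fixes c :: "real \<Rightarrow> real"
  assumes c: "mono_on {0..} c" and ac: "AE x in lborel. 0 < x \<longrightarrow> 0 \<le> c x" and x: "0 < x"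
  shows "0 \<le> c x"
proof (rule ccontr)
  assume neg: "\<not> 0 \<le> c x"
  have "AE z in lborel. z \<notin> {0<..<x}"
    using ac
  proof eventually_elim
    case (elim z)
    then show ?case using monotone_onD[OF c, of z x] neg by force
  qed
  then have "emeasure lborel {0<..<x} = 0"
    by (subst (asm) AE_iff_measurable[of "{0<..<x}"]) auto
  then show False using x by simp
qed

theorem theorem3p3:
  fixes a \<omega> :: "real \<Rightarrow> real" and b :: "real \<Rightarrow> real \<Rightarrow> real" and \<kappa> :: real
  assumes a_loc: "locally_Linf {0..} a"
    and a_nonneg: "AE x in lebesgue_on {0<..}. 0 \<le> a x"
    and b_meas: "(\<lambda>(x, y). b x y) \<in> borel_measurable (lebesgue_on ({0<..} \<times> {0<..}))"
    and b_nonneg: "\<And>x y. 0 < x \<Longrightarrow> 0 < y \<Longrightarrow> 0 \<le> b x y"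
    and b_zero: "AE (x, y) in lebesgue_on ({0<..} \<times> {0<..}). y < x \<longrightarrow> b x y = 0"
    and \<omega>_meas: "\<omega> \<in> borel_measurable (lebesgue_on {0..})"
    and \<omega>_nonneg: "\<And>x. 0 \<le> x \<Longrightarrow> 0 \<le> \<omega> x"
    and \<kappa>: "0 < \<kappa>" "\<kappa> \<le> 1"
    and b_\<omega>: "\<And>y. 0 < y \<Longrightarrow>
      (\<integral>\<^sup>+x\<in>{0<..<y}. ennreal (b x y * \<omega> x) \<partial>lebesgue) \<le> ennreal (\<kappa> * \<omega> y)"
  shows "\<exists>S. substochastic_semigroup (weighted \<omega>) S \<and>
      semigroup_generator (weighted \<omega>) S =
        operator_closure (weighted \<omega>) (operator_sum (weighted \<omega>) (frag_A \<omega> a) (frag_B \<omega> a b)) \<and>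
      (\<forall>c. mono_on {0..} c \<and> (AE x in lebesgue_on {0..}. a x \<le> c x) \<longrightarrow>
        (\<forall>t\<ge>0. \<forall>f\<in>L1 (weighted (\<lambda>x. (1 + c x) * \<omega> x)).
           S t f \<in> L1 (weighted (\<lambda>x. (1 + c x) * \<omega> x))))"
proof -
  have a_nonneg': "AE x in lborel. 0 < x \<longrightarrow> 0 \<le> a x"
    using a_nonneg by (simp add: AE_lebesgue_on_iff)
  have \<omega>_meas': "\<omega> \<in> borel_measurable (lebesgue_on {0<..})"
    by (rule measurable_restrict_mono[OF \<omega>_meas]) auto
  obtain w0 where [measurable]: "w0 \<in> borel_measurable borel"
    and w0: "AE x in lborel. x \<in> {0<..} \<longrightarrow> w0 x = \<omega> x"
    using lebesgue_on_borel_version[OF _ \<omega>_meas'] by auto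
  \<comment> \<open>Truncation makes the Borel version nonnegative everywhere, and the value 0 for x
    \<le> 0 turns restriction to the half-line into a property of the weight.\<close>
  define w where "w x = (if 0 < x then max 0 (w0 x) else 0)" for x
  have w_meas [measurable]: "w \<in> borel_measurable borel" unfolding w_def by measurable
  have w_nonneg: "0 \<le> w x" for x by (simp add: w_def)
  have w_eq: "AE x in lborel. 0 < x \<longrightarrow> w x = \<omega> x"
    using w0 by eventually_elim (use \<omega>_nonneg in \<open>auto simp: w_def max_def\<close>)

  have a_meas: "a \<in> borel_measurable (lebesgue_on {0<..})"
    by (rule measurable_restrict_mono[of _ _ "{0..}"]) (use a_loc in \<open>auto simp: locally_Linf_def\<close>)
  obtain a0 where [measurable]: "a0 \<in> borel_measurable borel"
    and a0: "AE x in lborel. x \<in> {0<..} \<longrightarrow> a0 x = a x"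
    using lebesgue_on_borel_version[OF _ a_meas] by auto
  have "\<exists>B. AE x in lborel. x \<in> {0..real n} \<longrightarrow> \<bar>a x\<bar> \<le> B" for n
  proof -
    have "compact {0..real n} \<and> {0..real n} \<subseteq> {0..}" by auto
    with a_loc obtain B where "AE x in lebesgue_on {0..real n}. \<bar>a x\<bar> \<le> B"
      unfolding locally_Linf_def by blast
    then show ?thesis by (subst (asm) AE_lebesgue_on_iff) auto
  qed
  then obtain B where B: "\<And>n. AE x in lborel. x \<in> {0..real n} \<longrightarrow> \<bar>a x\<bar> \<le> B n"
    by metis
  \<comment> \<open>\<open>R n\<close> divides by \<open>C n\<close>, so the essential bound is
    raised to at least 1.\<close>
  define C where "C n = max 1 (B n)" for n
  text \<open>Setting \<open>\<alpha>\<close> to \<open>0\<close> on the exceptional null set makes the local bounds hold everywhere.\<close>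
  define \<alpha> where "\<alpha> x = (if 0 < x \<and> (\<forall>n. x < real n \<longrightarrow> a0 x \<le> C n) then max 0 (a0 x) else 0)" for x
  have [measurable]: "\<alpha> \<in> borel_measurable borel" unfolding \<alpha>_def by measurable
  have C_pos: "0 < C n" for n by (simp add: C_def)
  have \<alpha>_le: "\<alpha> x \<le> C n" if "x < real n" for x n
    using that C_pos[of n] by (auto simp: \<alpha>_def)
  have \<alpha>_nonneg: "0 \<le> \<alpha> x" for x by (simp add: \<alpha>_def)
  have "AE x in lborel. \<forall>n. x \<in> {0..real n} \<longrightarrow> \<bar>a x\<bar> \<le> B n"
    unfolding AE_all_countable using B by blast
  with a0 a_nonneg' have \<alpha>_eq: "AE x in lborel. 0 < x \<longrightarrow> \<alpha> x = a x"
  proof eventually_elim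
    case (elim x)
    show ?case
    proof
      assume x: "0 < x"
      have "a0 x \<le> C n" if "x < real n" for n
        using elim(1) elim(3)[rule_format, of n] x that by (simp add: C_def)
      then show "\<alpha> x = a x"
        using elim(1,2) x by (simp add: \<alpha>_def)
    qed
  qed

  have Q: "{0<..} \<times> {0<..} \<in> sets (lebesgue :: (real \<times> real) measure)"
    by (intro sets_completionI_sets) (auto intro!: borel_open open_Times)
  obtain b0 where b0_meas: "b0 \<in> borel_measurable (borel :: (real \<times> real) measure)"
    and b0: "AE p in lborel. p \<in> {0<..} \<times> {0<..} \<longrightarrow> b0 p = (case p of (x, y) \<Rightarrow> b x y)"
    using lebesgue_on_borel_version[OF Q b_meas] .
  define \<beta> where "\<beta> x y = max 0 (b0 (x, y))" for x y
  have [measurable]: "b0 \<in> borel_measurable (borel \<Otimes>\<^sub>M borel)"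
    using b0_meas by (simp add: borel_prod)
  have \<beta>_meas [measurable]: "(\<lambda>(x, y). \<beta> x y) \<in> borel_measurable (borel \<Otimes>\<^sub>M borel)"
    unfolding \<beta>_def by measurable
  have \<beta>_nonneg: "0 \<le> \<beta> x y" for x y by (simp add: \<beta>_def)
  have "AE p in lborel. 0 < fst p \<longrightarrow> 0 < snd p \<longrightarrow> \<beta> (fst p) (snd p) = b (fst p) (snd p)"
    using b0 by eventually_elim (use b_nonneg in \<open>auto simp: \<beta>_def max_def\<close>)
  from AE_lborel_pair[OF this]
  have \<beta>_eq: "AE x in lborel. AE y in lborel. 0 < x \<longrightarrow> 0 < y \<longrightarrow> \<beta> x y = b x y"
    and \<beta>_eq': "AE y in lborel. AE x in lborel. 0 < x \<longrightarrow> 0 < y \<longrightarrow> \<beta> x y = b x y"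
    by simp_all

  \<comment> \<open>Passing to Borel versions costs a null set of \<open>y\<close>, and \<kappa>
    \<le> 1 is absorbed into the weight.\<close>
  have \<beta>_column: "AE y in lborel. 0 < y \<longrightarrow>
      (\<integral>\<^sup>+x. ennreal (\<beta> x y * w x) * indicator {0<..<y} x \<partial>lborel) \<le> ennreal (w y)"
    using \<beta>_eq' w_eq
  proof eventually_elim
    case (elim y)
    show ?case
    proof
      assume y: "0 < y"
      have "(\<integral>\<^sup>+x. ennreal (\<beta> x y * w x) * indicator {0<..<y} x \<partial>lborel) =
          (\<integral>\<^sup>+x. ennreal (b x y * \<omega> x) * indicator {0<..<y} x \<partial>lborel)"
      proof (rule nn_integral_cong_AE)
        from elim(1) w_eq show "AE x in lborel. ennreal (\<beta> x y * w x) * indicator {0<..<y} x =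
            ennreal (b x y * \<omega> x) * indicator {0<..<y} x"
          by eventually_elim (use y in \<open>auto simp: indicator_def\<close>)
      qed
      also have "\<dots> \<le> ennreal (\<kappa> * \<omega> y)"
        using b_\<omega>[OF y] by (simp add: nn_integral_completion)
      also have "\<dots> \<le> ennreal (w y)"
        using elim(2) y \<kappa> \<omega>_nonneg[of y] by (intro ennreal_leI) (simp add: mult_left_le_one_le)
      finally show "(\<integral>\<^sup>+x. ennreal (\<beta> x y * w x) * indicator {0<..<y} x \<partial>lborel) \<le> ennreal (w y)" .
    qed
  qed
  \<comment> \<open>Where \<open>w y = 0\<close> the column bound is 0, so the nonnegative integrand
    vanishes for almost every \<open>x\<close>.\<close>
  have "AE y in lborel. AE x in lborel. w x \<noteq> 0 \<longrightarrow> x < y \<longrightarrow> w y = 0 \<longrightarrow> \<beta> x y = 0"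
    using \<beta>_column
  proof eventually_elim
    case (elim y)
    show ?case
    proof (cases "0 < y \<and> w y = 0")
      case True
      then have "(\<integral>\<^sup>+x. ennreal (\<beta> x y * w x) * indicator {0<..<y} x \<partial>lborel) = 0"
        using elim by simp
      then have "AE x in lborel. ennreal (\<beta> x y * w x) * indicator {0<..<y} x = 0"
        by (subst (asm) nn_integral_0_iff_AE) auto
      then show ?thesis
      proof eventually_elim
        case (elim x)
        then show ?case
          using \<beta>_nonneg[of x y] w_nonneg[of x]
          by (cases "0 < x") (auto simp: indicator_def w_def ennreal_eq_0_iff mult_le_0_iff split: if_splits)
      qed
    qed (auto simp: w_def)
  qed
  \<comment> \<open>The locale fixes \<open>x\<close> first; joint measurability of the condition
    allows the exchange of the two quantifiers.\<close>
  then have \<beta>_null: "AE x in lborel. AE y in lborel. w x \<noteq> 0 \<longrightarrow> x < y \<longrightarrow> w y = 0 \<longrightarrow> \<beta> x y = 0"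
    by (subst lborel_pair.AE_commute) measurable

  define k where "k x y = (if 0 < x \<and> x < y then \<alpha> y * \<beta> x y * w x / w y else 0)" for x y
  have k_meas: "(\<lambda>(x, y). k x y) \<in> borel_measurable (borel \<Otimes>\<^sub>M borel)"
    unfolding k_def by measurable
  have k_column: "AE y in lborel. (\<integral>\<^sup>+x. ennreal (k x y) \<partial>lborel) \<le> ennreal (\<alpha> y)"
    using \<beta>_column
  proof eventually_elim
    case (elim y)
    show ?case
    proof (cases "w y = 0")
      case True
      then have "k x y = 0" for x by (simp add: k_def)
      then show ?thesis by simp
    next
      case False
      then have y: "0 < y" "0 < w y" using w_nonneg[of y] by (auto simp: w_def split: if_splits)
      have "(\<integral>\<^sup>+x. ennreal (k x y) \<partial>lborel) =
          (\<integral>\<^sup>+x. ennreal (\<alpha> y / w y) * (ennreal (\<beta> x y * w x) * indicator {0<..<y} x) \<partial>lborel)"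
        using \<alpha>_nonneg[of y] \<beta>_nonneg w_nonneg y
        by (intro nn_integral_cong) (auto simp: k_def indicator_def ennreal_mult[symmetric])
      also have "\<dots> = ennreal (\<alpha> y / w y) * (\<integral>\<^sup>+x. ennreal (\<beta> x y * w x) * indicator {0<..<y} x \<partial>lborel)"
        by (rule nn_integral_cmult) measurable
      also have "\<dots> \<le> ennreal (\<alpha> y / w y) * ennreal (w y)"
        using elim y by (intro mult_left_mono) auto
      also have "\<dots> = ennreal (\<alpha> y)"
        using y \<alpha>_nonneg[of y] by (simp add: ennreal_mult[symmetric])
      finally show ?thesis .
    qed
  qed

  interpret weighted_fragmentation \<omega> w k \<alpha> C a b \<beta>
  proof
    show "w x = 0" if "x \<le> 0" for x using that by (simp add: w_def)
    show "0 \<le> k x y" for x y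
      using \<alpha>_nonneg \<beta>_nonneg w_nonneg by (simp add: k_def)
    show "k x y = 0" if "y \<le> x" for x y using that by (simp add: k_def)
  qed (use \<omega>_meas' w_meas w_nonneg w_eq k_meas \<alpha>_nonneg C_pos \<alpha>_le k_column \<alpha>_eq \<beta>_meas \<beta>_eq \<beta>_null
        in \<open>auto simp: k_def\<close>)

  show ?thesis
  proof (intro exI[of _ S] conjI allI impI ballI)
    show "substochastic_semigroup M S" by (rule substochastic_S)
    show "semigroup_generator M S = operator_closure M (operator_sum M (frag_A \<omega> a) (frag_B \<omega> a b))"
      by (rule generator_S)
    fix c f :: "real \<Rightarrow> real" and t :: real
    assume c: "mono_on {0..} c \<and> (AE x in lebesgue_on {0..}. a x \<le> c x)" and t: "0 \<le> t"
      and f: "f \<in> L1 (weighted (\<lambda>x. (1 + c x) * \<omega> x))"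
    then have "AE x in lborel. x \<in> {0..} \<longrightarrow> a x \<le> c x" by (simp add: AE_lebesgue_on_iff)
    with a_nonneg' have "AE x in lborel. 0 < x \<longrightarrow> 0 \<le> c x"
      by eventually_elim auto
    with c have "0 \<le> c x" if "0 < x" for x
      using mono_on_AE_ge_nonneg that by blast
    with c t f show "S t f \<in> L1 (weighted (\<lambda>x. (1 + c x) * \<omega> x))"
      using S_moment_invariant by blast
  qed
qed

end
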